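(* Let $\mu>0$ be fixed and let $a,b,g,R$ be $1$-periodic parameters satisfying (A1)--(A6) of the context. Let $\varepsilon_0>0$ and let $\{(c^\varepsilon,v^\varepsilon,u^\varepsilon)\}_{\varepsilon\in(0,\varepsilon_0]}$ be a family such that, for each $\varepsilon\in(0,\varepsilon_0]$, $(c^\varepsilon,v^\varepsilon,u^\varepsilon)$ is an $\varepsilon$-periodic solution with curvature coefficient $\mu$ (as defined in the context) and $\frac1\varepsilon\int_0^\varepsilon v^\varepsilon=0$. Then for all $y\in\mathbb{R}$ and $\varepsilon\in(0,\varepsilon_0]$, $$v^\varepsilon(y)=\varepsilon^2\,Q\Big(\frac y\varepsilon\Big)+o(\varepsilon^2),$$ where $Q\in W^{2,\infty}(\mathbb{R})$ is the function defined by $$Q_{zz}(z)=\frac1\mu\Big\{R\Big(z,\frac{\overline g}{\overline b}\Big)-\int_0^1R\Big(t,\frac{\overline g}{\overline b}\Big)dt\Big\},\qquad Q(z+1)=Q(z),\qquad\int_0^1Q=0,$$ and where $\frac{o(\varepsilon^2)}{\varepsilon^2}\to0$ in $L^p_{loc}(\mathbb{R})$ as $\varepsilon\downarrow0$ for every $p\in[1,+\infty)$; that is, for every fixed $p\in[1,+\infty)$ and $r>0$, $\frac1{\varepsilon^2}\big(\int_{-r}^r|o(\varepsilon^2)|^p\,dy\big)^{1/p}\to0$. If in addition the function $T\in\mathbb{R}^+\mapsto R(\cdot,T)\in L^\infty(\mathbb{R})$ is continuous at $T=\frac{\overline g}{\overline b}$, then $\frac{o(\varepsilon^2)}{\varepsilon^2}\to0$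 in $L^\infty(\mathbb{R})$.
   Context: $\mathbb{R}^+=(0,+\infty)$; $\overline f=\int_0^1f$ for a $1$-periodic function $f$. Assumptions on the parameters. For each $f=a,b,g$: (A1) $f:\mathbb{R}\to\mathbb{R}$ is measurable and $1$-periodic; (A2) there are constants $f_M\ge f_m>0$ with $f_M\ge f(y)\ge f_m$ for a.e. $y$. The function $R:\mathbb{R}\times\mathbb{R}^+\to\mathbb{R}^+$ satisfies: (A3) for a.e. $y$, $T\mapsto R(y,T)$ is continuous and nondecreasing; (A4) for each $T>0$, $y\mapsto R(y,T)$ is measurable and $1$-periodic; (A5) there is a constant $R_M>0$ such that $R_M\ge R(y,T)>0$ for a.e. $y$ and all $T>0$; (A6) for every $T>0$, $\operatorname{ess\,inf}_{y}R(y,T)>0$. $\varepsilon$-periodic solution with curvature coefficient $\mu$: a triplet $(c^\varepsilon,v^\varepsilon,u^\varepsilon)$ with $c^\varepsilon\in\mathbb{R}$; $v^\varepsilon\in W^{2,\infty}(\mathbb{R})$ $\varepsilon$-periodic; and, with $\Omega^\varepsilon=\{(x,y):x<v^\varepsilon(y)\}$ and $\Omega^\varepsilon_{per}=\Omega^\varepsilon\cap\{0<y<\varepsilon\}$, $u^\varepsilon\in H^1_{per}(\Omega^\varepsilon)$, $u^\varepsilon\ge0$, where $H^1_{per}(\Omega^\varepsilon)$ is the space of $u\in L^1_{loc}(\overline{\Omega^\varepsilon})$ that are $\varepsilon$-periodic in $y$ with $\int_{\Omega^\varepsilon_{per}}(u^2+|\nabla u|^2)<\infty$; such that for all $w\in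 H^1_{per}(\Omega^\varepsilon)$ $$\int_{\Omega^\varepsilon_{per}}\Big(c^\varepsilon b\big(\tfrac y\varepsilon\big)u^\varepsilon_x\,w+a\big(\tfrac y\varepsilon\big)\nabla u^\varepsilon\cdot\nabla w\Big)dx\,dy=\int_0^\varepsilon c^\varepsilon g\big(\tfrac y\varepsilon\big)\,w(v^\varepsilon(y),y)\,dy,$$ and for a.e. $y\in\mathbb{R}$ $$-c^\varepsilon+R\Big(\frac y\varepsilon,u^\varepsilon(v^\varepsilon(y),y)\Big)\sqrt{1+(v^\varepsilon_y)^2}=\mu\,\frac{v^\varepsilon_{yy}}{1+(v^\varepsilon_y)^2}.$$ Values of $u^\varepsilon,w$ at $(v^\varepsilon(y),y)$ are traces; as $R(y,T)$ is defined only for $T>0$, the last equation is understood to include that $u^\varepsilon(v^\varepsilon(y),y)>0$ for a.e. $y$. *)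

theory Defs
  imports "HOL-Analysis.Analysis" "HOL-Probability.Essential_Supremum"
begin

section \<open>Lebesgue and Sobolev spaces\<close>

definition Linf_norm :: "(real \<Rightarrow> real) \<Rightarrow> ereal" where
  "Linf_norm f = esssup lebesgue (\<lambda>y. ereal \<bar>f y\<bar>)"

definition Linf :: "(real \<Rightarrow> real) set" where
  "Linf = {f. f \<in> borel_measurable lebesgue \<and> Linf_norm f < \<infinity>}"

definition essinf :: "(real \<Rightarrow> real) \<Rightarrow> ereal" where
  "essinf f = - esssup lebesgue (\<lambda>y. ereal (- f y))"

definition loc_integrable_on ::
    "('a::euclidean_space \<Rightarrow> 'b::euclidean_space) \<Rightarrow> 'a set \<Rightarrow> bool" where
  "loc_integrable_on f S \<longleftrightarrow> (\<forall>K. compact K \<and> K \<subseteq> S \<longrightarrow> set_integrable lebesgue K f)"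

definition C1_gradient :: "('a::euclidean_space \<Rightarrow> real) \<Rightarrow> ('a \<Rightarrow> 'a) \<Rightarrow> bool" where
  "C1_gradient \<phi> D \<longleftrightarrow> (\<forall>z. GDERIV \<phi> z :> D z) \<and> continuous_on UNIV D"

text \<open>
  Weak gradients on an open set \<open>U\<close>, tested against \<open>C\<^sup>1\<close> functions with compact support in
  \<open>U\<close> as in Brezis' textbook; by mollification this is the same as testing against smooth ones.
  The identity is an equation between vectors, one component for each partial derivative. On
  the real line the gradient is the derivative.
\<close>

definition has_weak_gradient_on ::
    "('a::euclidean_space \<Rightarrow> real) \<Rightarrow> ('a \<Rightarrow> 'a) \<Rightarrow> 'a set \<Rightarrow> bool" where
  "has_weak_gradient_on u G U \<longleftrightarrow>
     loc_integrable_on u U \<and> loc_integrable_on G U \<and>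
     (\<forall>\<phi> D. C1_gradient \<phi> D \<and> (\<exists>K. compact K \<and> K \<subseteq> U \<and> (\<forall>z. z \<notin> K \<longrightarrow> \<phi> z = 0)) \<longrightarrow>
        (LINT z:U|lebesgue. u z *\<^sub>R D z) = - (LINT z:U|lebesgue. \<phi> z *\<^sub>R G z))"

text \<open>
  \<open>W2inf f p q\<close>: the function \<open>f\<close> is the continuous representative of an element of
  \<open>W\<^sup>2\<^sup>,\<^sup>\<infinity>(\<real>)\<close> with weak derivatives \<open>p\<close> and \<open>q\<close> of order one and two (both unique up to null sets).
\<close>

definition W2inf :: "(real \<Rightarrow> real) \<Rightarrow> (real \<Rightarrow> real) \<Rightarrow> (real \<Rightarrow> real) \<Rightarrow> bool" where
  "W2inf f p q \<longleftrightarrow>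
     continuous_on UNIV f \<and> f \<in> Linf \<and> p \<in> Linf \<and> q \<in> Linf \<and>
     has_weak_gradient_on f p UNIV \<and> has_weak_gradient_on p q UNIV"


section \<open>Assumptions on the parameters\<close>

definition mean :: "(real \<Rightarrow> real) \<Rightarrow> real" where
  "mean f = (LINT t:{0..1}|lebesgue. f t)"

definition admissible_coeff :: "(real \<Rightarrow> real) \<Rightarrow> bool" where
  "admissible_coeff f \<longleftrightarrow>
     f \<in> borel_measurable lebesgue \<and> (\<forall>y. f (y + 1) = f y) \<and>
     (\<exists>fM fm. fM \<ge> fm \<and> fm > 0 \<and> (AE y in lebesgue. fM \<ge> f y \<and> f y \<ge> fm))"

text \<open>Only the values \<open>R y T\<close> with \<open>T > 0\<close> are meaningful.\<close>

definition admissible_R :: "(real \<Rightarrow> real \<Rightarrow> real) \<Rightarrow> bool" where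
  "admissible_R R \<longleftrightarrow>
     (\<forall>y. \<forall>T>0. R y T > 0) \<and>
     (AE y in lebesgue. continuous_on {0<..} (R y) \<and> mono_on {0<..} (R y)) \<and>
     (\<forall>T>0. (\<lambda>y. R y T) \<in> borel_measurable lebesgue \<and> (\<forall>y. R (y + 1) T = R y T)) \<and>
     (\<exists>RM>0. AE y in lebesgue. \<forall>T>0. RM \<ge> R y T \<and> R y T > 0) \<and>
     (\<forall>T>0. essinf (\<lambda>y. R y T) > 0)"


section \<open>Periodic solutions\<close>

text \<open>A point of the plane is a pair \<open>(x, y)\<close>.\<close>

definition Dom :: "(real \<Rightarrow> real) \<Rightarrow> (real \<times> real) set" where
  "Dom v = {(x, y). x < v y}"

definition Dom_per :: "real \<Rightarrow> (real \<Rightarrow> real) \<Rightarrow> (real \<times> real) set" where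
  "Dom_per \<epsilon> v = Dom v \<inter> {(x, y). 0 < y \<and> y < \<epsilon>}"

text \<open>\<open>H1_per \<epsilon> v u G\<close>: the function \<open>u\<close> belongs to \<open>H\<^sup>1\<^sub>p\<^sub>e\<^sub>r\<close> of \<open>Dom v\<close> and has weak gradient \<open>G\<close>.\<close>

definition H1_per ::
    "real \<Rightarrow> (real \<Rightarrow> real) \<Rightarrow> (real \<times> real \<Rightarrow> real) \<Rightarrow> (real \<times> real \<Rightarrow> real \<times> real) \<Rightarrow> bool" where
  "H1_per \<epsilon> v u G \<longleftrightarrow>
     loc_integrable_on u (closure (Dom v)) \<and>
     (AE (x, y) in lebesgue. (x, y) \<in> Dom v \<longrightarrow> u (x, y + \<epsilon>) = u (x, y)) \<and>
     has_weak_gradient_on u G (Dom v) \<and>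
     set_integrable lebesgue (Dom_per \<epsilon> v) (\<lambda>z. (u z)\<^sup>2 + (norm (G z))\<^sup>2)"

text \<open>
  \<open>is_trace \<epsilon> v u G \<tau>\<close>: the trace of \<open>u\<close> (with weak gradient \<open>G\<close>) at the point \<open>(v y, y)\<close> is \<open>\<tau> y\<close>,
  for almost every \<open>y\<close>. As usual, the trace is the extension by continuity of the restriction map from
  functions that are \<open>C\<^sup>1\<close> up to the boundary: it is the \<open>L\<^sup>2\<close> limit of the boundary values of such
  functions converging to \<open>u\<close> in \<open>H\<^sup>1\<close>.
\<close>

definition is_trace ::
    "real \<Rightarrow> (real \<Rightarrow> real) \<Rightarrow> (real \<times> real \<Rightarrow> real) \<Rightarrow> (real \<times> real \<Rightarrow> real \<times> real) \<Rightarrow>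
     (real \<Rightarrow> real) \<Rightarrow> bool" where
  "is_trace \<epsilon> v u G \<tau> \<longleftrightarrow>
     H1_per \<epsilon> v u G \<and>
     \<tau> \<in> borel_measurable lebesgue \<and>
     set_integrable lebesgue {0<..<\<epsilon>} (\<lambda>y. (\<tau> y)\<^sup>2) \<and>
     (AE y in lebesgue. \<tau> (y + \<epsilon>) = \<tau> y) \<and>
     (\<exists>\<phi> D. (\<forall>n::nat. C1_gradient (\<phi> n) (D n) \<and> H1_per \<epsilon> v (\<phi> n) (D n)) \<and>
        (\<lambda>n. LINT z:Dom_per \<epsilon> v|lebesgue. (\<phi> n z - u z)\<^sup>2 + (norm (D n z - G z))\<^sup>2) \<longlonglongrightarrow> 0 \<and>
        (\<lambda>n. LINT y:{0<..<\<epsilon>}|lebesgue. (\<phi> n (v y, y) - \<tau> y)\<^sup>2) \<longlonglongrightarrow> 0)"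

text \<open>
  Weak derivatives and traces are unique up to null sets, so it does not matter which ones are used
  for \<open>v\<close>, \<open>u\<close> and the test function \<open>w\<close>.
\<close>

definition periodic_solution ::
    "real \<Rightarrow> (real \<Rightarrow> real) \<Rightarrow> (real \<Rightarrow> real) \<Rightarrow> (real \<Rightarrow> real) \<Rightarrow> (real \<Rightarrow> real \<Rightarrow> real) \<Rightarrow>
     real \<Rightarrow> real \<Rightarrow> (real \<Rightarrow> real) \<Rightarrow> (real \<times> real \<Rightarrow> real) \<Rightarrow> bool" where
  "periodic_solution \<mu> a b g R \<epsilon> c v u \<longleftrightarrow>
     (\<forall>y. v (y + \<epsilon>) = v y) \<and>
     (AE z in lebesgue. z \<in> Dom v \<longrightarrow> u z \<ge> 0) \<and>
     (\<exists>vy vyy G \<tau>.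
        W2inf v vy vyy \<and> H1_per \<epsilon> v u G \<and> is_trace \<epsilon> v u G \<tau> \<and>
        (\<forall>w H \<sigma>. H1_per \<epsilon> v w H \<and> is_trace \<epsilon> v w H \<sigma> \<longrightarrow>
           (LINT z:Dom_per \<epsilon> v|lebesgue.
              c * b (snd z / \<epsilon>) * fst (G z) * w z + a (snd z / \<epsilon>) * (G z \<bullet> H z)) =
           (LINT y:{0<..<\<epsilon>}|lebesgue. c * g (y / \<epsilon>) * \<sigma> y)) \<and>
        (AE y in lebesgue. \<tau> y > 0 \<and>
           - c + R (y / \<epsilon>) (\<tau> y) * sqrt (1 + (vy y)\<^sup>2) = \<mu> * (vyy y / (1 + (vy y)\<^sup>2))))"


section \<open>The limit profile\<close>

definition is_profile :: "real \<Rightarrow> (real \<Rightarrow> real \<Rightarrow> real) \<Rightarrow> real \<Rightarrow> (real \<Rightarrow> real) \<Rightarrow> bool" where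
  "is_profile \<mu> R T Q \<longleftrightarrow>
     (\<exists>Qz. W2inf Q Qz (\<lambda>z. 1 / \<mu> * (R z T - mean (\<lambda>t. R t T)))) \<and>
     (\<forall>z. Q (z + 1) = Q z) \<and> mean Q = 0"

end

theory Submission
  imports Defs
begin

text \<open>
  Write \<open>\<tau>\<close> for the trace of the temperature on the front, \<open>c\<close> for the speed, \<open>T\<close> for the quotient of the means of
  \<open>g\<close> and \<open>b\<close>, and \<open>R\<^sub>M\<close> for the upper bound of \<open>R\<close>.

  The geometry comes first. Dividing the curvature equation by \<open>sqrt (1 + v\<^sub>y\<^sup>2)\<close> turns its right hand side into \<open>\<mu>\<close> times the
  derivative of \<open>v\<^sub>y / sqrt (1 + v\<^sub>y\<^sup>2)\<close>, the sine of the slope angle, and its left hand side into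
  \<open>R - c / sqrt (1 + v\<^sub>y\<^sup>2)\<close>. The integral over a period vanishes, so \<open>c\<close> is positive and both terms have the same
  integral, at most \<open>R\<^sub>M \<epsilon>\<close>. Hence the sine varies by at most \<open>2 R\<^sub>M \<epsilon> / \<mu>\<close> over a period; it has a zero, so the slope is
  \<open>O(\<epsilon>)\<close> and \<open>c\<close> is bounded (\<open>front_bounds\<close>). Consequently \<open>\<mu> v\<^sub>y\<^sub>y = R(y / \<epsilon>, \<tau>) - c + O(\<epsilon>\<^sup>2)\<close>.

  Next, the temperature on the front is almost constant. Testing with \<open>exp (\<delta> x)\<close> and letting \<open>\<delta>\<close> tend to zero
  gives that \<open>b \<tau>\<close> and \<open>g\<close> have the same integral (\<open>heat_balance\<close>). Testing with \<open>u\<close> itself, the convection term has a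
  sign, and the Dirichlet energy of a cell of width \<open>\<epsilon>\<close> is \<open>O(\<epsilon>)\<close> (\<open>dirichlet_energy_bound\<close>). A trace inequality on the
  curved square of side \<open>\<epsilon>\<close> behind the front (\<open>C1_trace_oscillation\<close>) then bounds the squared \<open>L\<^sup>2\<close> distance of \<open>\<tau>\<close> to a
  constant by \<open>O(\<epsilon>\<^sup>2)\<close>, and the balance identifies that constant as \<open>T\<close> up to a further error of the same order. In
  the variable \<open>z = y / \<epsilon>\<close>, with a period of length one, this squared distance is \<open>O(\<epsilon>)\<close>.

  Since \<open>R\<close> is continuous and nondecreasing in \<open>T\<close>, the functions \<open>R(z, \<tau>(\<epsilon> z))\<close> converge to \<open>R(z, T)\<close> in \<open>L\<^sup>1\<close> of a
  period (\<open>nonlinearity_distance\<close>). So the second derivative of \<open>v(\<epsilon> z) / \<epsilon>\<^sup>2 - Q(z)\<close> tends to zero in \<open>L\<^sup>1\<close>, and a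
  periodic function of mean zero is bounded by the integral of the modulus of its second derivative
  (\<open>periodic_mean_zero_sup_bound\<close>). The remainder is therefore \<open>o(\<epsilon>\<^sup>2)\<close> uniformly in \<open>y\<close> (\<open>uniform_convergence\<close>), and a
  uniform bound controls the norms of \<open>L\<^sup>p\<close> on bounded intervals and of \<open>L\<^sup>\<infinity>\<close>.
\<close>

section \<open>Primitives of bounded functions\<close>

text \<open>
  A Lipschitz function with its almost everywhere derivative, described by the fundamental theorem of calculus only.
  The derivative is merely Lebesgue measurable, and no statement about pointwise derivatives of \<open>P\<close> is involved.
\<close>

definition bounded_primitive :: "(real \<Rightarrow> real) \<Rightarrow> (real \<Rightarrow> real) \<Rightarrow> bool" where
  "bounded_primitive P q \<longleftrightarrow>
     q \<in> borel_measurable lebesgue \<and> (\<exists>M. AE x in lebesgue. \<bar>q x\<bar> \<le> M) \<and>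
     (\<forall>x y. x \<le> y \<longrightarrow> P y - P x = (LINT t:{x..y}|lebesgue. q t))"

lemma borel_measurable_lebesgueI:
  "f \<in> borel_measurable borel \<Longrightarrow> f \<in> borel_measurable lebesgue"
  by (intro measurable_completion) simp

lemma set_integrable_ess_bounded:
  fixes q :: "'a::euclidean_space \<Rightarrow> real"
  assumes [measurable]: "q \<in> borel_measurable lebesgue" and "AE x in lebesgue. \<bar>q x\<bar> \<le> M"
    and S: "S \<in> lmeasurable"
  shows "set_integrable lebesgue S q"
  unfolding set_integrable_def
proof (rule Bochner_Integration.integrable_bound)
  have [measurable]: "S \<in> sets lebesgue" using S by (simp add: fmeasurable_def)
  show "integrable lebesgue (\<lambda>x. indicator S x * \<bar>M\<bar>)"
    using S by (intro integrable_mult_left) (auto simp: fmeasurable_def)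
  show "(\<lambda>x. indicator S x *\<^sub>R q x) \<in> borel_measurable lebesgue" by measurable
  show "AE x in lebesgue. norm (indicator S x *\<^sub>R q x) \<le> norm (indicator S x * \<bar>M\<bar>)"
    using assms(2) by eventually_elim (auto simp: indicator_def)
qed


lemma set_integral_abs_le_const:
  fixes q :: "real \<Rightarrow> real"
  assumes q [measurable]: "q \<in> borel_measurable lebesgue"
    and b: "AE x in lebesgue. x \<in> {a..b} \<longrightarrow> \<bar>q x\<bar> \<le> M" and "a \<le> b"
  shows "\<bar>LINT t:{a..b}|lebesgue. q t\<bar> \<le> M * (b - a)"
proof -
  have i: "integrable lebesgue (\<lambda>t. indicat_real {a..b} t * M)"
    by (intro integrable_mult_left) (auto simp: integrable_indicator_iff emeasure_lborel_Icc_eq)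
  have iq: "integrable lebesgue (\<lambda>t. indicat_real {a..b} t *\<^sub>R q t)"
    using i
  proof (rule Bochner_Integration.integrable_bound)
    show "(\<lambda>t. indicat_real {a..b} t *\<^sub>R q t) \<in> borel_measurable lebesgue"
      using q by (intro borel_measurable_scaleR borel_measurable_indicator) auto
  qed (use b in \<open>auto simp: indicator_def\<close>)
  have "\<bar>LINT t:{a..b}|lebesgue. q t\<bar> \<le> (\<integral>t. \<bar>indicat_real {a..b} t *\<^sub>R q t\<bar> \<partial>lebesgue)"
    unfolding set_lebesgue_integral_def by (rule integral_abs_bound)
  also have "\<dots> \<le> (\<integral>t. indicat_real {a..b} t * M \<partial>lebesgue)"
    using iq i by (intro integral_mono_AE integrable_abs) (use b in \<open>auto simp: indicator_def\<close>)
  finally show ?thesis using assms(3) by (simp add: mult.commute)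
qed

lemma set_integral_Icc_split:
  fixes q :: "real \<Rightarrow> real"
  assumes "set_integrable lebesgue {x..z} q" "x \<le> y" "y \<le> z"
  shows "(LINT t:{x..z}|lebesgue. q t) = (LINT t:{x..y}|lebesgue. q t) + (LINT t:{y..z}|lebesgue. q t)"
proof -
  have "set_integrable lebesgue {x..y} q" "set_integrable lebesgue {y..z} q"
    using assms by (auto intro: set_integrable_subset)
  with assms show ?thesis
    using Henstock_Kurzweil_Integration.integral_combine[of x y z q] set_lebesgue_integral_eq_integral
    by (metis)
qed

lemma set_integrable_continuous_times_ess_bounded:
  fixes q w :: "real \<Rightarrow> real"
  assumes [measurable]: "q \<in> borel_measurable lebesgue" and q: "AE x in lebesgue. \<bar>q x\<bar> \<le> M"
    and w: "continuous_on {x..y} w"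
  shows "set_integrable lebesgue {x..y} (\<lambda>t. w t * q t)"
proof -
  have "bounded (w ` {x..y})"
    using w compact_continuous_image compact_imp_bounded by blast
  then obtain K where K: "\<And>t. t \<in> {x..y} \<Longrightarrow> \<bar>w t\<bar> \<le> K"
    unfolding bounded_iff by force
  have [measurable]: "(\<lambda>t. indicator {x..y} t *\<^sub>R w t) \<in> borel_measurable lebesgue"
    using w by (intro borel_measurable_lebesgueI borel_measurable_continuous_on_indicator) auto
  then have m: "(\<lambda>t. (indicator {x..y} t *\<^sub>R w t) * q t) \<in> borel_measurable lebesgue"
    using assms(1) by (intro borel_measurable_times) auto
  have "set_integrable lebesgue {x..y} (\<lambda>t. (indicator {x..y} t *\<^sub>R w t) * q t)"
  proof (rule set_integrable_ess_bounded)
    show "AE t in lebesgue. \<bar>(indicator {x..y} t *\<^sub>R w t) * q t\<bar> \<le> \<bar>K\<bar> * M"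
      using q
    proof eventually_elim
      case (elim t)
      have "\<bar>indicator {x..y} t *\<^sub>R w t\<bar> \<le> \<bar>K\<bar>"
        using K[of t] by (auto simp: indicator_def)
      then show ?case using elim by (auto simp: abs_mult intro!: mult_mono)
    qed
  qed (use m in auto)
  then show ?thesis
    by (rule set_integrable_cong[THEN iffD1, rotated -1]) auto
qed

lemma bounded_primitiveD:
  assumes "bounded_primitive P q"
  shows "q \<in> borel_measurable lebesgue" "x \<le> y \<Longrightarrow> set_integrable lebesgue {x..y} q"
    "x \<le> y \<Longrightarrow> P y - P x = (LINT t:{x..y}|lebesgue. q t)"
  using assms set_integrable_ess_bounded[of q] unfolding bounded_primitive_def by auto

lemma bounded_primitive_lipschitz:
  assumes P: "bounded_primitive P q" and M: "AE x in lebesgue. \<bar>q x\<bar> \<le> M"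
  shows "\<bar>P y - P x\<bar> \<le> M * \<bar>y - x\<bar>"
proof -
  have *: "\<bar>P y - P x\<bar> \<le> M * (y - x)" if "x \<le> y" for x y
    unfolding bounded_primitiveD(3)[OF P that]
    by (rule set_integral_abs_le_const[OF bounded_primitiveD(1)[OF P] _ that]) (use M in auto)
  show ?thesis
    using *[of x y] *[of y x] by (cases "x \<le> y") (auto simp: abs_minus_commute)
qed

lemma bounded_primitive_continuous:
  assumes P: "bounded_primitive P q"
  shows "continuous_on S P"
proof -
  obtain M where M: "AE x in lebesgue. \<bar>q x\<bar> \<le> M" using P by (auto simp: bounded_primitive_def)
  have "(\<bar>M\<bar>)-lipschitz_on UNIV P"
  proof (rule lipschitz_onI)
    fix x y :: real
    have "\<bar>P x - P y\<bar> \<le> M * \<bar>x - y\<bar>" by (rule bounded_primitive_lipschitz[OF P M])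
    also have "\<dots> \<le> \<bar>M\<bar> * \<bar>x - y\<bar>" by (intro mult_right_mono) auto
    finally show "dist (P x) (P y) \<le> \<bar>M\<bar> * dist x y" by (simp add: dist_real_def)
  qed auto
  then show ?thesis
    using lipschitz_on_continuous_on continuous_on_subset by blast
qed

text \<open>
  The difference of the two sides, as a function of the upper limit, is shown to have derivative zero everywhere:
  over a short interval at \<open>t\<close> both sides change by \<open>F' (P t)\<close> times the increment of \<open>P\<close>, up to a small multiple of
  the length. This avoids differentiating \<open>P\<close> at almost every point.
\<close>

lemma bounded_primitive_chain_rule:
  assumes P: "bounded_primitive P q"
    and F: "\<And>r. (F has_real_derivative F' r) (at r)" and cF: "continuous_on UNIV F'"
    and xy: "x \<le> y"
  shows "F (P y) - F (P x) = (LINT t:{x..y}|lebesgue. F' (P t) * q t)"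
proof -
  obtain M0 where "AE x in lebesgue. \<bar>q x\<bar> \<le> M0" using P by (auto simp: bounded_primitive_def)
  then have M: "AE x in lebesgue. \<bar>q x\<bar> \<le> \<bar>M0\<bar>" by eventually_elim auto
  define M where "M = \<bar>M0\<bar>"
  have M: "AE x in lebesgue. \<bar>q x\<bar> \<le> M" "0 \<le> M" using M by (auto simp: M_def)
  have q[measurable]: "q \<in> borel_measurable lebesgue" by (rule bounded_primitiveD[OF P])
  have cP: "continuous_on S P" for S by (rule bounded_primitive_continuous[OF P])
  have cFP: "continuous_on S (\<lambda>t. F' (P t))" for S
    by (rule continuous_on_compose2[OF cF cP]) auto
  have mFP: "(\<lambda>t. F' (P t)) \<in> borel_measurable lebesgue"
    by (intro borel_measurable_lebesgueI borel_measurable_continuous_onI cFP)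
  have int: "set_integrable lebesgue {u..w} (\<lambda>t. F' (P t) * q t)" for u w
    by (rule set_integrable_continuous_times_ess_bounded[OF q M(1) cFP])
  \<comment> \<open>Both sides change by almost the same amount, namely \<open>F' (P t)\<close> times the increment of \<open>P\<close>.\<close>
  have key: "\<exists>d>0. \<forall>u w. u \<le> w \<and> \<bar>u - t\<bar> < d \<and> \<bar>w - t\<bar> < d \<longrightarrow>
      \<bar>F (P w) - F (P u) - (LINT s:{u..w}|lebesgue. F' (P s) * q s)\<bar> \<le> e * (w - u)" if "e > 0" for e t
  proof -
    define e' where "e' = e / (2 * (M + 1))"
    have e': "e' > 0" using that M by (auto simp: e'_def)
    obtain \<eta> where \<eta>: "\<eta> > 0" "\<And>r. \<bar>r - P t\<bar> < \<eta> \<Longrightarrow> \<bar>F' r - F' (P t)\<bar> < e'"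
      using cF e' unfolding continuous_on_iff dist_real_def by (metis UNIV_I)
    define d where "d = \<eta> / (M + 1)"
    have d: "d > 0" using \<eta> M by (auto simp: d_def)
    have near: "\<bar>P s - P t\<bar> < \<eta>" if "\<bar>s - t\<bar> < d" for s
    proof -
      have "\<bar>P s - P t\<bar> \<le> M * \<bar>s - t\<bar>" by (rule bounded_primitive_lipschitz[OF P M(1)])
      also have "\<dots> \<le> (M + 1) * \<bar>s - t\<bar>" by (intro mult_right_mono) auto
      also have "\<dots> < (M + 1) * d" using that M by (intro mult_strict_left_mono) auto
      also have "\<dots> = \<eta>" using M by (simp add: d_def)
      finally show ?thesis .
    qed
    have "\<bar>F (P w) - F (P u) - (LINT s:{u..w}|lebesgue. F' (P s) * q s)\<bar> \<le> e * (w - u)"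
      if uw: "u \<le> w" "\<bar>u - t\<bar> < d" "\<bar>w - t\<bar> < d" for u w
    proof -
      let ?k = "F' (P t)"
      have "norm ((F (P w) - ?k * P w) - (F (P u) - ?k * P u)) \<le> e' * norm (P w - P u)"
      proof (rule field_differentiable_bound[of "ball (P t) \<eta>" _ "\<lambda>r. F' r - ?k"])
        show "((\<lambda>r. F r - ?k * r) has_field_derivative F' z - ?k) (at z within ball (P t) \<eta>)" for z
          by (rule DERIV_subset[of _ _ _ UNIV]) (auto intro!: derivative_eq_intros F)
        show "norm (F' z - ?k) \<le> e'" if "z \<in> ball (P t) \<eta>" for z
          using \<eta>(2)[of z] that by (auto simp: dist_real_def abs_minus_commute)
        show "P w \<in> ball (P t) \<eta>" "P u \<in> ball (P t) \<eta>"
          using near[of w] near[of u] uw by (auto simp: dist_real_def abs_minus_commute)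
      qed auto
      also have "\<dots> \<le> e' * (M * (w - u))"
        using bounded_primitive_lipschitz[OF P M(1), of w u] uw e' by (intro mult_left_mono) auto
      finally have 1: "\<bar>F (P w) - F (P u) - ?k * (P w - P u)\<bar> \<le> e' * M * (w - u)"
        by (simp add: algebra_simps)
      have "?k * (P w - P u) - (LINT s:{u..w}|lebesgue. F' (P s) * q s)
          = (LINT s:{u..w}|lebesgue. ?k * q s) - (LINT s:{u..w}|lebesgue. F' (P s) * q s)"
        using bounded_primitiveD(3)[OF P uw(1)] by simp
      also have "\<dots> = (LINT s:{u..w}|lebesgue. ?k * q s - F' (P s) * q s)"
        using bounded_primitiveD(2)[OF P uw(1)] int by (subst set_integral_diff(2)) auto
      also have "\<bar>\<dots>\<bar> \<le> (e' * M) * (w - u)"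
      proof (rule set_integral_abs_le_const)
        show "AE s in lebesgue. s \<in> {u..w} \<longrightarrow> \<bar>?k * q s - F' (P s) * q s\<bar> \<le> e' * M"
          using M(1)
        proof eventually_elim
          case (elim s)
          show ?case
          proof
            assume "s \<in> {u..w}"
            then have "\<bar>s - t\<bar> < d" using uw by auto
            from \<eta>(2)[OF near[OF this]] have "\<bar>?k - F' (P s)\<bar> \<le> e'" by auto
            then have "\<bar>?k - F' (P s)\<bar> * \<bar>q s\<bar> \<le> e' * M" using elim e' by (intro mult_mono) auto
            then show "\<bar>?k * q s - F' (P s) * q s\<bar> \<le> e' * M"
              by (simp add: abs_mult[symmetric] left_diff_distrib)
          qed
        qed
      qed (use uw in \<open>auto intro!: borel_measurable_diff borel_measurable_times mFP q\<close>)
      finally have 2: "\<bar>?k * (P w - P u) - (LINT s:{u..w}|lebesgue. F' (P s) * q s)\<bar> \<le> e' * M * (w - u)" .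
      have "2 * (e' * M) \<le> e" using that M \<open>e > 0\<close> by (simp add: e'_def field_simps)
      then have "2 * (e' * M) * (w - u) \<le> e * (w - u)" using uw by (intro mult_right_mono) auto
      then show ?thesis using 1 2 by (auto simp: abs_le_iff)
    qed
    then show ?thesis using d by blast
  qed
  define E where "E t = F (P t) - (LINT s:{x..t}|lebesgue. F' (P s) * q s)" for t
  have E: "E w - E u = F (P w) - F (P u) - (LINT s:{u..w}|lebesgue. F' (P s) * q s)"
    if "x \<le> u" "u \<le> w" for u w
    using set_integral_Icc_split[OF int that] by (simp add: E_def)
  have "\<exists>c. \<forall>t\<in>{x..y}. E t = c"
  proof (rule has_field_derivative_zero_constant)
    fix t assume t: "t \<in> {x..y}"
    show "(E has_real_derivative 0) (at t within {x..y})"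
      unfolding has_field_derivative_def has_derivative_within_alt
    proof (intro conjI allI impI)
      fix e :: real assume "e > 0"
      then obtain d where d: "d > 0" "\<And>u w. u \<le> w \<Longrightarrow> \<bar>u - t\<bar> < d \<Longrightarrow> \<bar>w - t\<bar> < d \<Longrightarrow>
        \<bar>F (P w) - F (P u) - (LINT s:{u..w}|lebesgue. F' (P s) * q s)\<bar> \<le> e * (w - u)"
        using key by meson
      have "norm (E r - E t - 0 * (r - t)) \<le> e * norm (r - t)" if "r \<in> {x..y}" "norm (r - t) < d" for r
      proof (cases "t \<le> r")
        case True
        then show ?thesis using d(2)[of t r] E[of t r] that t d(1) by auto
      next
        case False
        then have "\<bar>E t - E r\<bar> \<le> e * (t - r)" using d(2)[of r t] E[of r t] that t d(1) by auto
        then show ?thesis using False by (auto simp: abs_minus_commute)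
      qed
      then show "\<exists>d>0. \<forall>r\<in>{x..y}. norm (r - t) < d \<longrightarrow> norm (E r - E t - 0 * (r - t)) \<le> e * norm (r - t)"
        using d(1) by blast
    qed (auto simp: bounded_linear_mult_right)
  qed auto
  then have "E y = E x" using xy by auto
  then show ?thesis using E[of x y] xy by simp
qed

text \<open>
  For a large constant \<open>K\<close> the function \<open>1 + h / K\<close> is the density of a measure that gives intervals their length. So this
  measure is Lebesgue measure, and its density is one.
\<close>

lemma AE_zero_if_interval_integrals_zero_bounded:
  fixes h :: "real \<Rightarrow> real"
  assumes h: "h \<in> borel_measurable lebesgue" and M: "AE x in lebesgue. \<bar>h x\<bar> \<le> M"
    and zero: "\<And>x y. x \<le> y \<Longrightarrow> (LINT t:{x..y}|lebesgue. h t) = 0"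
  shows "AE x in lebesgue. h x = 0"
proof -
  obtain h0 where h0[measurable]: "h0 \<in> borel_measurable lborel" and hh0: "AE x in lborel. h x = h0 x"
    using completion_ex_borel_measurable_real[OF h] by blast
  then have h0l: "h0 \<in> borel_measurable lebesgue" by (intro borel_measurable_lebesgueI) simp
  define K where "K = \<bar>M\<bar> + 1"
  have K: "K > 0" by (simp add: K_def)
  have h0': "AE x in lborel. 0 \<le> 1 + h0 x / K"
    using hh0 AE_completion_iff[THEN iffD1, OF M]
  proof eventually_elim
    case (elim x)
    then have "- K \<le> h0 x" by (auto simp: K_def)
    then show ?case using K by (simp add: field_simps)
  qed
  define f where "f x = ennreal (1 + h0 x / K)" for x
  have f[measurable]: "f \<in> borel_measurable lborel" unfolding f_def using h0 by (intro measurable_compose[OF _ measurable_ennreal] borel_measurable_add borel_measurable_divide) auto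
  have "lborel = density lborel f"
  proof (rule lborel_eqI)
    fix l u :: real assume lu: "\<And>b. b \<in> Basis \<Longrightarrow> l \<bullet> b \<le> u \<bullet> b"
    then have lu: "l \<le> u" by auto
    have ih: "set_integrable lebesgue {l..u} h"
      by (rule set_integrable_ess_bounded[OF h M]) auto
    have "integrable lebesgue (\<lambda>x. indicator {l..u} x *\<^sub>R h0 x)"
      by (rule Bochner_Integration.integrable_cong_AE_imp[OF ih[unfolded set_integrable_def]])
        (use AE_completion[OF hh0] h h0l in \<open>auto intro!: borel_measurable_times borel_measurable_indicator\<close>)
    then have i0: "integrable lborel (\<lambda>x. indicator {l..u} x *\<^sub>R h0 x)"
      by (subst (asm) integrable_completion) auto
    have i1: "integrable lborel (\<lambda>x. indicat_real {l..u} x)"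
      by (auto simp: emeasure_lborel_Icc_eq)
    have "(LINT x|lborel. indicator {l..u} x *\<^sub>R h0 x) = (LINT x|lebesgue. indicator {l..u} x *\<^sub>R h0 x)"
      by (subst integral_completion) auto
    also have "\<dots> = (LINT t:{l..u}|lebesgue. h t)"
      unfolding set_lebesgue_integral_def
      by (rule integral_cong_AE)
        (use AE_completion[OF hh0] h h0l in \<open>auto intro!: borel_measurable_times borel_measurable_indicator\<close>)
    finally have z: "(LINT x|lborel. indicator {l..u} x *\<^sub>R h0 x) = 0" using zero[OF lu] by simp
    have "emeasure (density lborel f) (box l u) = (\<integral>\<^sup>+x. f x * indicator {l<..<u} x \<partial>lborel)"
      by (subst emeasure_density) (auto simp: box_real)
    also have "\<dots> = (\<integral>\<^sup>+x. ennreal (indicator {l..u} x + indicator {l..u} x *\<^sub>R h0 x / K) \<partial>lborel)"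
      using AE_lborel_singleton[of l] AE_lborel_singleton[of u]
      by (intro nn_integral_cong_AE, eventually_elim) (auto simp: f_def indicator_def)
    also have "\<dots> = ennreal (LINT x|lborel. indicator {l..u} x + indicator {l..u} x *\<^sub>R h0 x / K)"
      by (rule nn_integral_eq_integral) (use i0 i1 h0' in \<open>auto simp: indicator_def\<close>)
    also have "(LINT x|lborel. indicator {l..u} x + indicator {l..u} x *\<^sub>R h0 x / K) = u - l"
      using i0 i1 z lu by (subst Bochner_Integration.integral_add) auto
    finally show "emeasure (density lborel f) (box l u) = (\<Prod>b\<in>Basis. (u - l) \<bullet> b)" by simp
  qed simp
  then have "density lborel (\<lambda>x. 1) = density lborel f" by (simp add: density_1)
  then have "AE x in lborel. 1 = f x"
    by (intro sigma_finite_measure.density_unique[OF sigma_finite_lborel] f) auto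
  then have "AE x in lborel. h x = 0"
    using hh0 h0'
  proof eventually_elim
    case (elim x)
    then have "ennreal 1 = ennreal (1 + h0 x / K)" by (simp add: f_def)
    then have "1 = 1 + h0 x / K" using elim by (subst (asm) ennreal_inj) auto
    then show ?case using elim K by auto
  qed
  then show ?thesis by (rule AE_completion)
qed

lemma AE_zero_if_interval_integrals_zero:
  fixes h :: "real \<Rightarrow> real"
  assumes h: "h \<in> borel_measurable lebesgue"
    and M: "\<And>k::nat. \<exists>M. AE x in lebesgue. \<bar>x\<bar> \<le> k \<longrightarrow> \<bar>h x\<bar> \<le> M"
    and zero: "\<And>x y. x \<le> y \<Longrightarrow> (LINT t:{x..y}|lebesgue. h t) = 0"
  shows "AE x in lebesgue. h x = 0"
proof -
  have "AE x in lebesgue. indicator {-real k..real k} x * h x = 0" for k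
  proof -
    obtain M where M: "AE x in lebesgue. \<bar>x\<bar> \<le> k \<longrightarrow> \<bar>h x\<bar> \<le> M" using M by blast
    show ?thesis
    proof (rule AE_zero_if_interval_integrals_zero_bounded)
      show "(\<lambda>x. indicator {-real k..real k} x * h x) \<in> borel_measurable lebesgue"
        using h by (intro borel_measurable_times borel_measurable_indicator) auto
      show "AE x in lebesgue. \<bar>indicator {-real k..real k} x * h x\<bar> \<le> \<bar>M\<bar>"
        using M by eventually_elim (auto simp: indicator_def)
      fix x y :: real assume "x \<le> y"
      have "indicator {x..y} t *\<^sub>R (indicator {-real k..real k} t * h t)
          = indicator {max x (-real k)..min y (real k)} t *\<^sub>R h t" for t
        by (auto simp: indicator_def)
      then have "(LINT t:{x..y}|lebesgue. indicator {-real k..real k} t * h t)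
          = (LINT t:{max x (-real k)..min y (real k)}|lebesgue. h t)"
        by (simp only: set_lebesgue_integral_def)
      also have "\<dots> = 0"
        by (cases "max x (-real k) \<le> min y (real k)")
          (rule zero, auto simp: set_lebesgue_integral_def)
      finally show "(LINT t:{x..y}|lebesgue. indicator {-real k..real k} t * h t) = 0" .
    qed
  qed
  then have "AE x in lebesgue. \<forall>k::nat. indicator {-real k..real k} x * h x = 0"
    by (subst AE_all_countable) auto
  then show ?thesis
  proof eventually_elim
    case (elim x)
    obtain k :: nat where "\<bar>x\<bar> \<le> k" using real_arch_simple by blast
    then show ?case using elim[rule_format, of k] by (auto simp: indicator_def)
  qed
qed

lemma bounded_primitive_add:
  assumes "bounded_primitive P q" "bounded_primitive P' q'"
  shows "bounded_primitive (\<lambda>x. P x + P' x) (\<lambda>x. q x + q' x)"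
proof -
  obtain M M' where M: "AE x in lebesgue. \<bar>q x\<bar> \<le> M" "AE x in lebesgue. \<bar>q' x\<bar> \<le> M'"
    using assms by (auto simp: bounded_primitive_def)
  have "AE x in lebesgue. \<bar>q x + q' x\<bar> \<le> M + M'"
    using M by eventually_elim auto
  moreover have "P y + P' y - (P x + P' x) = (LINT t:{x..y}|lebesgue. q t + q' t)" if "x \<le> y" for x y
    using assms[THEN bounded_primitiveD(3), OF that] assms[THEN bounded_primitiveD(2), OF that]
    by (subst set_integral_add(2)) auto
  ultimately show ?thesis
    using assms[THEN bounded_primitiveD(1)] unfolding bounded_primitive_def by auto
qed

lemma bounded_primitive_scale:
  assumes "bounded_primitive P q"
  shows "bounded_primitive (\<lambda>x. k * P x) (\<lambda>x. k * q x)"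
proof -
  obtain M where M: "AE x in lebesgue. \<bar>q x\<bar> \<le> M"
    using assms by (auto simp: bounded_primitive_def)
  have "AE x in lebesgue. \<bar>k * q x\<bar> \<le> \<bar>k\<bar> * M"
    using M by eventually_elim (auto simp: abs_mult intro: mult_left_mono)
  moreover have "k * P y - k * P x = (LINT t:{x..y}|lebesgue. k * q t)" if "x \<le> y" for x y
    using assms[THEN bounded_primitiveD(3), OF that] by (simp add: right_diff_distrib[symmetric])
  ultimately show ?thesis
    using assms[THEN bounded_primitiveD(1)] unfolding bounded_primitive_def by auto
qed

text \<open>
  Polarization: the chain rule for the square, applied to the sum and the difference of the two primitives.
\<close>

lemma bounded_primitive_integration_by_parts:
  assumes P: "bounded_primitive P q" and P': "bounded_primitive P' q'" and "x \<le> y"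
  shows "P y * P' y - P x * P' x = (LINT t:{x..y}|lebesgue. P t * q' t + P' t * q t)"
proof -
  let ?S = "\<lambda>t. P t + P' t" and ?D = "\<lambda>t. P t + (-1) * P' t"
  have S: "bounded_primitive ?S (\<lambda>t. q t + q' t)"
    by (rule bounded_primitive_add[OF P P'])
  have D: "bounded_primitive ?D (\<lambda>t. q t + (-1) * q' t)"
    by (rule bounded_primitive_add[OF P bounded_primitive_scale[OF P']])
  have sq: "((\<lambda>r. r\<^sup>2 / 4) has_real_derivative r / 2) (at r)" for r :: real
    by (auto intro!: derivative_eq_intros)
  have c: "continuous_on UNIV (\<lambda>r::real. r / 2)" by (intro continuous_intros) auto
  have i: "set_integrable lebesgue {x..y} (\<lambda>t. P0 t / 2 * q0 t)" if b: "bounded_primitive P0 q0" for P0 q0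
  proof -
    obtain M where "AE x in lebesgue. \<bar>q0 x\<bar> \<le> M" using b by (auto simp: bounded_primitive_def)
    then show ?thesis
      by (rule set_integrable_continuous_times_ess_bounded[OF bounded_primitiveD(1)[OF b]])
        (intro continuous_intros bounded_primitive_continuous[OF b], auto)
  qed
  have "P y * P' y - P x * P' x = ((?S y)\<^sup>2 / 4 - (?S x)\<^sup>2 / 4) - ((?D y)\<^sup>2 / 4 - (?D x)\<^sup>2 / 4)"
    by (simp add: power2_eq_square field_simps)
  also have "\<dots> = (LINT t:{x..y}|lebesgue. ?S t / 2 * (q t + q' t)) - (LINT t:{x..y}|lebesgue. ?D t / 2 * (q t + (-1) * q' t))"
    using bounded_primitive_chain_rule[OF S sq c \<open>x \<le> y\<close>] bounded_primitive_chain_rule[OF D sq c \<open>x \<le> y\<close>]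
    by simp
  also have "\<dots> = (LINT t:{x..y}|lebesgue. ?S t / 2 * (q t + q' t) - ?D t / 2 * (q t + (-1) * q' t))"
    using i[OF S] i[OF D] by (subst set_integral_diff(2)) auto
  also have "(\<lambda>t. ?S t / 2 * (q t + q' t) - ?D t / 2 * (q t + (-1) * q' t)) = (\<lambda>t. P t * q' t + P' t * q t)"
    by (auto simp: field_simps)
  finally show ?thesis .
qed

lemma bounded_primitive_exists:
  assumes q: "q \<in> borel_measurable lebesgue" and M: "AE x in lebesgue. \<bar>q x\<bar> \<le> M"
  shows "\<exists>P. bounded_primitive P q"
proof -
  have i: "set_integrable lebesgue {x..y} q" for x y
    by (rule set_integrable_ess_bounded[OF q M]) auto
  define P where "P x = (LINT t:{0..x}|lebesgue. q t) - (LINT t:{x..0}|lebesgue. q t)" for x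
  have z: "(LINT t:{x..y}|lebesgue. q t) = 0" if "y \<le> x" for x y
  proof (cases "x = y")
    case True
    have "AE t in lebesgue. t \<noteq> x" by (rule AE_completion[OF AE_lborel_singleton])
    then have "AE t in lebesgue. indicator {x..y} t *\<^sub>R q t = 0"
      by eventually_elim (auto simp: True indicator_def)
    then show ?thesis unfolding set_lebesgue_integral_def by (rule integral_eq_zero_AE)
  qed (use that in \<open>auto simp: set_lebesgue_integral_def\<close>)
  have "P y - P x = (LINT t:{x..y}|lebesgue. q t)" if "x \<le> y" for x y
  proof -
    consider "0 \<le> x" | "x \<le> 0" "0 \<le> y" | "y \<le> 0" by linarith
    then show ?thesis
    proof cases
      case 1
      then show ?thesis using set_integral_Icc_split[OF i 1 that] that by (simp add: P_def z)
    next
      case 2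
      then show ?thesis using set_integral_Icc_split[OF i 2] by (simp add: P_def z)
    next
      case 3
      then show ?thesis using set_integral_Icc_split[OF i that 3] that by (simp add: P_def z)
    qed
  qed
  then show ?thesis using assms unfolding bounded_primitive_def by blast
qed

lemma primitive_has_derivative_at_continuous:
  fixes P w :: "real \<Rightarrow> real"
  assumes P: "\<And>x y. x \<le> y \<Longrightarrow> P y - P x = (LINT t:{x..y}|lebesgue. w t)" and w: "continuous_on UNIV w"
  shows "(P has_real_derivative w x) (at x)"
proof -
  have cw: "continuous_on S w" for S using w continuous_on_subset by blast
  have "set_integrable lebesgue {a..b} w" for a b
    using set_integrable_continuous_times_ess_bounded[of "\<lambda>_. 1" 1 a b w] cw by auto
  then have eq: "P u = P (x - 1) + integral {x-1..u} w" if "u \<in> {x-1..x+1}" for u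
    using P[of "x - 1" u] that set_lebesgue_integral_eq_integral(2)[of "{x-1..u}" w] by auto
  have "((\<lambda>u. P (x - 1) + integral {x-1..u} w) has_real_derivative 0 + w x) (at x within {x-1..x+1})"
    by (intro DERIV_add DERIV_const integral_has_real_derivative cw) auto
  from this[simplified] have "(P has_real_derivative w x) (at x within {x-1..x+1})"
  proof (rule has_field_derivative_transform_within)
    show "P (x - 1) + integral {x-1..u} w = P u" if "u \<in> {x-1..x+1}" "dist u x < 1" for u
      using eq[OF that(1)] by simp
  qed auto
  then show ?thesis by (simp add: at_within_Icc_at)
qed

lemma gradient_zero_off_support:
  assumes "C1_gradient \<phi> D" "compact K" "\<And>z. z \<notin> K \<Longrightarrow> \<phi> z = 0" "z \<notin> K"
  shows "D z = 0"
proof -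
  have 1: "(\<phi> has_derivative (\<lambda>h. inner h (D z))) (at z)"
    using assms(1) by (auto simp: C1_gradient_def gderiv_def)
  have "open (- K)" using assms(2) compact_imp_closed by auto
  then have "((\<lambda>_. 0) has_derivative (\<lambda>h. inner h (D z))) (at z)"
    by (rule has_derivative_transform_within_open[OF 1]) (use assms in auto)
  then have "(\<lambda>h. inner h (D z)) = (\<lambda>h. 0)"
    by (rule has_derivative_unique) auto
  then have "inner (D z) (D z) = 0" by metis
  then show ?thesis by simp
qed

lemma compact_support_in_interval:
  fixes K :: "real set"
  assumes "compact K"
  obtains N where "N > 0" "K \<subseteq> {-N<..<N}"
proof -
  obtain B where "\<And>x. x \<in> K \<Longrightarrow> \<bar>x\<bar> \<le> B" using compact_imp_bounded[OF assms] by (auto simp: bounded_iff)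
  then show ?thesis by (intro that[of "\<bar>B\<bar> + 1"]) fastforce+
qed

lemma bounded_primitive_C1_compact_support:
  assumes C: "C1_gradient \<phi> D" and K: "compact K" "\<And>z::real. z \<notin> K \<Longrightarrow> \<phi> z = 0"
  shows "bounded_primitive \<phi> D"
proof -
  have d: "(\<phi> has_real_derivative D z) (at z)" for z using C by (simp add: C1_gradient_def)
  have c: "continuous_on S D" for S using C continuous_on_subset unfolding C1_gradient_def by blast
  have "bounded (D ` K)" using compact_continuous_image[OF c K(1)] compact_imp_bounded by blast
  then obtain M where M: "\<And>x. x \<in> K \<Longrightarrow> \<bar>D x\<bar> \<le> M" unfolding bounded_iff by force
  have "\<bar>D x\<bar> \<le> \<bar>M\<bar>" for x
    using M[of x] gradient_zero_off_support[OF C K, of x] by (cases "x \<in> K") auto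
  moreover have m: "D \<in> borel_measurable lebesgue"
    by (intro borel_measurable_lebesgueI borel_measurable_continuous_onI c)
  moreover have "\<phi> y - \<phi> x = (LINT t:{x..y}|lebesgue. D t)" if "x \<le> y" for x y
  proof -
    have "set_integrable lebesgue {x..y} D"
      by (rule set_integrable_ess_bounded[OF m, of "\<bar>M\<bar>"]) (use calculation in auto)
    moreover have "(D has_integral \<phi> y - \<phi> x) {x..y}"
      by (rule fundamental_theorem_of_calculus[OF that])
        (use d in \<open>auto simp: has_real_derivative_iff_has_vector_derivative[symmetric] intro: DERIV_subset\<close>)
    ultimately show ?thesis
      using set_lebesgue_integral_eq_integral(2)[of "{x..y}" D] integral_unique[of D] by simp
  qed
  ultimately show ?thesis unfolding bounded_primitive_def by blast
qed

lemma bounded_primitive_weak_gradient_test: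
  assumes P: "bounded_primitive P q"
    and C: "C1_gradient \<phi> D" and K: "compact K" "\<And>z::real. z \<notin> K \<Longrightarrow> \<phi> z = 0"
  shows "(LINT z:UNIV|lebesgue. P z *\<^sub>R D z) = - (LINT z:UNIV|lebesgue. \<phi> z *\<^sub>R q z)"
proof -
  obtain N where N: "N > 0" "K \<subseteq> {-N<..<N}" using compact_support_in_interval[OF K(1)] .
  have b: "bounded_primitive \<phi> D" by (rule bounded_primitive_C1_compact_support[OF C K])
  obtain M M' where M: "AE x in lebesgue. \<bar>q x\<bar> \<le> M" "AE x in lebesgue. \<bar>D x\<bar> \<le> M'"
    using P b by (auto simp: bounded_primitive_def)
  have i: "set_integrable lebesgue {-N..N} (\<lambda>t. P t * D t)" "set_integrable lebesgue {-N..N} (\<lambda>t. \<phi> t * q t)"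
    by (rule set_integrable_continuous_times_ess_bounded[OF bounded_primitiveD(1)]
      bounded_primitive_continuous P b M)+
  have "N \<notin> K" "- N \<notin> K" using N by auto
  then have "0 = P N * \<phi> N - P (-N) * \<phi> (-N)" by (simp add: K(2))
  also have "\<dots> = (LINT t:{-N..N}|lebesgue. P t * D t) + (LINT t:{-N..N}|lebesgue. \<phi> t * q t)"
    using bounded_primitive_integration_by_parts[OF P b, of "-N" N] N set_integral_add(2)[OF i]
    by linarith
  also have "(LINT t:{-N..N}|lebesgue. P t * D t) = (LINT z:UNIV|lebesgue. P z *\<^sub>R D z)"
    unfolding set_lebesgue_integral_def
    by (intro Bochner_Integration.integral_cong refl) (use gradient_zero_off_support[OF C K] N in \<open>force simp: indicator_def\<close>)
  also have "(LINT t:{-N..N}|lebesgue. \<phi> t * q t) = (LINT z:UNIV|lebesgue. \<phi> z *\<^sub>R q z)"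
    unfolding set_lebesgue_integral_def
    by (intro Bochner_Integration.integral_cong refl) (use K N in \<open>force simp: indicator_def\<close>)
  finally show ?thesis by simp
qed

section \<open>Bounded weak derivatives on the line\<close>

lemma C1_gradient_real:
  "C1_gradient \<phi> D \<longleftrightarrow> (\<forall>z::real. (\<phi> has_real_derivative D z) (at z)) \<and> continuous_on UNIV D"
  by (simp add: C1_gradient_def)

lemma LinfD:
  assumes "f \<in> Linf"
  shows "f \<in> borel_measurable lebesgue" "\<exists>M. AE x in lebesgue. \<bar>f x\<bar> \<le> M"
proof -
  show "f \<in> borel_measurable lebesgue" using assms by (simp add: Linf_def)
  obtain M where M: "Linf_norm f \<le> ereal M"
    using assms by (cases "Linf_norm f") (auto simp: Linf_def)
  have "AE x in lebesgue. ereal \<bar>f x\<bar> \<le> Linf_norm f"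
    unfolding Linf_norm_def by (rule esssup_AE)
  then have "AE x in lebesgue. \<bar>f x\<bar> \<le> M"
  proof eventually_elim
    case (elim x)
    then have "ereal \<bar>f x\<bar> \<le> ereal M" using M by (rule order_trans)
    then show ?case by simp
  qed
  then show "\<exists>M. AE x in lebesgue. \<bar>f x\<bar> \<le> M" by blast
qed

lemma Linf_norm_le:
  assumes "f \<in> borel_measurable lebesgue" "AE x in lebesgue. \<bar>f x\<bar> \<le> M"
  shows "Linf_norm f \<le> ereal M"
  unfolding Linf_norm_def
  by (rule esssup_I) (use assms in auto)

lemma LinfI:
  assumes "f \<in> borel_measurable lebesgue" "AE x in lebesgue. \<bar>f x\<bar> \<le> M"
  shows "f \<in> Linf"
  using Linf_norm_le[OF assms] assms(1) by (auto simp: Linf_def intro: le_less_trans)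

text \<open>
  The lemma of du Bois-Reymond. If \<open>P\<close> is a primitive of \<open>q\<close>, then \<open>f - P\<close> is orthogonal to the derivatives of all test
  functions, that is, to all continuous functions of compact support and integral zero. Comparing an arbitrary one with
  a fixed bump of integral one shows that, for a constant \<open>c\<close>, \<open>f - P - c\<close> is orthogonal to every continuous function of
  compact support, and approximating indicator functions of intervals gives \<open>f = P + c\<close>.
\<close>

lemma weak_derivative_is_bounded_primitive:
  assumes f: "f \<in> Linf" and q: "q \<in> Linf" and w: "has_weak_gradient_on f q UNIV"
  shows "\<exists>P. bounded_primitive P q \<and> (AE x in lebesgue. f x = P x)"
proof -
  obtain P where P: "bounded_primitive P q" using bounded_primitive_exists LinfD[OF q] by blast
  have fm: "f \<in> borel_measurable lebesgue" by (rule LinfD[OF f])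
  obtain Mf where Mf: "AE x in lebesgue. \<bar>f x\<bar> \<le> Mf" using LinfD[OF f] by blast
  have cP: "continuous_on S P" for S by (rule bounded_primitive_continuous[OF P])
  define h where "h x = f x - P x" for x
  have hm: "h \<in> borel_measurable lebesgue"
    unfolding h_def by (intro borel_measurable_diff fm borel_measurable_lebesgueI borel_measurable_continuous_onI cP)
  have fi: "set_integrable lebesgue {a..b} (\<lambda>t. f t * u t)" if "continuous_on UNIV u" for u a b
  proof -
    have "set_integrable lebesgue {a..b} (\<lambda>t. u t * f t)"
      by (rule set_integrable_continuous_times_ess_bounded[OF fm Mf]) (use that continuous_on_subset in blast)
    then show ?thesis by (simp add: mult.commute)
  qed
  have Pi: "set_integrable lebesgue {a..b} (\<lambda>t. P t * u t)" if "continuous_on UNIV u" for u a b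
  proof -
    have "continuous_on {a..b} u" using that continuous_on_subset by blast
    then show ?thesis
      using set_integrable_continuous_times_ess_bounded[of "\<lambda>_. 1" 1 a b "\<lambda>t. P t * u t"]
      by (auto intro!: continuous_intros cP)
  qed
  have hi: "set_integrable lebesgue {a..b} (\<lambda>t. h t * u t)" if "continuous_on UNIV u" for u a b
    using set_integral_diff(1)[OF fi[OF that] Pi[OF that]] by (simp add: h_def left_diff_distrib)
  have orth: "(LINT t:{-N..N}|lebesgue. h t * D t) = 0"
    if C: "C1_gradient \<phi> D" and supp: "\<And>z. z \<notin> {-N..N} \<Longrightarrow> \<phi> z = 0" for \<phi> D :: "real \<Rightarrow> real" and N
  proof -
    have cD: "continuous_on UNIV D" using C by (simp add: C1_gradient_def)
    have D0: "D z = 0" if "\<not> (- N \<le> z \<and> z \<le> N)" for z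
      by (rule gradient_zero_off_support[OF C compact_Icc[of "-N" N] supp]) (use that in auto)
    have eq: "(LINT z:UNIV|lebesgue. u z *\<^sub>R D z) = (LINT t:{-N..N}|lebesgue. u t * D t)" for u
      unfolding set_lebesgue_integral_def
      by (intro Bochner_Integration.integral_cong refl)
        (use D0 in \<open>force simp: indicator_def\<close>)
    have "(LINT z:UNIV|lebesgue. f z *\<^sub>R D z) = - (LINT z:UNIV|lebesgue. \<phi> z *\<^sub>R q z)"
      using w C supp compact_Icc[of "-N" N] unfolding has_weak_gradient_on_def by blast
    moreover have "(LINT z:UNIV|lebesgue. P z *\<^sub>R D z) = - (LINT z:UNIV|lebesgue. \<phi> z *\<^sub>R q z)"
      by (rule bounded_primitive_weak_gradient_test[OF P C _ supp]) auto
    ultimately have "(LINT t:{-N..N}|lebesgue. f t * D t) - (LINT t:{-N..N}|lebesgue. P t * D t) = 0"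
      unfolding eq by linarith
    then show ?thesis
      using fi[OF cD] Pi[OF cD] by (subst (asm) set_integral_diff(2)[symmetric]) (auto simp: h_def left_diff_distrib)
  qed
  define \<eta> :: "real \<Rightarrow> real" where "\<eta> x = max 0 (1 - \<bar>x\<bar>)" for x
  have c\<eta>: "continuous_on UNIV \<eta>" unfolding \<eta>_def by (intro continuous_intros)
  have ci: "set_integrable lebesgue {a..b} u" if "continuous_on UNIV u" for u :: "real \<Rightarrow> real" and a b
    using set_integrable_continuous_times_ess_bounded[of "\<lambda>_. 1" 1 a b u] continuous_on_subset[OF that] by auto
  have bd: "\<exists>M. AE x in lebesgue. \<bar>u x\<bar> \<le> M"
    if c: "continuous_on UNIV u" and s: "\<And>z. z \<notin> {-N..N} \<Longrightarrow> u z = 0" for u :: "real \<Rightarrow> real" and N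
  proof -
    have "bounded (u ` {-N..N})"
      using compact_continuous_image[OF continuous_on_subset[OF c] compact_Icc] compact_imp_bounded by auto
    then obtain M where M: "\<And>x. x \<in> {-N..N} \<Longrightarrow> \<bar>u x\<bar> \<le> M" unfolding bounded_iff by force
    have "\<bar>u x\<bar> \<le> \<bar>M\<bar>" for x using M[of x] s[of x] by (cases "x \<in> {-N..N}") auto
    then show ?thesis by blast
  qed
  have \<eta>1: "(LINT t:{-N..N}|lebesgue. \<eta> t) = 1" if "N \<ge> 1" for N
  proof -
    have "((\<lambda>t. 1 + t) has_integral (0 + 0\<^sup>2/2) - (-1 + (-1)\<^sup>2/2)) {-1..0::real}"
      by (intro fundamental_theorem_of_calculus)
        (auto intro!: derivative_eq_intros simp: has_real_derivative_iff_has_vector_derivative[symmetric])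
    then have "((\<lambda>t. 1 + t) has_integral 1/2) {-1..0::real}" by (simp add: power2_eq_square)
    then have 1: "(\<eta> has_integral 1/2) {-1..0}"
      by (rule has_integral_eq[rotated]) (auto simp: \<eta>_def)
    have "((\<lambda>t. 1 - t) has_integral (1 - 1\<^sup>2/2) - (0 - 0\<^sup>2/2)) {0..1::real}"
      by (intro fundamental_theorem_of_calculus)
        (auto intro!: derivative_eq_intros simp: has_real_derivative_iff_has_vector_derivative[symmetric])
    then have "((\<lambda>t. 1 - t) has_integral 1/2) {0..1::real}" by (simp add: power2_eq_square)
    then have 2: "(\<eta> has_integral 1/2) {0..1}"
      by (rule has_integral_eq[rotated]) (auto simp: \<eta>_def)
    have "(\<eta> has_integral 1/2 + 1/2) {-1..1}"
      by (rule has_integral_combine[OF _ _ 1 2]) auto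
    then have 3: "(\<eta> has_integral 1) {-1..1}" by simp
    have "(\<eta> has_integral 1) {-N..N}"
      by (rule has_integral_on_superset[OF 3]) (use that in \<open>auto simp: \<eta>_def\<close>)
    then show ?thesis
      using set_lebesgue_integral_eq_integral(2)[OF ci[OF c\<eta>]] by (metis integral_unique)
  qed
  define c where "c = (LINT t:{-1..1}|lebesgue. h t * \<eta> t)"
  have c': "(LINT t:{-N..N}|lebesgue. h t * \<eta> t) = c" if "N \<ge> 1" for N
    unfolding c_def set_lebesgue_integral_def
    by (intro Bochner_Integration.integral_cong refl) (use that in \<open>auto simp: \<eta>_def indicator_def\<close>)
  \<comment> \<open>Every continuous \<open>\<psi>\<close> becomes the derivative of a test function after a multiple of \<open>\<eta>\<close> is subtracted.\<close>
  have test: "(LINT t:{-N..N}|lebesgue. h t * \<psi> t) = c * (LINT t:{-N..N}|lebesgue. \<psi> t)"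
    if N: "N \<ge> 1" and c\<psi>: "continuous_on UNIV \<psi>" and s: "\<And>z. z \<notin> {-N..N} \<Longrightarrow> \<psi> z = 0" for \<psi> N
  proof -
    define I where "I = (LINT t:{-N..N}|lebesgue. \<psi> t)"
    define u where "u t = \<psi> t - I * \<eta> t" for t
    have cu: "continuous_on UNIV u" unfolding u_def by (intro continuous_intros c\<psi> c\<eta>)
    have su: "u z = 0" if "z \<notin> {-N..N}" for z using s[OF that] that N by (auto simp: u_def \<eta>_def)
    have mu: "u \<in> borel_measurable lebesgue"
      by (intro borel_measurable_lebesgueI borel_measurable_continuous_onI cu)
    obtain W where W: "bounded_primitive W u" using bounded_primitive_exists[OF mu] bd[OF cu su] by blast
    define \<phi> where "\<phi> t = W t - W (-N)" for t
    have W0: "W y - W x = 0" if "x \<le> y" "\<And>t. t \<in> {x<..<y} \<Longrightarrow> u t = 0" for x y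
    proof -
      have "AE t in lebesgue. t \<noteq> x \<and> t \<noteq> y"
        using AE_completion[OF AE_lborel_singleton[of x]] AE_completion[OF AE_lborel_singleton[of y]] by eventually_elim auto
      then have "AE t in lebesgue. indicator {x..y} t *\<^sub>R u t = 0"
        by eventually_elim (use that in \<open>auto simp: indicator_def\<close>)
      then show ?thesis unfolding bounded_primitiveD(3)[OF W that(1)] set_lebesgue_integral_def
        by (rule integral_eq_zero_AE)
    qed
    have "W N - W (-N) = (LINT t:{-N..N}|lebesgue. \<psi> t) - (LINT t:{-N..N}|lebesgue. I * \<eta> t)"
      using bounded_primitiveD(3)[OF W, of "-N" N] N unfolding u_def
      by (subst set_integral_diff(2)[symmetric]) (auto intro!: ci c\<psi> continuous_intros c\<eta>)
    then have WN: "W N = W (-N)" using \<eta>1[OF N] by (simp add: I_def)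
    have s\<phi>: "\<phi> z = 0" if "z \<notin> {-N..N}" for z
    proof (cases "z < - N")
      case True
      then show ?thesis using W0[of z "-N"] su by (auto simp: \<phi>_def)
    next
      case False
      then show ?thesis using W0[of N z] su WN that by (auto simp: \<phi>_def)
    qed
    have "C1_gradient \<phi> u"
      unfolding C1_gradient_real \<phi>_def
      using primitive_has_derivative_at_continuous[OF bounded_primitiveD(3)[OF W] cu] cu
      by (auto intro!: derivative_eq_intros)
    from orth[OF this s\<phi>] have "(LINT t:{-N..N}|lebesgue. h t * \<psi> t - I * (h t * \<eta> t)) = 0"
      by (simp add: u_def algebra_simps)
    then show ?thesis
      using hi[OF c\<psi>] hi[OF c\<eta>] c'[OF N] by (subst (asm) set_integral_diff(2)) (auto simp: I_def)
  qed
  have "AE x in lebesgue. h x - c = 0"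
  proof (rule AE_zero_if_interval_integrals_zero)
    show "(\<lambda>x. h x - c) \<in> borel_measurable lebesgue" using hm by auto
    show "\<exists>M. AE x in lebesgue. \<bar>x\<bar> \<le> real k \<longrightarrow> \<bar>h x - c\<bar> \<le> M" for k :: nat
    proof -
      have "bounded (P ` {-real k..real k})"
        using compact_continuous_image[OF cP compact_Icc] compact_imp_bounded by auto
      then obtain B where B: "\<And>x. x \<in> {-real k..real k} \<Longrightarrow> \<bar>P x\<bar> \<le> B" unfolding bounded_iff by force
      have "AE x in lebesgue. \<bar>x\<bar> \<le> real k \<longrightarrow> \<bar>h x - c\<bar> \<le> Mf + B + \<bar>c\<bar>"
        using Mf
      proof eventually_elim
        case (elim x)
        show ?case
        proof
          assume "\<bar>x\<bar> \<le> real k"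
          then have "\<bar>P x\<bar> \<le> B" by (intro B) auto
          then show "\<bar>h x - c\<bar> \<le> Mf + B + \<bar>c\<bar>" using elim unfolding h_def by linarith
        qed
      qed
      then show ?thesis by blast
    qed
    fix \<alpha> \<beta> :: real assume ab: "\<alpha> \<le> \<beta>"
    define N where "N = \<bar>\<alpha>\<bar> + \<bar>\<beta>\<bar> + 1"
    have N: "N \<ge> 1" by (simp add: N_def)
    define \<psi> where "\<psi> n x = max 0 (1 - real (Suc n) * max 0 (max (\<alpha> - x) (x - \<beta>)))" for n x
    have c\<psi>: "continuous_on UNIV (\<psi> n)" for n unfolding \<psi>_def by (intro continuous_intros)
    have s: "\<psi> n z = 0" if "z \<notin> {-N..N}" for n z
    proof -
      have "1 \<le> max 0 (max (\<alpha> - z) (z - \<beta>))" using that by (auto simp: N_def)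
      then have "1 * 1 \<le> real (Suc n) * max 0 (max (\<alpha> - z) (z - \<beta>))" by (intro mult_mono) auto
      then show ?thesis by (simp add: \<psi>_def)
    qed
    have lim: "(\<lambda>n. \<psi> n x) \<longlonglongrightarrow> indicator {\<alpha>..\<beta>} x" for x
    proof (cases "x \<in> {\<alpha>..\<beta>}")
      case True
      then have "\<psi> n x = 1" for n by (auto simp: \<psi>_def)
      then show ?thesis using True by simp
    next
      case False
      define d where "d = max 0 (max (\<alpha> - x) (x - \<beta>))"
      have d: "d > 0" using False by (auto simp: d_def)
      obtain m :: nat where m: "1 / d < real m" using reals_Archimedean2 by blast
      have "\<psi> n x = 0" if "n \<ge> m" for n
      proof -
        have "1 / d \<le> real (Suc n)" using m that by linarith
        then have "1 \<le> real (Suc n) * d" using d by (simp add: field_simps)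
        then show ?thesis by (simp add: \<psi>_def d_def)
      qed
      then have "eventually (\<lambda>n. \<psi> n x = 0) sequentially" by (auto simp: eventually_sequentially)
      then show ?thesis using False by (simp add: tendsto_eventually)
    qed
    have m\<psi>: "\<psi> n \<in> borel_measurable lebesgue" for n
      by (intro borel_measurable_lebesgueI borel_measurable_continuous_onI c\<psi>)
    have b1: "\<bar>\<psi> n x\<bar> \<le> 1" for n x by (auto simp: \<psi>_def)
    have conv: "(\<lambda>n. LINT t:{-N..N}|lebesgue. k t * \<psi> n t) \<longlonglongrightarrow> (LINT t:{\<alpha>..\<beta>}|lebesgue. k t)"
      if k: "set_integrable lebesgue {-N..N} k" and km: "k \<in> borel_measurable lebesgue" for k
    proof -
      have "(\<lambda>n. LINT t:{-N..N}|lebesgue. k t * \<psi> n t) \<longlonglongrightarrow> (LINT t:{-N..N}|lebesgue. k t * indicator {\<alpha>..\<beta>} t)"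
        unfolding set_lebesgue_integral_def
      proof (rule integral_dominated_convergence)
        show "integrable lebesgue (\<lambda>t. \<bar>indicator {-N..N} t *\<^sub>R k t\<bar>)"
          using k unfolding set_integrable_def by (rule integrable_abs)
        show "(\<lambda>x. indicat_real {- N..N} x *\<^sub>R (k x * indicat_real {\<alpha>..\<beta>} x)) \<in> borel_measurable lebesgue"
          using km by (intro borel_measurable_scaleR borel_measurable_indicator borel_measurable_times) auto
        show "(\<lambda>x. indicat_real {- N..N} x *\<^sub>R (k x * \<psi> n x)) \<in> borel_measurable lebesgue" for n
          using km m\<psi>[of n] by (intro borel_measurable_scaleR borel_measurable_indicator borel_measurable_times) auto
        show "AE x in lebesgue. norm (indicat_real {- N..N} x *\<^sub>R (k x * \<psi> n x)) \<le> \<bar>indicator {-N..N} x *\<^sub>R k x\<bar>" for n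
          using b1[of n] by (auto simp: abs_mult indicator_def mult_left_le)
        show "AE x in lebesgue. (\<lambda>n. indicat_real {- N..N} x *\<^sub>R (k x * \<psi> n x)) \<longlonglongrightarrow> indicat_real {- N..N} x *\<^sub>R (k x * indicat_real {\<alpha>..\<beta>} x)"
          by (intro AE_I2 tendsto_intros lim)
      qed
      also have "(LINT t:{-N..N}|lebesgue. k t * indicator {\<alpha>..\<beta>} t) = (LINT t:{\<alpha>..\<beta>}|lebesgue. k t)"
        unfolding set_lebesgue_integral_def
        by (intro Bochner_Integration.integral_cong refl) (auto simp: indicator_def N_def)
      finally show ?thesis .
    qed
    have h1: "set_integrable lebesgue {a..b} h" for a b using hi[of "\<lambda>_. 1"] by simp
    have k1: "set_integrable lebesgue {a..b} (\<lambda>_. c)" for a b :: real by (rule ci) auto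
    have "(LINT t:{-N..N}|lebesgue. h t * \<psi> n t) = (LINT t:{-N..N}|lebesgue. c * \<psi> n t)" for n
      using test[OF N c\<psi> s] by simp
    then have "(LINT t:{\<alpha>..\<beta>}|lebesgue. h t) = (LINT t:{\<alpha>..\<beta>}|lebesgue. c)"
      using conv[OF h1 hm] conv[OF k1] LIMSEQ_unique by auto
    then show "(LINT t:{\<alpha>..\<beta>}|lebesgue. h t - c) = 0"
      using h1 k1 by (subst set_integral_diff(2)) auto
  qed
  then have "AE x in lebesgue. f x = P x + c" by eventually_elim (auto simp: h_def)
  moreover have "bounded_primitive (\<lambda>x. P x + c) q"
    using P by (auto simp: bounded_primitive_def)
  ultimately show ?thesis by blast
qed

lemma continuous_AE_eq:
  fixes f g :: "real \<Rightarrow> real"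
  assumes "continuous_on UNIV f" "continuous_on UNIV g" and ae: "AE x in lebesgue. f x = g x"
  shows "f x = g x"
proof (rule ccontr)
  assume "f x \<noteq> g x"
  moreover have o: "open {x. f x \<noteq> g x}" using assms by (intro open_Collect_neq) auto
  ultimately have "\<not> negligible {x. f x \<noteq> g x}" by (intro open_not_negligible) auto
  moreover have "{x. f x \<noteq> g x} \<in> null_sets lebesgue"
    using AE_iff_null[of lebesgue "\<lambda>x. f x = g x"] ae o by (auto simp: sets_completionI_sets)
  ultimately show False by (simp add: negligible_iff_null_sets)
qed

text \<open>
  The first weak derivative has a Lipschitz representative, so the function itself is continuously differentiable in the
  classical sense.
\<close>

lemma W2inf_regularity:
  assumes "W2inf f p q"
  obtains P where "bounded_primitive P q" "AE x in lebesgue. p x = P x"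
    "\<And>x. (f has_real_derivative P x) (at x)"
proof -
  have f: "continuous_on UNIV f" "f \<in> Linf" "p \<in> Linf" "q \<in> Linf"
    and w: "has_weak_gradient_on f p UNIV" "has_weak_gradient_on p q UNIV"
    using assms by (auto simp: W2inf_def)
  obtain P where P: "bounded_primitive P q" "AE x in lebesgue. p x = P x"
    using weak_derivative_is_bounded_primitive[OF f(3,4) w(2)] by blast
  obtain F where F: "bounded_primitive F p" "AE x in lebesgue. f x = F x"
    using weak_derivative_is_bounded_primitive[OF f(2,3) w(1)] by blast
  have fF: "f x = F x" for x
    by (rule continuous_AE_eq[OF f(1) bounded_primitive_continuous[OF F(1)] F(2)])
  have cP: "continuous_on UNIV P" by (rule bounded_primitive_continuous[OF P(1)])
  have "f y - f x = (LINT t:{x..y}|lebesgue. P t)" if "x \<le> y" for x y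
    unfolding fF bounded_primitiveD(3)[OF F(1) that] set_lebesgue_integral_def
    by (rule integral_cong_AE)
      (use P(2) in \<open>auto intro!: borel_measurable_times borel_measurable_indicator LinfD[OF f(3)]
          borel_measurable_lebesgueI[OF borel_measurable_continuous_onI[OF cP]]\<close>)
  then have "(f has_real_derivative P x) (at x)" for x
    by (rule primitive_has_derivative_at_continuous[OF _ cP])
  then show ?thesis using that P by blast
qed

section \<open>Square integrable functions\<close>

definition square_integrable :: "'a measure \<Rightarrow> ('a \<Rightarrow> real) \<Rightarrow> bool" where
  "square_integrable M f \<longleftrightarrow> f \<in> borel_measurable M \<and> integrable M (\<lambda>x. (f x)\<^sup>2)"

definition L2_norm :: "'a measure \<Rightarrow> ('a \<Rightarrow> real) \<Rightarrow> real" where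
  "L2_norm M f = sqrt (\<integral>x. (f x)\<^sup>2 \<partial>M)"

lemma L2_norm_nonneg [simp]: "0 \<le> L2_norm M f"
  by (simp add: L2_norm_def)

lemma L2_norm_square: "(L2_norm M f)\<^sup>2 = (\<integral>x. (f x)\<^sup>2 \<partial>M)"
  by (simp add: L2_norm_def)

lemma square_integrable_mult:
  assumes "square_integrable M f" "square_integrable M g"
  shows "integrable M (\<lambda>x. f x * g x)"
proof (rule Bochner_Integration.integrable_bound)
  show "integrable M (\<lambda>x. (f x)\<^sup>2 + (g x)\<^sup>2)"
    using assms by (auto simp: square_integrable_def)
  show "(\<lambda>x. f x * g x) \<in> borel_measurable M"
    using assms by (auto simp: square_integrable_def)
  have "\<bar>f x * g x\<bar> \<le> (f x)\<^sup>2 + (g x)\<^sup>2" for x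
  proof -
    have "0 \<le> (\<bar>f x\<bar> - \<bar>g x\<bar>)\<^sup>2" by simp
    then have "2 * (\<bar>f x\<bar> * \<bar>g x\<bar>) \<le> (f x)\<^sup>2 + (g x)\<^sup>2" by (simp add: power2_diff)
    moreover have "0 \<le> \<bar>f x\<bar> * \<bar>g x\<bar>" by simp
    ultimately have "\<bar>f x\<bar> * \<bar>g x\<bar> \<le> (f x)\<^sup>2 + (g x)\<^sup>2" by linarith
    then show ?thesis by (simp add: abs_mult)
  qed
  then show "AE x in M. norm (f x * g x) \<le> norm ((f x)\<^sup>2 + (g x)\<^sup>2)" by auto
qed

lemma square_integrable_bounded_mult:
  assumes "square_integrable M f" "w \<in> borel_measurable M" "AE x in M. \<bar>w x\<bar> \<le> K"
  shows "square_integrable M (\<lambda>x. w x * f x)"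
  unfolding square_integrable_def
proof
  show m: "(\<lambda>x. w x * f x) \<in> borel_measurable M" using assms by (auto simp: square_integrable_def)
  show "integrable M (\<lambda>x. (w x * f x)\<^sup>2)"
  proof (rule Bochner_Integration.integrable_bound)
    show "integrable M (\<lambda>x. K\<^sup>2 * (f x)\<^sup>2)" using assms by (auto simp: square_integrable_def)
    show "AE x in M. norm ((w x * f x)\<^sup>2) \<le> norm (K\<^sup>2 * (f x)\<^sup>2)"
      using assms(3) by eventually_elim
        (auto simp: power_mult_distrib abs_mult intro!: mult_right_mono abs_le_square_iff[THEN iffD1])
  qed (use m in auto)
qed

lemma square_integrable_scale:
  "square_integrable M f \<Longrightarrow> square_integrable M (\<lambda>x. k * f x)"
  by (auto simp: square_integrable_def power_mult_distrib)

lemma square_integrable_add: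
  assumes "square_integrable M f" "square_integrable M g"
  shows "square_integrable M (\<lambda>x. f x + g x)"
  using square_integrable_mult[OF assms] assms by (auto simp: square_integrable_def power2_sum mult.assoc)

lemma square_integrable_diff:
  assumes "square_integrable M f" "square_integrable M g"
  shows "square_integrable M (\<lambda>x. f x - g x)"
  using square_integrable_add[OF assms(1) square_integrable_scale[OF assms(2), of "-1"]] by simp

text \<open>
  The quadratic polynomial \<open>t \<mapsto> \<integral> (f + t g)\<^sup>2\<close> is nonnegative.
\<close>

lemma Cauchy_Schwarz_integral:
  assumes f: "square_integrable M f" and g: "square_integrable M g"
  shows "\<bar>\<integral>x. f x * g x \<partial>M\<bar> \<le> L2_norm M f * L2_norm M g"
proof -
  define A B C where "A = (\<integral>x. (f x)\<^sup>2 \<partial>M)" and "B = (\<integral>x. f x * g x \<partial>M)" and "C = (\<integral>x. (g x)\<^sup>2 \<partial>M)"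
  have i: "integrable M (\<lambda>x. (f x)\<^sup>2)" "integrable M (\<lambda>x. (g x)\<^sup>2)" "integrable M (\<lambda>x. f x * g x)"
    using f g square_integrable_mult[OF f g] by (auto simp: square_integrable_def)
  have q: "0 \<le> A + 2 * t * B + t\<^sup>2 * C" for t
  proof -
    have "0 \<le> (\<integral>x. (f x + t * g x)\<^sup>2 \<partial>M)" by simp
    also have "(\<lambda>x. (f x + t * g x)\<^sup>2) = (\<lambda>x. (f x)\<^sup>2 + (2 * t * (f x * g x) + t\<^sup>2 * (g x)\<^sup>2))"
      by (auto simp: power2_eq_square algebra_simps)
    also have "(\<integral>x. (f x)\<^sup>2 + (2 * t * (f x * g x) + t\<^sup>2 * (g x)\<^sup>2) \<partial>M) = A + (2 * t * B + t\<^sup>2 * C)"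
      unfolding A_def B_def C_def using i by simp
    finally show ?thesis by simp
  qed
  have C0: "0 \<le> C" by (simp add: C_def)
  have "B\<^sup>2 \<le> A * C"
  proof (cases "C = 0")
    case True
    have "B = 0"
    proof (rule ccontr)
      assume "B \<noteq> 0"
      then show False using q[of "- (A + 1) / (2 * B)"] True by (simp add: field_simps)
    qed
    then show ?thesis using True by simp
  next
    case False
    then have "C > 0" using C0 by simp
    then have "0 \<le> C * (A + 2 * (- B / C) * B + (- B / C)\<^sup>2 * C)"
      using q[of "- B / C"] by (intro mult_nonneg_nonneg) auto
    also have "\<dots> = A * C - B\<^sup>2" using \<open>C > 0\<close> by (simp add: field_simps power2_eq_square)
    finally show ?thesis by simp
  qed
  then have "sqrt (B\<^sup>2) \<le> sqrt (A * C)" by (rule real_sqrt_le_mono)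
  then show ?thesis by (simp add: L2_norm_def A_def B_def C_def real_sqrt_mult)
qed

lemma weighted_Cauchy_Schwarz:
  assumes f: "square_integrable M f" and g: "square_integrable M g"
    and w: "w \<in> borel_measurable M" "AE x in M. \<bar>w x\<bar> \<le> K"
  shows "integrable M (\<lambda>x. w x * f x * g x)"
    "0 \<le> K \<Longrightarrow> \<bar>\<integral>x. w x * f x * g x \<partial>M\<bar> \<le> K * (L2_norm M f * L2_norm M g)"
proof -
  have wf: "square_integrable M (\<lambda>x. w x * f x)" by (rule square_integrable_bounded_mult[OF f w])
  show "integrable M (\<lambda>x. w x * f x * g x)" by (rule square_integrable_mult[OF wf g])
  assume K: "0 \<le> K"
  have "L2_norm M (\<lambda>x. w x * f x) \<le> sqrt (\<integral>x. K\<^sup>2 * (f x)\<^sup>2 \<partial>M)"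
    unfolding L2_norm_def
  proof (intro real_sqrt_le_mono integral_mono_AE)
    show "AE x in M. (w x * f x)\<^sup>2 \<le> K\<^sup>2 * (f x)\<^sup>2"
      using w(2) by eventually_elim
        (use K in \<open>auto simp: power_mult_distrib intro!: mult_right_mono abs_le_square_iff[THEN iffD1]\<close>)
  qed (use f wf in \<open>auto simp: square_integrable_def\<close>)
  also have "\<dots> = K * L2_norm M f" using K by (simp add: L2_norm_def real_sqrt_mult)
  finally have "L2_norm M (\<lambda>x. w x * f x) * L2_norm M g \<le> K * L2_norm M f * L2_norm M g"
    by (intro mult_right_mono) auto
  then show "\<bar>\<integral>x. w x * f x * g x \<partial>M\<bar> \<le> K * (L2_norm M f * L2_norm M g)"
    using Cauchy_Schwarz_integral[OF wf g] by simp
qed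

text \<open>
  This is how identities that hold for the smooth approximations of a Sobolev function are passed to the limit.
\<close>

lemma L2_convergence_weighted_product:
  assumes f: "square_integrable M f" and g: "square_integrable M g"
    and F: "\<And>n. square_integrable M (F n)" and G: "\<And>n. square_integrable M (G n)"
    and Ff: "(\<lambda>n. L2_norm M (\<lambda>x. F n x - f x)) \<longlonglongrightarrow> 0"
    and Gg: "(\<lambda>n. L2_norm M (\<lambda>x. G n x - g x)) \<longlonglongrightarrow> 0"
    and w: "w \<in> borel_measurable M" "AE x in M. \<bar>w x\<bar> \<le> K"
  shows "(\<lambda>n. \<integral>x. w x * F n x * G n x \<partial>M) \<longlonglongrightarrow> (\<integral>x. w x * f x * g x \<partial>M)"
proof -
  define d e where "d n x = F n x - f x" and "e n x = G n x - g x" for n x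
  have d: "square_integrable M (d n)" and e: "square_integrable M (e n)" for n
    unfolding d_def e_def by (intro square_integrable_diff f g F G)+
  define K' where "K' = \<bar>K\<bar>"
  have w': "AE x in M. \<bar>w x\<bar> \<le> K'" using w(2) by eventually_elim (auto simp: K'_def)
  have K': "0 \<le> K'" by (simp add: K'_def)
  note CS = weighted_Cauchy_Schwarz(2)[OF _ _ w(1) w' K']
  note I = weighted_Cauchy_Schwarz(1)[OF _ _ w(1) w']
  have bound: "\<bar>(\<integral>x. w x * F n x * G n x \<partial>M) - (\<integral>x. w x * f x * g x \<partial>M)\<bar> \<le>
      K' * (L2_norm M (d n) * L2_norm M (e n)) + K' * (L2_norm M f * L2_norm M (e n))
        + K' * (L2_norm M (d n) * L2_norm M g)" for n
  proof -
    have "(\<integral>x. w x * F n x * G n x \<partial>M) - (\<integral>x. w x * f x * g x \<partial>M)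
        = (\<integral>x. w x * F n x * G n x - w x * f x * g x \<partial>M)"
      by (rule Bochner_Integration.integral_diff[symmetric]) (intro I F G f g)+
    also have "(\<lambda>x. w x * F n x * G n x - w x * f x * g x)
        = (\<lambda>x. w x * d n x * e n x + (w x * f x * e n x + w x * d n x * g x))"
      by (auto simp: d_def e_def algebra_simps)
    also have "(\<integral>x. w x * d n x * e n x + (w x * f x * e n x + w x * d n x * g x) \<partial>M)
      = (\<integral>x. w x * d n x * e n x \<partial>M) + ((\<integral>x. w x * f x * e n x \<partial>M) + (\<integral>x. w x * d n x * g x \<partial>M))"
      by (subst Bochner_Integration.integral_add | intro Bochner_Integration.integrable_add I d e f g refl)+
    finally show ?thesis
      using CS[OF d[of n] e[of n]] CS[OF f e[of n]] CS[OF d[of n] g] by linarith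
  qed
  have "(\<lambda>n. L2_norm M (d n)) \<longlonglongrightarrow> 0" "(\<lambda>n. L2_norm M (e n)) \<longlonglongrightarrow> 0"
    using Ff Gg unfolding d_def e_def by -
  then have "(\<lambda>n. K' * (L2_norm M (d n) * L2_norm M (e n)) + K' * (L2_norm M f * L2_norm M (e n))
        + K' * (L2_norm M (d n) * L2_norm M g)) \<longlonglongrightarrow> K' * (0 * 0) + K' * (L2_norm M f * 0) + K' * (0 * L2_norm M g)"
    by (intro tendsto_intros)
  then have lim: "(\<lambda>n. K' * (L2_norm M (d n) * L2_norm M (e n)) + K' * (L2_norm M f * L2_norm M (e n))
        + K' * (L2_norm M (d n) * L2_norm M g)) \<longlonglongrightarrow> 0" by simp
  have "(\<lambda>n. (\<integral>x. w x * F n x * G n x \<partial>M) - (\<integral>x. w x * f x * g x \<partial>M)) \<longlonglongrightarrow> 0"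
    by (rule Lim_null_comparison[OF _ lim]) (use bound in auto)
  then show ?thesis by (simp add: LIM_zero_iff)
qed

section \<open>Integration over the plane and over rays\<close>

text \<open>
  Integrability of \<open>f\<close> and \<open>f'\<close> forces \<open>f\<close> to vanish at minus infinity. Instead of proving this separately, \<open>f\<close> is
  multiplied by the linear function \<open>k n\<close> that is zero at \<open>m - (n + 1)\<close> and one at \<open>m\<close>: the fundamental theorem of
  calculus then has no contribution from the left end point, and the extra term \<open>f / (n + 1)\<close> vanishes in the limit.
\<close>

lemma integral_derivative_over_left_ray:
  fixes f f' :: "real \<Rightarrow> real"
  assumes d: "\<And>x. (f has_real_derivative f' x) (at x)" and c: "continuous_on UNIV f'"
    and i: "set_integrable lborel {..<m} f" and i': "set_integrable lborel {..<m} f'"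
  shows "(LINT x:{..<m}|lborel. f' x) = f m"
proof -
  have cf: "continuous_on UNIV f"
    using d by (intro continuous_at_imp_continuous_on ballI) (rule DERIV_isCont)
  have [measurable]: "f \<in> borel_measurable borel" "f' \<in> borel_measurable borel"
    using c cf by (auto intro: borel_measurable_continuous_onI)
  define k where "k n x = 1 + (x - m) / real (Suc n)" for n x
  let ?g = "\<lambda>n x. (k n x * f' x + f x / real (Suc n)) * indicator {m - real (Suc n)..m} x"
  have FTC: "(\<integral>x. ?g n x \<partial>lborel) = f m" for n
  proof -
    have "(\<integral>x. ?g n x \<partial>lborel) = k n m * f m - k n (m - real (Suc n)) * f (m - real (Suc n))"
    proof (rule integral_FTC_Icc_real)
      show "((\<lambda>x. k n x * f x) has_real_derivative k n x * f' x + f x / real (Suc n)) (at x)" for x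
      proof -
        have "((\<lambda>x. (x - m) / real (Suc n)) has_real_derivative 1 / real (Suc n)) (at x)"
          by (rule DERIV_cdivide) (auto intro!: derivative_eq_intros)
        then have "(k n has_real_derivative 0 + 1 / real (Suc n)) (at x)"
          unfolding k_def by (intro DERIV_add DERIV_const)
        from DERIV_mult[OF this d[of x]] show ?thesis by (simp add: add.commute mult.commute)
      qed
      have "continuous_on UNIV (\<lambda>x. k n x * f' x + f x / real (Suc n))"
        unfolding k_def by (intro continuous_intros c cf) auto
      then show "isCont (\<lambda>x. k n x * f' x + f x / real (Suc n)) x" for x
        by (simp add: continuous_on_eq_continuous_at)
    qed auto
    moreover have "k n m = 1" "k n (m - real (Suc n)) = 0" by (auto simp: k_def field_simps)
    ultimately show ?thesis by simp
  qed
  have "(\<lambda>n. \<integral>x. ?g n x \<partial>lborel) \<longlonglongrightarrow> (\<integral>x. indicator {..<m} x *\<^sub>R f' x \<partial>lborel)"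
  proof (rule integral_dominated_convergence)
    show "integrable lborel (\<lambda>x. \<bar>indicator {..<m} x *\<^sub>R f' x\<bar> + \<bar>indicator {..<m} x *\<^sub>R f x\<bar>)"
      using i i' unfolding set_integrable_def by (intro Bochner_Integration.integrable_add integrable_abs)
    show "?g n \<in> borel_measurable lborel" for n unfolding k_def by measurable
    show "AE x in lborel. norm (?g n x) \<le> \<bar>indicator {..<m} x *\<^sub>R f' x\<bar> + \<bar>indicator {..<m} x *\<^sub>R f x\<bar>" for n
      using AE_lborel_singleton[of m]
    proof eventually_elim
      case (elim x)
      show ?case
      proof (cases "x \<in> {m - real (Suc n)..m}")
        case True
        have "0 \<le> k n x" "k n x \<le> 1" using True by (auto simp: k_def field_simps)
        then have "\<bar>k n x * f' x\<bar> \<le> 1 * \<bar>f' x\<bar>" unfolding abs_mult by (intro mult_right_mono) auto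
        moreover have "\<bar>f x / real (Suc n)\<bar> \<le> \<bar>f x\<bar> / 1" unfolding abs_divide by (intro divide_left_mono) auto
        ultimately have "\<bar>k n x * f' x + f x / real (Suc n)\<bar> \<le> \<bar>f' x\<bar> + \<bar>f x\<bar>" by linarith
        then show ?thesis using True elim by simp
      qed auto
    qed
    show "AE x in lborel. (\<lambda>n. ?g n x) \<longlonglongrightarrow> indicator {..<m} x *\<^sub>R f' x"
      using AE_lborel_singleton[of m]
    proof eventually_elim
      case (elim x)
      show ?case
      proof (cases "x < m")
        case True
        have l: "(\<lambda>n. s / real (Suc n)) \<longlonglongrightarrow> 0" for s by (rule LIMSEQ_Suc[OF lim_const_over_n])
        have "(\<lambda>n. k n x * f' x + f x / real (Suc n)) \<longlonglongrightarrow> (1 + 0) * f' x + 0"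
          unfolding k_def by (intro tendsto_intros l)
        moreover obtain j where j: "m - x \<le> real j" using real_arch_simple by blast
        have "\<forall>\<^sub>F n in sequentially. k n x * f' x + f x / real (Suc n) = ?g n x"
          using True j by (intro eventually_sequentiallyI[of j]) (auto simp: indicator_def)
        ultimately show ?thesis using True by (auto intro: Lim_transform_eventually)
      next
        case False
        then show ?thesis using elim by (auto simp: indicator_def)
      qed
    qed
  qed auto
  then show ?thesis unfolding FTC set_lebesgue_integral_def using LIMSEQ_unique tendsto_const by blast
qed

lemma set_integral_lebesgue_on:
  fixes f :: "'a::euclidean_space \<Rightarrow> real"
  assumes "S \<in> sets lebesgue"
  shows "(LINT z:S|lebesgue. f z) = integral\<^sup>L (lebesgue_on S) f"
    "set_integrable lebesgue S f \<longleftrightarrow> integrable (lebesgue_on S) f"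
  using assms by (simp_all add: set_lebesgue_integral_def set_integrable_def integral_restrict_space integrable_restrict_space)

lemma set_integral_completion:
  fixes f :: "'a::euclidean_space \<Rightarrow> real"
  assumes f: "f \<in> borel_measurable borel" and S: "S \<in> sets borel"
  shows "(LINT z:S|lebesgue. f z) = (LINT z:S|lborel. f z)"
    "set_integrable lebesgue S f \<longleftrightarrow> set_integrable lborel S f"
proof -
  have "(\<lambda>z. indicator S z *\<^sub>R f z) \<in> borel_measurable lborel" using assms by simp
  then show "(LINT z:S|lebesgue. f z) = (LINT z:S|lborel. f z)"
    "set_integrable lebesgue S f \<longleftrightarrow> set_integrable lborel S f"
    unfolding set_lebesgue_integral_def set_integrable_def
    by (simp_all add: integral_completion integrable_completion)
qed

lemma loc_integrable_on_continuous:
  fixes f :: "'a::euclidean_space \<Rightarrow> 'b::euclidean_space"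
  assumes "continuous_on UNIV f"
  shows "loc_integrable_on f U"
  unfolding loc_integrable_on_def
proof (intro allI impI)
  fix K :: "'a set" assume K: "compact K \<and> K \<subseteq> U"
  then have "integrable lborel (\<lambda>x. indicator K x *\<^sub>R f x)"
    using assms by (intro borel_integrable_compact) (auto intro: continuous_on_subset)
  then have "integrable lebesgue (\<lambda>x. indicator K x *\<^sub>R f x)"
    by (subst integrable_completion) auto
  then show "set_integrable lebesgue K f" by (simp add: set_integrable_def)
qed

text \<open>
  An open set is a countable union of compact sets.
\<close>

lemma loc_integrable_on_measurable:
  fixes f :: "'a::euclidean_space \<Rightarrow> 'b::euclidean_space"
  assumes f: "loc_integrable_on f U" and U: "open U" and S: "S \<subseteq> U" "S \<in> sets lebesgue"
  shows "f \<in> borel_measurable (lebesgue_on S)"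
proof -
  obtain C where C: "\<And>n::nat. compact (C n)" "\<And>n. C n \<subseteq> U" "\<And>n. C n \<subseteq> interior (C (Suc n))" "(\<Union>n. C n) = U"
    using open_Union_compact_subsets[OF U] by metis
  have mono: "C m \<subseteq> C n" if "m \<le> n" for m n
    using lift_Suc_mono_le[of C] C(3) interior_subset that by (metis order_trans)
  have m: "(\<lambda>x. indicator (C n) x *\<^sub>R f x) \<in> borel_measurable lebesgue" for n
    using f C(1,2)[of n] unfolding loc_integrable_on_def set_integrable_def by auto
  have "(\<lambda>x. indicator S x *\<^sub>R f x) \<in> borel_measurable lebesgue"
  proof (rule borel_measurable_LIMSEQ_metric)
    show "(\<lambda>x. indicator S x *\<^sub>R (indicator (C n) x *\<^sub>R f x)) \<in> borel_measurable lebesgue" for n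
      using S(2) by (intro borel_measurable_scaleR[OF _ m] borel_measurable_indicator) auto
    show "(\<lambda>n. indicat_real S x *\<^sub>R indicat_real (C n) x *\<^sub>R f x) \<longlonglongrightarrow> indicator S x *\<^sub>R f x" for x
    proof (cases "x \<in> S")
      case True
      then obtain m where "x \<in> C m" using S C(4) by auto
      then have "eventually (\<lambda>n. indicat_real S x *\<^sub>R indicat_real (C n) x *\<^sub>R f x = indicator S x *\<^sub>R f x) sequentially"
        using mono by (intro eventually_sequentiallyI[of m]) (auto simp: indicator_def)
      then show ?thesis by (rule tendsto_eventually)
    qed simp
  qed
  then show ?thesis using S by (subst borel_measurable_restrict_space_iff) auto
qed

lemma plane_Fubini:
  fixes F :: "real \<times> real \<Rightarrow> real"
  assumes "integrable lborel F"
  shows "AE y in lborel. integrable lborel (\<lambda>x. F (x, y))"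
    "(\<integral>z. F z \<partial>lborel) = (\<integral>y. (\<integral>x. F (x, y) \<partial>lborel) \<partial>lborel)"
    "(\<integral>z. F z \<partial>lborel) = (\<integral>x. (\<integral>y. F (x, y) \<partial>lborel) \<partial>lborel)"
    "integrable lborel (\<lambda>y. \<integral>x. F (x, y) \<partial>lborel)"
    "integrable lborel (\<lambda>x. \<integral>y. F (x, y) \<partial>lborel)"
proof -
  have F: "case_prod (\<lambda>x y. F (x, y)) = F" by auto
  have i: "integrable (lborel \<Otimes>\<^sub>M lborel) (case_prod (\<lambda>x y. F (x, y)))"
    using assms by (simp add: F lborel_prod)
  show "AE y in lborel. integrable lborel (\<lambda>x. F (x, y))"
    by (rule lborel_pair.AE_integrable_snd[OF i])
  show "(\<integral>z. F z \<partial>lborel) = (\<integral>y. (\<integral>x. F (x, y) \<partial>lborel) \<partial>lborel)"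
    using lborel_pair.integral_snd[OF i] unfolding F lborel_prod by (rule sym)
  show "(\<integral>z. F z \<partial>lborel) = (\<integral>x. (\<integral>y. F (x, y) \<partial>lborel) \<partial>lborel)"
    using lborel_pair.integral_fst[OF i] unfolding F lborel_prod by (rule sym)
  show "integrable lborel (\<lambda>y. \<integral>x. F (x, y) \<partial>lborel)"
    by (rule lborel_pair.integrable_snd[OF i])
  show "integrable lborel (\<lambda>x. \<integral>y. F (x, y) \<partial>lborel)"
    by (rule lborel_pair.integrable_fst[OF i])
qed

lemma C1_gradient_continuous:
  fixes \<phi> :: "'a::euclidean_space \<Rightarrow> real"
  assumes "C1_gradient \<phi> D"
  shows "continuous_on S \<phi>" "continuous_on S D"
proof -
  show "continuous_on S \<phi>"
    using assms unfolding C1_gradient_def gderiv_def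
    by (intro continuous_at_imp_continuous_on ballI) (auto intro: has_derivative_continuous)
  show "continuous_on S D"
    using assms continuous_on_subset unfolding C1_gradient_def by blast
qed

lemma C1_gradient_partial:
  fixes \<phi> :: "real \<times> real \<Rightarrow> real"
  assumes "C1_gradient \<phi> D"
  shows "((\<lambda>x. \<phi> (x, y)) has_real_derivative fst (D (x, y))) (at x)"
    and "((\<lambda>y. \<phi> (x, y)) has_real_derivative snd (D (x, y))) (at y)"
proof -
  have d: "(\<phi> has_derivative (\<lambda>h. h \<bullet> D z)) (at z)" for z
    using assms unfolding C1_gradient_def gderiv_def by blast
  show "((\<lambda>x. \<phi> (x, y)) has_real_derivative fst (D (x, y))) (at x)"
    unfolding has_field_derivative_def
    by (rule has_derivative_eq_rhs, rule has_derivative_compose[OF _ d, of "\<lambda>x. (x, y)"])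
      (auto intro!: derivative_eq_intros simp: inner_prod_def mult.commute)
  show "((\<lambda>y. \<phi> (x, y)) has_real_derivative snd (D (x, y))) (at y)"
    unfolding has_field_derivative_def
    by (rule has_derivative_eq_rhs, rule has_derivative_compose[OF _ d, of "\<lambda>y. (x, y)"])
      (auto intro!: derivative_eq_intros simp: inner_prod_def mult.commute)
qed

text \<open>
  Fubini, integrating each partial derivative first along its own direction.
\<close>

lemma integral_C1_gradient_compact_support:
  fixes \<psi> :: "real \<times> real \<Rightarrow> real"
  assumes C: "C1_gradient \<psi> D" and K: "compact K" "\<And>z. z \<notin> K \<Longrightarrow> \<psi> z = 0"
  shows "integrable lborel D" "(\<integral>z. D z \<partial>lborel) = 0"
proof -
  have cD: "continuous_on S D" for S using C continuous_on_subset unfolding C1_gradient_def by blast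
  have D0: "D z = 0" if "z \<notin> K" for z by (rule gradient_zero_off_support[OF C K that])
  have "integrable lborel (\<lambda>z. indicator K z *\<^sub>R D z)"
    by (rule borel_integrable_compact[OF K(1) cD])
  also have "(\<lambda>z. indicator K z *\<^sub>R D z) = D" using D0 by (auto simp: indicator_def)
  finally show iD: "integrable lborel D" .
  obtain N where N: "N > 0" "\<And>z. z \<in> K \<Longrightarrow> norm z < N"
    using compact_imp_bounded[OF K(1)] by (metis bounded_pos_less)
  have out: "\<psi> (x, y) = 0" "D (x, y) = 0" if "\<bar>x\<bar> \<ge> N \<or> \<bar>y\<bar> \<ge> N" for x y
  proof -
    have "\<bar>x\<bar> \<le> norm (x, y)" "\<bar>y\<bar> \<le> norm (x, y)"
      by (simp_all add: norm_Pair real_sqrt_ge_abs1 real_sqrt_ge_abs2)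
    then have "(x, y) \<notin> K" using that N(2) by force
    then show "\<psi> (x, y) = 0" "D (x, y) = 0" using K D0 by auto
  qed
  have line: "(\<integral>t. k' t \<partial>lborel) = 0"
    if k: "\<And>t. (k has_real_derivative k' t) (at t)" "continuous_on UNIV k'" "\<And>t. \<bar>t\<bar> \<ge> N \<Longrightarrow> k t = 0 \<and> k' t = 0"
    for k k' :: "real \<Rightarrow> real"
  proof -
    have "(\<integral>t. k' t * indicator {-N..N} t \<partial>lborel) = k N - k (-N)"
      by (rule integral_FTC_Icc_real) (use N k in \<open>auto simp: continuous_on_eq_continuous_at\<close>)
    also have "(\<lambda>t. k' t * indicator {-N..N} t) = k'"
    proof
      fix t show "k' t * indicator {-N..N} t = k' t" using k(3)[of t] by (cases "\<bar>t\<bar> \<ge> N") (auto simp: indicator_def)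
    qed
    finally show ?thesis using k(3)[of N] k(3)[of "-N"] N by simp
  qed
  have ifst: "integrable lborel (\<lambda>z. fst (D z))" and isnd: "integrable lborel (\<lambda>z. snd (D z))"
    using iD by (auto intro: integrable_bounded_linear bounded_linear_fst bounded_linear_snd)
  have "(\<integral>z. fst (D z) \<partial>lborel) = (\<integral>y. (\<integral>x. fst (D (x, y)) \<partial>lborel) \<partial>lborel)"
    by (rule plane_Fubini(2)[OF ifst])
  also have "\<dots> = 0"
  proof -
    have "(\<integral>x. fst (D (x, y)) \<partial>lborel) = 0" for y
      by (rule line[OF C1_gradient_partial(1)[OF C]]) (auto simp: out intro!: continuous_on_fst continuous_on_compose2[OF cD[of UNIV]] continuous_intros)
    then show ?thesis by simp
  qed
  finally have 1: "(\<integral>z. fst (D z) \<partial>lborel) = 0" .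
  have "(\<integral>z. snd (D z) \<partial>lborel) = (\<integral>x. (\<integral>y. snd (D (x, y)) \<partial>lborel) \<partial>lborel)"
    by (rule plane_Fubini(3)[OF isnd])
  also have "\<dots> = 0"
  proof -
    have "(\<integral>y. snd (D (x, y)) \<partial>lborel) = 0" for x
      by (rule line[OF C1_gradient_partial(2)[OF C]]) (auto simp: out intro!: continuous_on_snd continuous_on_compose2[OF cD[of UNIV]] continuous_intros)
    then show ?thesis by simp
  qed
  finally have 2: "(\<integral>z. snd (D z) \<partial>lborel) = 0" .
  have "fst (\<integral>z. D z \<partial>lborel) = 0" "snd (\<integral>z. D z \<partial>lborel) = 0"
    using 1 2 integral_bounded_linear[OF bounded_linear_fst iD] integral_bounded_linear[OF bounded_linear_snd iD]
    by auto
  then show "(\<integral>z. D z \<partial>lborel) = 0" by (simp add: prod_eq_iff)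
qed

text \<open>
  The product rule; the product with a test function has compact support.
\<close>

lemma C1_gradient_imp_weak_gradient:
  fixes w :: "real \<times> real \<Rightarrow> real"
  assumes w: "C1_gradient w H"
  shows "has_weak_gradient_on w H U"
  unfolding has_weak_gradient_on_def
proof (intro conjI allI impI)
  have cH: "continuous_on S H" for S using w continuous_on_subset unfolding C1_gradient_def by blast
  have cw: "continuous_on S w" for S by (rule C1_gradient_continuous[OF w])
  show "loc_integrable_on w U" "loc_integrable_on H U"
    by (rule loc_integrable_on_continuous cw cH)+
  fix \<phi> D assume "C1_gradient \<phi> D \<and> (\<exists>K. compact K \<and> K \<subseteq> U \<and> (\<forall>z. z \<notin> K \<longrightarrow> \<phi> z = 0))"
  then obtain K where C: "C1_gradient \<phi> D" and K: "compact K" "K \<subseteq> U" "\<And>z. z \<notin> K \<Longrightarrow> \<phi> z = 0" by blast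
  have cD: "continuous_on S D" for S using C continuous_on_subset unfolding C1_gradient_def by blast
  have D0: "D z = 0" if "z \<notin> K" for z by (rule gradient_zero_off_support[OF C K(1,3) that])
  have prod: "C1_gradient (\<lambda>z. w z * \<phi> z) (\<lambda>z. w z *\<^sub>R D z + \<phi> z *\<^sub>R H z)"
    using C w cw[of UNIV] C1_gradient_continuous(1)[OF C, of UNIV] cD[of UNIV] cH[of UNIV]
    by (auto simp: C1_gradient_def intro!: GDERIV_mult continuous_intros)
  have I: "integrable lborel (\<lambda>z. w z *\<^sub>R D z + \<phi> z *\<^sub>R H z)"
    "(\<integral>z. w z *\<^sub>R D z + \<phi> z *\<^sub>R H z \<partial>lborel) = 0"
    using integral_C1_gradient_compact_support[OF prod K(1)] K(3) by auto
  have i: "integrable lborel (\<lambda>z. indicator K z *\<^sub>R (w z *\<^sub>R D z))" "integrable lborel (\<lambda>z. indicator K z *\<^sub>R (\<phi> z *\<^sub>R H z))"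
    by (intro borel_integrable_compact K(1) continuous_intros cw cD cH C1_gradient_continuous(1)[OF C])+
  have eq: "(LINT z:U|lebesgue. w z *\<^sub>R D z) = (\<integral>z. indicator K z *\<^sub>R (w z *\<^sub>R D z) \<partial>lborel)"
    "(LINT z:U|lebesgue. \<phi> z *\<^sub>R H z) = (\<integral>z. indicator K z *\<^sub>R (\<phi> z *\<^sub>R H z) \<partial>lborel)"
  proof -
    have 1: "(\<lambda>z. indicat_real U z *\<^sub>R (w z *\<^sub>R D z)) = (\<lambda>z. indicator K z *\<^sub>R (w z *\<^sub>R D z))"
      using K(2) D0 by (auto simp: indicator_def fun_eq_iff)
    have 2: "(\<lambda>z. indicat_real U z *\<^sub>R (\<phi> z *\<^sub>R H z)) = (\<lambda>z. indicator K z *\<^sub>R (\<phi> z *\<^sub>R H z))"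
      using K(2,3) by (auto simp: indicator_def fun_eq_iff)
    show "(LINT z:U|lebesgue. w z *\<^sub>R D z) = (\<integral>z. indicator K z *\<^sub>R (w z *\<^sub>R D z) \<partial>lborel)"
      unfolding set_lebesgue_integral_def 1 using i(1) by (intro integral_completion) auto
    show "(LINT z:U|lebesgue. \<phi> z *\<^sub>R H z) = (\<integral>z. indicator K z *\<^sub>R (\<phi> z *\<^sub>R H z) \<partial>lborel)"
      unfolding set_lebesgue_integral_def 2 using i(2) by (intro integral_completion) auto
  qed
  have "(LINT z:U|lebesgue. w z *\<^sub>R D z) + (LINT z:U|lebesgue. \<phi> z *\<^sub>R H z)
      = (\<integral>z. indicator K z *\<^sub>R (w z *\<^sub>R D z) + indicator K z *\<^sub>R (\<phi> z *\<^sub>R H z) \<partial>lborel)"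
    unfolding eq by (rule Bochner_Integration.integral_add[symmetric, OF i])
  also have "(\<lambda>z. indicator K z *\<^sub>R (w z *\<^sub>R D z) + indicator K z *\<^sub>R (\<phi> z *\<^sub>R H z)) = (\<lambda>z. w z *\<^sub>R D z + \<phi> z *\<^sub>R H z)"
    using K(3) D0 by (auto simp: indicator_def fun_eq_iff)
  finally show "(LINT z:U|lebesgue. w z *\<^sub>R D z) = - (LINT z:U|lebesgue. \<phi> z *\<^sub>R H z)"
    using I(2) by (simp add: eq_neg_iff_add_eq_0)
qed

section \<open>One period of the domain\<close>

lemma norm_prod_square:
  fixes p :: "real \<times> real"
  shows "(norm p)\<^sup>2 = (fst p)\<^sup>2 + (snd p)\<^sup>2"
  by (simp add: norm_prod_def)

lemma nn_integral_exp_left_ray: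
  fixes k m :: real
  assumes "k > 0"
  shows "(\<integral>\<^sup>+x. ennreal (exp (k * x)) * indicator {..<m} x \<partial>lborel) = ennreal (exp (k * m) / k)"
proof -
  have "(\<integral>\<^sup>+x. ennreal (exp (k * x)) * indicator {..<m} x \<partial>lborel)
      = (\<integral>\<^sup>+x. ennreal (exp (k * (- x))) * indicator {..<m} (- x) \<partial>lborel)"
    using nn_integral_real_affine[of "\<lambda>x. ennreal (exp (k * x)) * indicator {..<m} x" "-1" 0] by simp
  also have "\<dots> = (\<integral>\<^sup>+x. ennreal (exp (- (k * x))) * indicator {-m..} x \<partial>lborel)"
    using AE_lborel_singleton[of "-m"]
    by (intro nn_integral_cong_AE, eventually_elim) (auto simp: indicator_def)
  also have "\<dots> = ennreal (0 - (- exp (- (k * (- m))) / k))"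
  proof (rule nn_integral_FTC_atLeast)
    show "((\<lambda>x. - exp (- (k * x)) / k) has_real_derivative exp (- (k * x))) (at x)" for x
      using assms by (auto intro!: derivative_eq_intros)
    show "((\<lambda>x. - exp (- (k * x)) / k) \<longlongrightarrow> 0) at_top"
    proof -
      have "filterlim (\<lambda>x. k * x) at_top at_top"
        using assms by (intro filterlim_tendsto_pos_mult_at_top[OF tendsto_const] filterlim_ident)
      then have "((\<lambda>x. exp (- (k * x))) \<longlongrightarrow> 0) at_top"
        by (intro filterlim_compose[OF exp_at_bot] filterlim_compose[OF filterlim_uminus_at_bot_at_top])
      then have "((\<lambda>x. - exp (- (k * x)) / k) \<longlongrightarrow> - 0 / k) at_top" using assms by (intro tendsto_intros) auto
      then show ?thesis by simp
    qed
  qed auto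
  finally show ?thesis by simp
qed

text \<open>
  Functions on one period cell are studied with two measures: \<open>bulk\<close> is Lebesgue measure on the cell and \<open>edge\<close> is
  Lebesgue measure on the parameter interval of its curved boundary.
\<close>

locale periodic_cell =
  fixes \<epsilon> :: real and v :: "real \<Rightarrow> real"
  assumes eps_pos: "0 < \<epsilon>" and v_cont: "continuous_on UNIV v" and v_per: "\<And>y. v (y + \<epsilon>) = v y"
begin

abbreviation bulk :: "(real \<times> real) measure" where "bulk \<equiv> lebesgue_on (Dom_per \<epsilon> v)"
abbreviation edge :: "real measure" where "edge \<equiv> lebesgue_on {0<..<\<epsilon>}"

lemma v_cont_on: "continuous_on S v"
  using v_cont continuous_on_subset by blast

lemma continuous_on_v_snd: "continuous_on S (\<lambda>z. v (snd z))"
  by (rule continuous_on_compose2[OF v_cont]) (auto intro!: continuous_intros)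

lemma open_Dom: "open (Dom v)"
proof -
  have "Dom v = {z. fst z < v (snd z)}" by (auto simp: Dom_def)
  then show ?thesis by (auto intro!: open_Collect_less continuous_on_v_snd continuous_intros)
qed

lemma open_Dom_per: "open (Dom_per \<epsilon> v)"
proof -
  have "Dom_per \<epsilon> v = Dom v \<inter> ({z. 0 < snd z} \<inter> {z. snd z < \<epsilon>})" by (auto simp: Dom_per_def)
  then show ?thesis by (auto intro!: open_Int open_Dom open_Collect_less continuous_intros)
qed

lemma Dom_per_borel [simp]: "Dom_per \<epsilon> v \<in> sets borel"
  using open_Dom_per by simp

lemma Dom_per_lebesgue [simp]: "Dom_per \<epsilon> v \<in> sets lebesgue"
  by simp

lemma indicator_Dom_per: "indicat_real (Dom_per \<epsilon> v) (x, y) = indicator {..<v y} x * indicator {0<..<\<epsilon>} y"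
  by (auto simp: Dom_per_def Dom_def indicator_def)

lemma borel_measurable_bulk: "f \<in> borel_measurable borel \<Longrightarrow> f \<in> borel_measurable bulk"
  by (intro measurable_restrict_space1 measurable_completion) simp

lemma borel_measurable_edge: "f \<in> borel_measurable borel \<Longrightarrow> f \<in> borel_measurable edge"
  by (intro measurable_restrict_space1 measurable_completion) simp

lemma coefficient_measurable:
  assumes "B \<in> borel_measurable borel"
  shows "(\<lambda>z. B (snd z)) \<in> borel_measurable bulk"
  by (intro borel_measurable_bulk measurable_compose[OF _ assms] borel_measurable_continuous_onI continuous_on_snd continuous_on_id)

lemma bulk_integral_lborel:
  fixes f :: "real \<times> real \<Rightarrow> real"
  assumes "f \<in> borel_measurable borel"
  shows "(\<integral>z. f z \<partial>bulk) = (\<integral>z. indicator (Dom_per \<epsilon> v) z *\<^sub>R f z \<partial>lborel)"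
    "integrable bulk f \<longleftrightarrow> integrable lborel (\<lambda>z. indicator (Dom_per \<epsilon> v) z *\<^sub>R f z)"
  using set_integral_lebesgue_on[OF Dom_per_lebesgue, of f] set_integral_completion[OF assms Dom_per_borel]
  unfolding set_integrable_def set_lebesgue_integral_def by simp_all

lemma finite_edge: "finite_measure edge"
  by (intro finite_measure_lebesgue_on) auto

lemma H1_square_integrable:
  assumes "H1_per \<epsilon> v u G"
  shows "square_integrable bulk u" "square_integrable bulk (\<lambda>z. fst (G z))" "square_integrable bulk (\<lambda>z. snd (G z))"
proof -
  have sub: "Dom_per \<epsilon> v \<subseteq> Dom v" by (auto simp: Dom_per_def)
  have w: "loc_integrable_on u (Dom v)" "loc_integrable_on G (Dom v)"
    using assms by (auto simp: H1_per_def has_weak_gradient_on_def)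
  have m: "u \<in> borel_measurable bulk" "G \<in> borel_measurable bulk"
    by (rule loc_integrable_on_measurable[OF _ open_Dom sub Dom_per_lebesgue], fact w)+
  have m2: "(\<lambda>z. fst (G z)) \<in> borel_measurable bulk" "(\<lambda>z. snd (G z)) \<in> borel_measurable bulk"
    by (intro measurable_compose[OF m(2)] borel_measurable_continuous_onI continuous_on_fst continuous_on_snd continuous_on_id)+
  have i: "integrable bulk (\<lambda>z. (u z)\<^sup>2 + (norm (G z))\<^sup>2)"
    using assms set_integral_lebesgue_on(2)[OF Dom_per_lebesgue] by (auto simp: H1_per_def)
  have "integrable bulk (\<lambda>z. (u z)\<^sup>2)"
    by (rule Bochner_Integration.integrable_bound[OF i]) (use m in auto)
  moreover have "integrable bulk (\<lambda>z. (fst (G z))\<^sup>2)"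
    by (rule Bochner_Integration.integrable_bound[OF i]) (use m2 in \<open>auto simp: norm_prod_square\<close>)
  moreover have "integrable bulk (\<lambda>z. (snd (G z))\<^sup>2)"
    by (rule Bochner_Integration.integrable_bound[OF i]) (use m2 in \<open>auto simp: norm_prod_square\<close>)
  ultimately show "square_integrable bulk u" "square_integrable bulk (\<lambda>z. fst (G z))" "square_integrable bulk (\<lambda>z. snd (G z))"
    using m m2 by (auto simp: square_integrable_def)
qed

lemma continuous_edge_square_integrable:
  assumes "continuous_on UNIV f"
  shows "square_integrable edge f"
  unfolding square_integrable_def
proof
  show "f \<in> borel_measurable edge"
    by (intro borel_measurable_edge borel_measurable_continuous_onI assms)
  have "continuous_on {0..\<epsilon>} (\<lambda>y. (f y)\<^sup>2)" using assms by (auto intro!: continuous_intros intro: continuous_on_subset)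
  then have "set_integrable lborel {0..\<epsilon>} (\<lambda>y. (f y)\<^sup>2)" by (rule borel_integrable_atLeastAtMost')
  then have "set_integrable lebesgue {0..\<epsilon>} (\<lambda>y. (f y)\<^sup>2)"
    by (subst set_integral_completion(2)) (auto intro!: borel_measurable_continuous_onI continuous_intros assms)
  then have "set_integrable lebesgue {0<..<\<epsilon>} (\<lambda>y. (f y)\<^sup>2)"
    by (rule set_integrable_subset) auto
  then show "integrable edge (\<lambda>y. (f y)\<^sup>2)" by (subst (asm) set_integral_lebesgue_on(2)) auto
qed

lemma continuous_on_boundary_values:
  assumes "continuous_on UNIV \<Psi>"
  shows "continuous_on UNIV (\<lambda>y. \<Psi> (v y, y))"
  by (rule continuous_on_compose2[OF assms]) (auto intro!: continuous_intros v_cont)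

text \<open>
  The single integral in the definition of a trace is split into the convergence of the function and of both partial
  derivatives in \<open>L\<^sup>2\<close>.
\<close>

lemma trace_approximation:
  assumes tr: "is_trace \<epsilon> v u G \<tau>"
  obtains \<phi> D where "\<And>n::nat. C1_gradient (\<phi> n) (D n)" "\<And>n. H1_per \<epsilon> v (\<phi> n) (D n)"
    "(\<lambda>n. L2_norm bulk (\<lambda>z. \<phi> n z - u z)) \<longlonglongrightarrow> 0"
    "(\<lambda>n. L2_norm bulk (\<lambda>z. fst (D n z) - fst (G z))) \<longlonglongrightarrow> 0"
    "(\<lambda>n. L2_norm bulk (\<lambda>z. snd (D n z) - snd (G z))) \<longlonglongrightarrow> 0"
    "(\<lambda>n. L2_norm edge (\<lambda>y. \<phi> n (v y, y) - \<tau> y)) \<longlonglongrightarrow> 0"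
proof -
  obtain \<phi> D where C: "\<And>n::nat. C1_gradient (\<phi> n) (D n)" and H: "\<And>n. H1_per \<epsilon> v (\<phi> n) (D n)"
    and l1: "(\<lambda>n. LINT z:Dom_per \<epsilon> v|lebesgue. (\<phi> n z - u z)\<^sup>2 + (norm (D n z - G z))\<^sup>2) \<longlonglongrightarrow> 0"
    and l2: "(\<lambda>n. LINT y:{0<..<\<epsilon>}|lebesgue. (\<phi> n (v y, y) - \<tau> y)\<^sup>2) \<longlonglongrightarrow> 0"
    using tr unfolding is_trace_def by auto
  have Hu: "H1_per \<epsilon> v u G" using tr by (simp add: is_trace_def)
  define T where "T n = (\<integral>z. (\<phi> n z - u z)\<^sup>2 + (norm (D n z - G z))\<^sup>2 \<partial>bulk)" for n
  have T: "T \<longlonglongrightarrow> 0" using l1 unfolding T_def by (simp add: set_integral_lebesgue_on(1))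
  then have sT: "(\<lambda>n. sqrt (T n)) \<longlonglongrightarrow> 0" using tendsto_real_sqrt by force
  note sq = square_integrable_diff[OF H1_square_integrable(1)[OF H] H1_square_integrable(1)[OF Hu]]
     square_integrable_diff[OF H1_square_integrable(2)[OF H] H1_square_integrable(2)[OF Hu]]
     square_integrable_diff[OF H1_square_integrable(3)[OF H] H1_square_integrable(3)[OF Hu]]
  have i: "integrable bulk (\<lambda>z. (\<phi> n z - u z)\<^sup>2 + (norm (D n z - G z))\<^sup>2)" for n
    using sq[of n] by (auto simp: square_integrable_def norm_prod_square)
  have lim: "(\<lambda>n. L2_norm bulk (k n)) \<longlonglongrightarrow> 0"
    if k: "\<And>n. square_integrable bulk (k n)" "\<And>n z. (k n z)\<^sup>2 \<le> (\<phi> n z - u z)\<^sup>2 + (norm (D n z - G z))\<^sup>2" for k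
  proof (rule Lim_null_comparison[OF _ sT])
    have "L2_norm bulk (k n) \<le> sqrt (T n)" for n
      unfolding L2_norm_def T_def
      by (intro real_sqrt_le_mono integral_mono i k) (use k in \<open>auto simp: square_integrable_def\<close>)
    then show "\<forall>\<^sub>F n in sequentially. norm (L2_norm bulk (k n)) \<le> sqrt (T n)" by auto
  qed
  show ?thesis
  proof (rule that[OF C H])
    show "(\<lambda>n. L2_norm bulk (\<lambda>z. \<phi> n z - u z)) \<longlonglongrightarrow> 0" by (rule lim[OF sq(1)]) auto
    show "(\<lambda>n. L2_norm bulk (\<lambda>z. fst (D n z) - fst (G z))) \<longlonglongrightarrow> 0"
      by (rule lim[OF sq(2)]) (auto simp: norm_prod_square)
    show "(\<lambda>n. L2_norm bulk (\<lambda>z. snd (D n z) - snd (G z))) \<longlonglongrightarrow> 0"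
      by (rule lim[OF sq(3)]) (auto simp: norm_prod_square)
    have "(\<lambda>n. sqrt (LINT y:{0<..<\<epsilon>}|lebesgue. (\<phi> n (v y, y) - \<tau> y)\<^sup>2)) \<longlonglongrightarrow> 0"
      using tendsto_real_sqrt[OF l2] by simp
    then show "(\<lambda>n. L2_norm edge (\<lambda>y. \<phi> n (v y, y) - \<tau> y)) \<longlonglongrightarrow> 0"
      by (simp add: L2_norm_def set_integral_lebesgue_on(1))
  qed
qed

lemma trace_square_integrable:
  assumes "is_trace \<epsilon> v u G \<tau>"
  shows "square_integrable edge \<tau>"
  using assms set_integral_lebesgue_on(2)[of "{0<..<\<epsilon>}"]
  by (auto simp: is_trace_def square_integrable_def intro: measurable_restrict_space1)

text \<open>
  Coefficients that depend on \<open>y\<close> only commute with the derivative in \<open>x\<close>. Integrating along horizontal lines first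
  therefore leaves nothing but boundary values.
\<close>

lemma cell_integral_x_derivative:
  fixes \<Psi> \<Psi>' :: "real \<times> real \<Rightarrow> real" and B :: "real \<Rightarrow> real"
  assumes d: "\<And>x y. ((\<lambda>x. \<Psi> (x, y)) has_real_derivative \<Psi>' (x, y)) (at x)"
    and c: "continuous_on UNIV \<Psi>" "continuous_on UNIV \<Psi>'"
    and i: "integrable bulk \<Psi>" "integrable bulk \<Psi>'"
    and B: "B \<in> borel_measurable borel" "\<And>y. \<bar>B y\<bar> \<le> K"
  shows "(\<integral>z. B (snd z) * \<Psi>' z \<partial>bulk) = (\<integral>y. B y * \<Psi> (v y, y) \<partial>edge)"
proof -
  have m: "\<Psi> \<in> borel_measurable borel" "\<Psi>' \<in> borel_measurable borel"
    by (rule borel_measurable_continuous_onI, fact c)+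
  have mB: "(\<lambda>z. B (snd z)) \<in> borel_measurable (borel :: (real \<times> real) measure)"
    by (intro measurable_compose[OF _ B(1)] borel_measurable_continuous_onI continuous_on_snd continuous_on_id)
  have mBP: "(\<lambda>z. B (snd z) * \<Psi>' z) \<in> borel_measurable borel"
    by (rule borel_measurable_times[OF mB m(2)])
  have I: "integrable lborel (\<lambda>z. indicator (Dom_per \<epsilon> v) z *\<^sub>R \<Psi> z)" "integrable lborel (\<lambda>z. indicator (Dom_per \<epsilon> v) z *\<^sub>R \<Psi>' z)"
    using i m bulk_integral_lborel(2) by blast+
  have IB: "integrable lborel (\<lambda>z. indicator (Dom_per \<epsilon> v) z *\<^sub>R (B (snd z) * \<Psi>' z))"
  proof (rule Bochner_Integration.integrable_bound)
    show "integrable lborel (\<lambda>z. K * (indicator (Dom_per \<epsilon> v) z *\<^sub>R \<Psi>' z))" using I(2) by (rule integrable_mult_right)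
    show "(\<lambda>z. indicator (Dom_per \<epsilon> v) z *\<^sub>R (B (snd z) * \<Psi>' z)) \<in> borel_measurable lborel"
      using mBP by (intro borel_measurable_scaleR borel_measurable_indicator) simp_all
    have "\<bar>B y\<bar> \<le> \<bar>K\<bar>" for y using B(2)[of y] by linarith
    then show "AE z in lborel. norm (indicator (Dom_per \<epsilon> v) z *\<^sub>R (B (snd z) * \<Psi>' z)) \<le> norm (K * (indicator (Dom_per \<epsilon> v) z *\<^sub>R \<Psi>' z))"
      by (auto simp: abs_mult indicator_def intro!: mult_right_mono)
  qed
  have "(\<integral>z. B (snd z) * \<Psi>' z \<partial>bulk) = (\<integral>z. indicator (Dom_per \<epsilon> v) z *\<^sub>R (B (snd z) * \<Psi>' z) \<partial>lborel)"
    by (rule bulk_integral_lborel(1)[OF mBP])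
  also have "\<dots> = (\<integral>y. (\<integral>x. indicator (Dom_per \<epsilon> v) (x, y) *\<^sub>R (B (snd (x, y)) * \<Psi>' (x, y)) \<partial>lborel) \<partial>lborel)"
    by (rule plane_Fubini(2)[OF IB])
  also have "\<dots> = (\<integral>y. indicator {0<..<\<epsilon>} y *\<^sub>R (B y * \<Psi> (v y, y)) \<partial>lborel)"
  proof (rule integral_cong_AE)
    show "(\<lambda>y. indicator {0<..<\<epsilon>} y *\<^sub>R (B y * \<Psi> (v y, y))) \<in> borel_measurable lborel"
      using B borel_measurable_continuous_onI[OF continuous_on_boundary_values[OF c(1)]] by simp
    show "(\<lambda>y. \<integral>x. indicator (Dom_per \<epsilon> v) (x, y) *\<^sub>R (B (snd (x, y)) * \<Psi>' (x, y)) \<partial>lborel) \<in> borel_measurable lborel"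
      by (rule borel_measurable_integrable[OF plane_Fubini(4)[OF IB]])
    show "AE y in lborel. (\<integral>x. indicator (Dom_per \<epsilon> v) (x, y) *\<^sub>R (B (snd (x, y)) * \<Psi>' (x, y)) \<partial>lborel)
       = indicator {0<..<\<epsilon>} y *\<^sub>R (B y * \<Psi> (v y, y))"
      using plane_Fubini(1)[OF I(1)] plane_Fubini(1)[OF I(2)]
    proof eventually_elim
      case (elim y)
      show ?case
      proof (cases "y \<in> {0<..<\<epsilon>}")
        case True
        then have s: "set_integrable lborel {..<v y} (\<lambda>x. \<Psi> (x, y))" "set_integrable lborel {..<v y} (\<lambda>x. \<Psi>' (x, y))"
          using elim by (auto simp: indicator_Dom_per set_integrable_def)
        have "(\<integral>x. indicator (Dom_per \<epsilon> v) (x, y) *\<^sub>R (B (snd (x, y)) * \<Psi>' (x, y)) \<partial>lborel)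
            = B y * (LINT x:{..<v y}|lborel. \<Psi>' (x, y))"
          using True by (simp add: indicator_Dom_per set_lebesgue_integral_def mult.left_commute)
        also have "(LINT x:{..<v y}|lborel. \<Psi>' (x, y)) = \<Psi> (v y, y)"
          by (rule integral_derivative_over_left_ray[OF d _ s])
            (auto intro!: continuous_on_compose2[OF c(2)] continuous_intros)
        finally show ?thesis using True by simp
      next
        case False
        then show ?thesis by (simp add: indicator_Dom_per)
      qed
    qed
  qed
  also have "\<dots> = (LINT y:{0<..<\<epsilon>}|lborel. B y * \<Psi> (v y, y))" by (simp add: set_lebesgue_integral_def)
  also have "\<dots> = (LINT y:{0<..<\<epsilon>}|lebesgue. B y * \<Psi> (v y, y))"
    using B borel_measurable_continuous_onI[OF continuous_on_boundary_values[OF c(1)]]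
    by (intro set_integral_completion(1)[symmetric]) auto
  also have "\<dots> = (\<integral>y. B y * \<Psi> (v y, y) \<partial>edge)" by (rule set_integral_lebesgue_on(1)) auto
  finally show ?thesis .
qed

end

section \<open>Exponential test functions and fluxes through the front\<close>

context periodic_cell
begin

text \<open>
  The constants are the closest thing to the natural test function of the heat balance, but they are not square
  integrable on the unbounded cell. The functions \<open>exp (\<delta> x)\<close> are, with squared norm of order \<open>1 / \<delta>\<close>.
\<close>

lemma exp_weight_square_integrable:
  assumes \<delta>: "0 < \<delta>" and V: "\<And>y. v y \<le> V"
  shows "square_integrable bulk (\<lambda>z. exp (\<delta> * fst z))"
    "(L2_norm bulk (\<lambda>z. exp (\<delta> * fst z)))\<^sup>2 \<le> \<epsilon> * (exp (2 * \<delta> * V) / (2 * \<delta>))"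
proof -
  let ?e = "\<lambda>z :: real \<times> real. exp (2 * \<delta> * fst z)"
  have sq: "(exp (\<delta> * fst z))\<^sup>2 = ?e z" for z :: "real \<times> real"
    by (simp add: power2_eq_square mult_exp_exp)
  have ce: "continuous_on UNIV ?e" by (intro continuous_intros)
  have me: "?e \<in> borel_measurable borel" by (rule borel_measurable_continuous_onI[OF ce])
  have me': "(\<lambda>z. indicator (Dom_per \<epsilon> v) z *\<^sub>R ?e z) \<in> borel_measurable lborel"
    using me by (intro borel_measurable_scaleR borel_measurable_indicator) simp_all
  then have me'': "(\<lambda>z. ennreal (indicator (Dom_per \<epsilon> v) z *\<^sub>R ?e z)) \<in> borel_measurable (lborel \<Otimes>\<^sub>M lborel)"
    unfolding lborel_prod by (rule measurable_compose[OF _ measurable_ennreal])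
  let ?K = "exp (2 * \<delta> * V) / (2 * \<delta>)"
  have "(\<integral>\<^sup>+z. ennreal (indicator (Dom_per \<epsilon> v) z *\<^sub>R ?e z) \<partial>lborel)
      = (\<integral>\<^sup>+y. (\<integral>\<^sup>+x. ennreal (indicator (Dom_per \<epsilon> v) (x, y) *\<^sub>R ?e (x, y)) \<partial>lborel) \<partial>lborel)"
    using lborel_pair.nn_integral_snd[OF me''] unfolding lborel_prod by (rule sym)
  also have "\<dots> \<le> (\<integral>\<^sup>+y. ennreal ?K * indicator {0<..<\<epsilon>} y \<partial>lborel)"
  proof (rule nn_integral_mono)
    fix y
    show "(\<integral>\<^sup>+x. ennreal (indicator (Dom_per \<epsilon> v) (x, y) *\<^sub>R ?e (x, y)) \<partial>lborel) \<le> ennreal ?K * indicator {0<..<\<epsilon>} y"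
    proof (cases "y \<in> {0<..<\<epsilon>}")
      case True
      then have "(\<integral>\<^sup>+x. ennreal (indicator (Dom_per \<epsilon> v) (x, y) *\<^sub>R ?e (x, y)) \<partial>lborel)
          = (\<integral>\<^sup>+x. ennreal (exp ((2 * \<delta>) * x)) * indicator {..<v y} x \<partial>lborel)"
        unfolding indicator_Dom_per by (intro nn_integral_cong) (auto simp: indicator_def)
      also have "\<dots> = ennreal (exp ((2 * \<delta>) * v y) / (2 * \<delta>))"
        using \<delta> by (intro nn_integral_exp_left_ray) auto
      also have "\<dots> \<le> ennreal ?K" using \<delta> V[of y] by (intro ennreal_leI divide_right_mono) auto
      finally show ?thesis using True by simp
    qed (simp add: indicator_Dom_per)
  qed
  also have "\<dots> = ennreal ?K * ennreal \<epsilon>"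
    using eps_pos by (subst nn_integral_cmult_indicator) auto
  also have "\<dots> = ennreal (\<epsilon> * ?K)"
    using \<delta> eps_pos by (subst ennreal_mult[symmetric]) (auto simp: mult.commute)
  finally have le: "(\<integral>\<^sup>+z. ennreal (indicator (Dom_per \<epsilon> v) z *\<^sub>R ?e z) \<partial>lborel) \<le> ennreal (\<epsilon> * ?K)" .
  have I: "integrable lborel (\<lambda>z. indicator (Dom_per \<epsilon> v) z *\<^sub>R ?e z)"
    using le_less_trans[OF le ennreal_less_top] me' by (intro integrableI_bounded) auto
  have J: "(\<integral>z. indicator (Dom_per \<epsilon> v) z *\<^sub>R ?e z \<partial>lborel) \<le> \<epsilon> * ?K"
    using le \<delta> eps_pos me' by (subst integral_eq_nn_integral) (auto intro!: enn2real_leI)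
  have "integrable bulk ?e"
    using I bulk_integral_lborel(2)[OF me] by blast
  then show "square_integrable bulk (\<lambda>z. exp (\<delta> * fst z))"
    unfolding square_integrable_def sq
    by (intro conjI borel_measurable_bulk borel_measurable_continuous_onI continuous_intros)
  have "(\<integral>z. ?e z \<partial>bulk) = (\<integral>z. indicator (Dom_per \<epsilon> v) z *\<^sub>R ?e z \<partial>lborel)"
    by (rule bulk_integral_lborel(1)[OF me])
  then show "(L2_norm bulk (\<lambda>z. exp (\<delta> * fst z)))\<^sup>2 \<le> \<epsilon> * ?K"
    using J by (simp add: L2_norm_square sq)
qed

lemma C1_gradient_exp:
  "C1_gradient (\<lambda>z :: real \<times> real. exp (\<delta> * fst z)) (\<lambda>z. (\<delta> * exp (\<delta> * fst z), 0))"
  unfolding C1_gradient_def gderiv_def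
  by (auto intro!: derivative_eq_intros continuous_intros simp: inner_prod_def algebra_simps)

lemma is_trace_exp:
  assumes \<delta>: "0 < \<delta>" and V: "\<And>y. v y \<le> V"
  shows "is_trace \<epsilon> v (\<lambda>z. exp (\<delta> * fst z)) (\<lambda>z. (\<delta> * exp (\<delta> * fst z), 0)) (\<lambda>y. exp (\<delta> * v y))"
proof -
  let ?w = "\<lambda>z :: real \<times> real. exp (\<delta> * fst z)" and ?H = "\<lambda>z :: real \<times> real. (\<delta> * exp (\<delta> * fst z), 0 :: real)"
  have "integrable bulk (\<lambda>z. (1 + \<delta>\<^sup>2) * (?w z)\<^sup>2)"
    using exp_weight_square_integrable(1)[OF assms] by (simp add: square_integrable_def)
  also have "(\<lambda>z. (1 + \<delta>\<^sup>2) * (?w z)\<^sup>2) = (\<lambda>z. (?w z)\<^sup>2 + (norm (?H z))\<^sup>2)"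
    by (auto simp: norm_prod_square algebra_simps power_mult_distrib)
  finally have H1: "H1_per \<epsilon> v ?w ?H"
    using C1_gradient_imp_weak_gradient[OF C1_gradient_exp]
    by (auto simp: H1_per_def set_integral_lebesgue_on(2) intro!: loc_integrable_on_continuous continuous_intros)
  have c: "continuous_on UNIV (\<lambda>y. exp (\<delta> * v y))" by (intro continuous_intros v_cont)
  show ?thesis
    unfolding is_trace_def
  proof (intro conjI)
    show "set_integrable lebesgue {0<..<\<epsilon>} (\<lambda>y. (exp (\<delta> * v y))\<^sup>2)"
      using continuous_edge_square_integrable[OF c] by (simp add: square_integrable_def set_integral_lebesgue_on(2))
    show "(\<lambda>y. exp (\<delta> * v y)) \<in> borel_measurable lebesgue"
      by (intro borel_measurable_lebesgueI borel_measurable_continuous_onI c)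
    show "\<exists>\<phi> D. (\<forall>n::nat. C1_gradient (\<phi> n) (D n) \<and> H1_per \<epsilon> v (\<phi> n) (D n)) \<and>
        (\<lambda>n. LINT z:Dom_per \<epsilon> v|lebesgue. (\<phi> n z - ?w z)\<^sup>2 + (norm (D n z - ?H z))\<^sup>2) \<longlonglongrightarrow> 0 \<and>
        (\<lambda>n. LINT y:{0<..<\<epsilon>}|lebesgue. (\<phi> n (v y, y) - exp (\<delta> * v y))\<^sup>2) \<longlonglongrightarrow> 0"
      by (rule exI[of _ "\<lambda>_. ?w"], rule exI[of _ "\<lambda>_. ?H"])
        (use H1 C1_gradient_exp in \<open>auto simp: set_lebesgue_integral_def\<close>)
  qed (use H1 v_per in auto)
qed

text \<open>
  For a continuously differentiable \<open>\<phi>\<close> this is the integral of the derivative in \<open>x\<close> of \<open>\<phi> exp (\<delta> x)\<close>; both sides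
  are continuous under the convergence that defines traces.
\<close>

lemma trace_flux:
  assumes tr: "is_trace \<epsilon> v u G \<tau>" and B: "B \<in> borel_measurable borel" "\<And>y. \<bar>B y\<bar> \<le> K"
    and \<delta>: "0 < \<delta>" and V: "\<And>y. v y \<le> V"
  shows "(\<integral>z. B (snd z) * fst (G z) * exp (\<delta> * fst z) \<partial>bulk) + \<delta> * (\<integral>z. B (snd z) * u z * exp (\<delta> * fst z) \<partial>bulk)
    = (\<integral>y. B y * \<tau> y * exp (\<delta> * v y) \<partial>edge)"
proof -
  obtain \<phi> D where C: "\<And>n::nat. C1_gradient (\<phi> n) (D n)" and H: "\<And>n. H1_per \<epsilon> v (\<phi> n) (D n)"
    and l: "(\<lambda>n. L2_norm bulk (\<lambda>z. \<phi> n z - u z)) \<longlonglongrightarrow> 0"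
    "(\<lambda>n. L2_norm bulk (\<lambda>z. fst (D n z) - fst (G z))) \<longlonglongrightarrow> 0"
    "(\<lambda>n. L2_norm bulk (\<lambda>z. snd (D n z) - snd (G z))) \<longlonglongrightarrow> 0"
    "(\<lambda>n. L2_norm edge (\<lambda>y. \<phi> n (v y, y) - \<tau> y)) \<longlonglongrightarrow> 0"
  proof (rule trace_approximation[OF tr], goal_cases)
    case (1 \<phi> D)
    from 1(2-7) show ?case by (rule 1(1))
  qed
  have Hu: "H1_per \<epsilon> v u G" using tr by (simp add: is_trace_def)
  let ?e = "\<lambda>z :: real \<times> real. exp (\<delta> * fst z)"
  have e: "square_integrable bulk ?e" by (rule exp_weight_square_integrable(1)[OF \<delta> V])
  have ce: "continuous_on UNIV ?e" by (intro continuous_intros)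
  have mB: "(\<lambda>z. B (snd z)) \<in> borel_measurable bulk"
    by (rule coefficient_measurable[OF B(1)])
  have B2: "AE z in bulk. \<bar>B (snd z)\<bar> \<le> K" "AE y in edge. \<bar>B y\<bar> \<le> K" using B(2) by auto
  note H1n = H1_square_integrable[OF H] and H1u = H1_square_integrable[OF Hu]
  have ev: "square_integrable edge (\<lambda>y. exp (\<delta> * v y))"
    by (intro continuous_edge_square_integrable continuous_intros v_cont)
  have tn: "square_integrable edge (\<lambda>y. \<phi> n (v y, y))" for n
    by (intro continuous_edge_square_integrable continuous_on_boundary_values C1_gradient_continuous(1)[OF C])
  have z0: "(\<lambda>n. L2_norm M0 (\<lambda>z. k z - k z)) \<longlonglongrightarrow> 0" for M0 :: "'z measure" and k
    by (simp add: L2_norm_def)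
  have eqn: "(\<integral>z. B (snd z) * fst (D n z) * ?e z \<partial>bulk) + \<delta> * (\<integral>z. B (snd z) * \<phi> n z * ?e z \<partial>bulk)
      = (\<integral>y. B y * \<phi> n (v y, y) * exp (\<delta> * v y) \<partial>edge)" for n
  proof -
    have i1: "integrable bulk (\<lambda>z. fst (D n z) * ?e z)" "integrable bulk (\<lambda>z. \<phi> n z * ?e z)"
      by (rule square_integrable_mult[OF _ e], rule H1n)+
    have "(\<integral>z. B (snd z) * (fst (D n z) * ?e z + \<delta> * (\<phi> n z * ?e z)) \<partial>bulk) = (\<integral>y. B y * (\<phi> n (v y, y) * ?e (v y, y)) \<partial>edge)"
    proof (rule cell_integral_x_derivative[OF _ _ _ _ _ B])
      show "((\<lambda>x. \<phi> n (x, y) * ?e (x, y)) has_real_derivative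
         fst (D n (x, y)) * ?e (x, y) + \<delta> * (\<phi> n (x, y) * ?e (x, y))) (at x)" for x y
        by (rule DERIV_cong, rule DERIV_mult[OF C1_gradient_partial(1)[OF C]])
          (auto intro!: derivative_eq_intros)
      show "continuous_on UNIV (\<lambda>z. \<phi> n z * ?e z)" "continuous_on UNIV (\<lambda>z. fst (D n z) * ?e z + \<delta> * (\<phi> n z * ?e z))"
        by (intro continuous_intros C1_gradient_continuous[OF C])+
    qed (use i1 in auto)
    moreover have "(\<integral>z. B (snd z) * (fst (D n z) * ?e z + \<delta> * (\<phi> n z * ?e z)) \<partial>bulk)
        = (\<integral>z. B (snd z) * fst (D n z) * ?e z + \<delta> * (B (snd z) * \<phi> n z * ?e z) \<partial>bulk)"
      by (simp add: algebra_simps)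
    moreover have "\<dots> = (\<integral>z. B (snd z) * fst (D n z) * ?e z \<partial>bulk) + (\<integral>z. \<delta> * (B (snd z) * \<phi> n z * ?e z) \<partial>bulk)"
      by (intro Bochner_Integration.integral_add integrable_mult_right weighted_Cauchy_Schwarz(1)[OF _ e mB B2(1)] H1n)
    ultimately show ?thesis by (simp add: mult.assoc)
  qed
  have "(\<lambda>n. (\<integral>z. B (snd z) * fst (D n z) * ?e z \<partial>bulk) + \<delta> * (\<integral>z. B (snd z) * \<phi> n z * ?e z \<partial>bulk)) \<longlonglongrightarrow>
    (\<integral>z. B (snd z) * fst (G z) * ?e z \<partial>bulk) + \<delta> * (\<integral>z. B (snd z) * u z * ?e z \<partial>bulk)"
    by (intro tendsto_add tendsto_mult tendsto_const L2_convergence_weighted_product[OF _ e _ e _ z0 mB B2(1)] H1n H1u l)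
  moreover have "(\<lambda>n. \<integral>y. B y * \<phi> n (v y, y) * exp (\<delta> * v y) \<partial>edge) \<longlonglongrightarrow> (\<integral>y. B y * \<tau> y * exp (\<delta> * v y) \<partial>edge)"
    by (intro L2_convergence_weighted_product[OF _ ev _ ev _ z0 borel_measurable_edge[OF B(1)] B2(2)]
        trace_square_integrable[OF tr] tn l)
  ultimately show ?thesis unfolding eqn using LIMSEQ_unique by blast
qed

text \<open>
  For smooth functions the integrand is half the derivative in \<open>x\<close> of \<open>B \<phi>\<^sup>2\<close>, whose integral is a boundary term with a
  sign.
\<close>

lemma advection_energy_nonneg:
  assumes tr: "is_trace \<epsilon> v u G \<tau>" and B: "B \<in> borel_measurable borel" "\<And>y. 0 \<le> B y" "\<And>y. B y \<le> K"
  shows "0 \<le> (\<integral>z. B (snd z) * fst (G z) * u z \<partial>bulk)"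
proof -
  obtain \<phi> D where C: "\<And>n::nat. C1_gradient (\<phi> n) (D n)" and H: "\<And>n. H1_per \<epsilon> v (\<phi> n) (D n)"
    and l: "(\<lambda>n. L2_norm bulk (\<lambda>z. \<phi> n z - u z)) \<longlonglongrightarrow> 0"
    "(\<lambda>n. L2_norm bulk (\<lambda>z. fst (D n z) - fst (G z))) \<longlonglongrightarrow> 0"
    "(\<lambda>n. L2_norm bulk (\<lambda>z. snd (D n z) - snd (G z))) \<longlonglongrightarrow> 0"
    "(\<lambda>n. L2_norm edge (\<lambda>y. \<phi> n (v y, y) - \<tau> y)) \<longlonglongrightarrow> 0"
  proof (rule trace_approximation[OF tr], goal_cases)
    case (1 \<phi> D)
    from 1(2-7) show ?case by (rule 1(1))
  qed
  have Hu: "H1_per \<epsilon> v u G" using tr by (simp add: is_trace_def)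
  have mB: "(\<lambda>z. B (snd z)) \<in> borel_measurable bulk"
    by (rule coefficient_measurable[OF B(1)])
  have B1: "\<bar>B y\<bar> \<le> K" for y using B(2,3)[of y] by simp
  then have B2: "AE z in bulk. \<bar>B (snd z)\<bar> \<le> K" by auto
  note H1n = H1_square_integrable[OF H] and H1u = H1_square_integrable[OF Hu]
  have nn: "0 \<le> (\<integral>z. B (snd z) * fst (D n z) * \<phi> n z \<partial>bulk)" for n
  proof -
    have i1: "integrable bulk (\<lambda>z. fst (D n z) * \<phi> n z)" "integrable bulk (\<lambda>z. (\<phi> n z)\<^sup>2 / 2)"
      using square_integrable_mult[OF H1n(2) H1n(1)] H1n(1)[of n] by (auto simp: square_integrable_def)
    have "(\<integral>z. B (snd z) * (fst (D n z) * \<phi> n z) \<partial>bulk) = (\<integral>y. B y * ((\<phi> n (v y, y))\<^sup>2 / 2) \<partial>edge)"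
    proof (rule cell_integral_x_derivative[OF _ _ _ _ _ B(1) B1])
      show "((\<lambda>x. (\<phi> n (x, y))\<^sup>2 / 2) has_real_derivative fst (D n (x, y)) * \<phi> n (x, y)) (at x)" for x y
        by (rule DERIV_cong, rule DERIV_cdivide, rule DERIV_power[OF C1_gradient_partial(1)[OF C]]) auto
      show "continuous_on UNIV (\<lambda>z. (\<phi> n z)\<^sup>2 / 2)" "continuous_on UNIV (\<lambda>z. fst (D n z) * \<phi> n z)"
        by (intro continuous_intros C1_gradient_continuous[OF C], simp?)+
    qed (use i1 in auto)
    moreover have "0 \<le> (\<integral>y. B y * ((\<phi> n (v y, y))\<^sup>2 / 2) \<partial>edge)"
      using B(2) by (intro Bochner_Integration.integral_nonneg) auto
    ultimately show ?thesis by (simp add: mult.assoc)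
  qed
  have "(\<lambda>n. \<integral>z. B (snd z) * fst (D n z) * \<phi> n z \<partial>bulk) \<longlonglongrightarrow> (\<integral>z. B (snd z) * fst (G z) * u z \<partial>bulk)"
    by (intro L2_convergence_weighted_product[OF _ _ _ _ _ _ mB B2] H1n H1u l)
  then show ?thesis by (rule LIMSEQ_le_const) (use nn in auto)
qed

end

section \<open>Oscillation of traces\<close>

text \<open>
  A function that is everywhere greater than its average would have a positive integral after subtracting it.
\<close>

lemma exists_le_average:
  fixes f :: "real \<Rightarrow> real"
  assumes ab: "a < b" and f: "set_integrable lborel {a..b} f"
  shows "\<exists>t\<in>{a..b}. (b - a) * f t \<le> (LINT t:{a..b}|lborel. f t)"
proof (rule ccontr)
  assume "\<not> ?thesis"
  then have gt: "(LINT t:{a..b}|lborel. f t) < (b - a) * f t" if "t \<in> {a..b}" for t using that by force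
  define c where "c = (LINT t:{a..b}|lborel. f t) / (b - a)"
  have gt': "c < f t" if "t \<in> {a..b}" for t
    using gt[OF that] ab by (simp add: c_def field_simps)
  have ic: "set_integrable lborel {a..b} (\<lambda>_. c)" by (rule borel_integrable_atLeastAtMost') auto
  have i: "set_integrable lborel {a..b} (\<lambda>t. f t - c)" by (rule set_integral_diff(1)[OF f ic])
  have "(LINT t:{a..b}|lborel. f t - c) = (LINT t:{a..b}|lborel. f t) - (LINT t:{a..b}|lborel. c)"
    by (rule set_integral_diff(2)[OF f ic])
  also have "(LINT t:{a..b}|lborel. c) = (LINT t:{a..b}|lborel. f t)"
    using ab by (simp add: set_lebesgue_integral_def c_def)
  finally have "(\<integral>t. indicator {a..b} t *\<^sub>R (f t - c) \<partial>lborel) = 0" by (simp add: set_lebesgue_integral_def)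
  moreover have "AE t in lborel. 0 \<le> indicator {a..b} t *\<^sub>R (f t - c)"
    by (rule AE_I2) (use gt' in \<open>force simp: indicator_def\<close>)
  ultimately have "AE t in lborel. indicator {a..b} t *\<^sub>R (f t - c) = 0"
    using i integral_nonneg_eq_0_iff_AE unfolding set_integrable_def by blast
  then have "AE t in lborel. t \<notin> {a..b}"
    by eventually_elim (use gt' in \<open>force simp: indicator_def\<close>)
  then have "{a..b} \<in> null_sets lborel" by (subst AE_iff_null_sets) auto
  then show False using ab by (auto simp: null_sets_def)
qed

lemma square_integral_le:
  fixes m :: "real \<Rightarrow> real"
  assumes ab: "a < b" and m: "continuous_on {a..b} m"
  shows "(LINT t:{a..b}|lborel. m t)\<^sup>2 \<le> (b - a) * (LINT t:{a..b}|lborel. (m t)\<^sup>2)"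
proof -
  define I where "I = (LINT t:{a..b}|lborel. m t)"
  define c where "c = I / (b - a)"
  have i: "set_integrable lborel {a..b} k" if "continuous_on {a..b} k" for k :: "real \<Rightarrow> real"
    using that by (rule borel_integrable_atLeastAtMost')
  have i2: "set_integrable lborel {a..b} (\<lambda>t. (m t)\<^sup>2)" "set_integrable lborel {a..b} (\<lambda>t. 2 * c * m t)"
    "set_integrable lborel {a..b} (\<lambda>t. c\<^sup>2)" "set_integrable lborel {a..b} (\<lambda>t. (m t)\<^sup>2 - 2 * c * m t)"
    by (intro i continuous_intros m)+
  have "0 \<le> (LINT t:{a..b}|lborel. (m t - c)\<^sup>2)"
    unfolding set_lebesgue_integral_def by (intro Bochner_Integration.integral_nonneg) auto
  also have "(\<lambda>t. (m t - c)\<^sup>2) = (\<lambda>t. ((m t)\<^sup>2 - 2 * c * m t) + c\<^sup>2)"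
    by (auto simp: power2_eq_square algebra_simps)
  also have "(LINT t:{a..b}|lborel. ((m t)\<^sup>2 - 2 * c * m t) + c\<^sup>2)
      = (LINT t:{a..b}|lborel. (m t)\<^sup>2) - (LINT t:{a..b}|lborel. 2 * c * m t) + (LINT t:{a..b}|lborel. c\<^sup>2)"
    using set_integral_add(2)[OF i2(4,3)] set_integral_diff(2)[OF i2(1,2)] by simp
  also have "(LINT t:{a..b}|lborel. 2 * c * m t) = 2 * c * I" by (simp add: I_def mult.assoc)
  also have "(LINT t:{a..b}|lborel. c\<^sup>2) = c\<^sup>2 * (b - a)" using ab by (simp add: set_lebesgue_integral_def)
  finally have "0 \<le> (LINT t:{a..b}|lborel. (m t)\<^sup>2) - 2 * c * I + c\<^sup>2 * (b - a)" .
  then have "0 \<le> (b - a) * ((LINT t:{a..b}|lborel. (m t)\<^sup>2) - 2 * c * I + c\<^sup>2 * (b - a))"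
    using ab by (intro mult_nonneg_nonneg) auto
  also have "\<dots> = (b - a) * (LINT t:{a..b}|lborel. (m t)\<^sup>2) - I\<^sup>2"
  proof -
    have I: "I = c * (b - a)" using ab by (simp add: c_def)
    show ?thesis unfolding I by (simp add: power2_eq_square algebra_simps)
  qed
  finally show ?thesis by (simp add: I_def)
qed

lemma increment_le_integral:
  fixes k k' m :: "real \<Rightarrow> real"
  assumes d: "\<And>t. (k has_real_derivative k' t) (at t)" and ck: "continuous_on UNIV k'"
    and m: "continuous_on {a..b} m" "\<And>t. t \<in> {a..b} \<Longrightarrow> \<bar>k' t\<bar> \<le> m t"
    and x: "x \<in> {a..b}" "y \<in> {a..b}"
  shows "\<bar>k y - k x\<bar> \<le> (LINT t:{a..b}|lborel. m t)"
proof -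
  have *: "\<bar>k y - k x\<bar> \<le> (LINT t:{a..b}|lborel. m t)" if "x \<in> {a..b}" "y \<in> {a..b}" "x \<le> y" for x y
  proof -
    have "(\<integral>t. k' t * indicator {x..y} t \<partial>lborel) = k y - k x"
      by (rule integral_FTC_Icc_real[OF that(3)]) (use d ck in \<open>auto simp: continuous_on_eq_continuous_at\<close>)
    then have "\<bar>k y - k x\<bar> = \<bar>\<integral>t. k' t * indicator {x..y} t \<partial>lborel\<bar>" by simp
    also have "\<dots> \<le> (\<integral>t. \<bar>k' t * indicator {x..y} t\<bar> \<partial>lborel)" by (rule integral_abs_bound)
    also have "\<dots> \<le> (LINT t:{a..b}|lborel. m t)"
      unfolding set_lebesgue_integral_def
    proof (rule integral_mono)
      have "set_integrable lborel {x..y} k'"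
        by (rule borel_integrable_atLeastAtMost') (use ck continuous_on_subset in blast)
      then show "integrable lborel (\<lambda>t. \<bar>k' t * indicator {x..y} t\<bar>)"
        by (auto simp: set_integrable_def mult.commute)
      show "integrable lborel (\<lambda>t. indicat_real {a..b} t *\<^sub>R m t)"
        using borel_integrable_atLeastAtMost'[OF m(1)] by (simp add: set_integrable_def)
      show "\<bar>k' t * indicator {x..y} t\<bar> \<le> indicat_real {a..b} t *\<^sub>R m t" for t
      proof (cases "t \<in> {a..b}")
        case True
        then have "0 \<le> m t" using m(2)[OF True] by linarith
        then show ?thesis using m(2)[OF True] True by (auto simp: indicator_def)
      next
        case False
        then show ?thesis using that by (auto simp: indicator_def)
      qed
    qed
    finally show ?thesis .
  qed
  show ?thesis
  proof (cases "x \<le> y")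
    case False
    then show ?thesis using *[of y x] x by (auto simp: abs_minus_commute)
  qed (use * x in auto)
qed

context periodic_cell
begin

text \<open>
  Two boundary points are joined by a path that leaves the first one in the direction of \<open>x\<close> until the translate of the
  front by \<open>s0\<close>, follows this translate, and returns to the boundary at the second one. By averaging, \<open>s0\<close> and the
  second end point \<open>y0\<close> can be chosen such that the energies on the middle and the last piece are at most their means.
  The squared increment on each piece is at most a multiple of \<open>\<epsilon>\<close> times its energy, so the squared differences
  integrate to a multiple of \<open>\<epsilon>\<close> times the energy of the strip.
\<close>

lemma C1_trace_oscillation:
  assumes C: "C1_gradient \<phi> D" and H: "H1_per \<epsilon> v \<phi> D"
    and v': "\<And>y. (v has_real_derivative p y) (at y)" and p: "continuous_on UNIV p" "\<And>y. \<bar>p y\<bar> \<le> 1"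
  shows "\<exists>A. (\<integral>y. (\<phi> (v y, y) - A)\<^sup>2 \<partial>edge) \<le> 18 * \<epsilon> * (\<integral>z. (norm (D z))\<^sup>2 \<partial>bulk)"
proof -
  have cD: "continuous_on UNIV D" and c\<phi>: "continuous_on UNIV \<phi>" using C1_gradient_continuous[OF C] by auto
  have d\<phi>: "(\<phi> has_derivative (\<lambda>h. h \<bullet> D z)) (at z)" for z
    using C unfolding C1_gradient_def gderiv_def by blast
  have cflat: "continuous_on S (\<lambda>z. D (v (snd z) + fst z, snd z))" for S
    by (rule continuous_on_compose2[OF cD]) (auto intro!: continuous_intros continuous_on_v_snd)
  \<comment> \<open>In the coordinates \<open>(s, y)\<close> with \<open>x = v y + s\<close> the strip behind the front is a square.\<close>
  define m where "m s y = norm (D (v y + s, y))" for s y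
  have cm: "continuous_on S (\<lambda>z. m (fst z) (snd z))" for S
    unfolding m_def by (intro continuous_intros cflat)
  have cm1: "continuous_on S (\<lambda>s. m s y)" and cm2: "continuous_on S (m s)" for S s y
    using continuous_on_compose2[OF cm[of UNIV], of S "\<lambda>s. (s, y)"] continuous_on_compose2[OF cm[of UNIV], of S "\<lambda>y. (s, y)"]
    by (simp_all add: continuous_on_Pair continuous_on_id continuous_on_const)
  define Q where "Q = {- \<epsilon>..0} \<times> {0..\<epsilon>}"
  have indQ: "indicat_real Q (s, y) = indicator {- \<epsilon>..0} s * indicator {0..\<epsilon>} y" for s y
    by (auto simp: Q_def indicator_def)
  have iQ: "integrable lborel (\<lambda>z. indicator Q z *\<^sub>R (m (fst z) (snd z))\<^sup>2)"
    by (rule borel_integrable_compact) (auto simp: Q_def intro!: compact_Times continuous_intros cm)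
  define E where "E y = (LINT s:{- \<epsilon>..0}|lborel. (m s y)\<^sup>2)" for y
  define F where "F s = (LINT y:{0..\<epsilon>}|lborel. (m s y)\<^sup>2)" for s
  define T where "T = (\<integral>z. indicator Q z *\<^sub>R (m (fst z) (snd z))\<^sup>2 \<partial>lborel)"
  have inner: "(\<integral>s. indicator Q (s, y) *\<^sub>R (m (fst (s, y)) (snd (s, y)))\<^sup>2 \<partial>lborel) = indicator {0..\<epsilon>} y *\<^sub>R E y" for y
    by (simp add: indQ E_def set_lebesgue_integral_def mult.assoc mult.left_commute[of _ "indicator {0..\<epsilon>} y"])
  have inner': "(\<integral>y. indicator Q (s, y) *\<^sub>R (m (fst (s, y)) (snd (s, y)))\<^sup>2 \<partial>lborel) = indicator {- \<epsilon>..0} s *\<^sub>R F s" for s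
    by (simp add: indQ F_def set_lebesgue_integral_def mult.assoc)
  have iE: "set_integrable lborel {0..\<epsilon>} E"
    using plane_Fubini(4)[OF iQ] unfolding inner by (simp add: set_integrable_def)
  have iF: "set_integrable lborel {- \<epsilon>..0} F"
    using plane_Fubini(5)[OF iQ] unfolding inner' by (simp add: set_integrable_def)
  have TE: "T = (LINT y:{0..\<epsilon>}|lborel. E y)"
    using plane_Fubini(2)[OF iQ] unfolding inner T_def by (simp add: set_lebesgue_integral_def)
  have TF: "T = (LINT s:{- \<epsilon>..0}|lborel. F s)"
    using plane_Fubini(3)[OF iQ] unfolding inner' T_def by (simp add: set_lebesgue_integral_def)
  obtain s0 where s0: "s0 \<in> {- \<epsilon>..0}" "\<epsilon> * F s0 \<le> T"
    using exists_le_average[OF _ iF] eps_pos TF by auto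
  obtain y0 where y0: "y0 \<in> {0..\<epsilon>}" "\<epsilon> * E y0 \<le> T"
    using exists_le_average[OF _ iE] eps_pos TE by auto
  define A where "A = \<phi> (v y0, y0)"
  have vert: "\<bar>\<phi> (v y, y) - \<phi> (v y + s0, y)\<bar>\<^sup>2 \<le> \<epsilon> * E y" for y
  proof -
    have "\<bar>\<phi> (v y + 0, y) - \<phi> (v y + s0, y)\<bar> \<le> (LINT s:{- \<epsilon>..0}|lborel. m s y)"
    proof (rule increment_le_integral[where k = "\<lambda>s. \<phi> (v y + s, y)"])
      show "((\<lambda>s. \<phi> (v y + s, y)) has_real_derivative fst (D (v y + s, y))) (at s)" for s
      proof -
        have "((\<lambda>s. v y + s) has_real_derivative 1) (at s)" by (auto intro!: derivative_eq_intros)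
        from DERIV_chain2[where f = "\<lambda>x. \<phi> (x, y)", OF C1_gradient_partial(1)[OF C] this]
        show ?thesis by simp
      qed
      show "continuous_on UNIV (\<lambda>s. fst (D (v y + s, y)))"
        by (intro continuous_on_fst continuous_on_compose2[OF cD]) (auto intro!: continuous_intros)
      show "\<bar>fst (D (v y + s, y))\<bar> \<le> m s y" for s
        using norm_fst_le[of "fst (D (v y + s, y))" "snd (D (v y + s, y))"] by (simp add: m_def)
    qed (use s0 eps_pos in \<open>auto intro: cm1\<close>)
    then have "\<bar>\<phi> (v y, y) - \<phi> (v y + s0, y)\<bar>\<^sup>2 \<le> (LINT s:{- \<epsilon>..0}|lborel. m s y)\<^sup>2"
      by (intro power_mono) auto
    also have "\<dots> \<le> (0 - (- \<epsilon>)) * E y"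
      unfolding E_def using eps_pos by (intro square_integral_le cm1) auto
    finally show ?thesis by simp
  qed
  have horiz: "\<bar>\<phi> (v y + s0, y) - \<phi> (v y0 + s0, y0)\<bar>\<^sup>2 \<le> 4 * (\<epsilon> * F s0)" if y: "y \<in> {0..\<epsilon>}" for y
  proof -
    have "\<bar>\<phi> (v y + s0, y) - \<phi> (v y0 + s0, y0)\<bar> \<le> (LINT t:{0..\<epsilon>}|lborel. 2 * m s0 t)"
    proof (rule increment_le_integral[where k = "\<lambda>t. \<phi> (v t + s0, t)"])
      let ?k' = "\<lambda>t. p t * fst (D (v t + s0, t)) + snd (D (v t + s0, t))"
      have dv: "(v has_derivative (\<lambda>h. h * p t)) (at t)" for t
        using v'[of t] by (simp add: has_field_derivative_def mult_commute_abs)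
      have pair: "((\<lambda>t. (v t + s0, t)) has_derivative (\<lambda>h. (h * p t, h))) (at t)" for t
        by (rule has_derivative_eq_rhs, rule has_derivative_Pair, rule has_derivative_add[OF dv has_derivative_const],
            rule has_derivative_ident) auto
      show "((\<lambda>t. \<phi> (v t + s0, t)) has_real_derivative ?k' t) (at t)" for t
        unfolding has_field_derivative_def
        by (rule has_derivative_eq_rhs, rule has_derivative_compose[OF pair d\<phi>])
          (auto simp: inner_prod_def algebra_simps)
      have cDt: "continuous_on UNIV (\<lambda>t. D (v t + s0, t))"
        by (rule continuous_on_compose2[OF cD]) (auto intro!: continuous_intros v_cont)
      show "continuous_on UNIV ?k'" by (intro continuous_intros p cDt)
      show "\<bar>?k' t\<bar> \<le> 2 * m s0 t" for t
      proof -
        have 1: "\<bar>fst (D (v t + s0, t))\<bar> \<le> m s0 t" "\<bar>snd (D (v t + s0, t))\<bar> \<le> m s0 t"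
          using norm_fst_le[of "fst (D (v t + s0, t))" "snd (D (v t + s0, t))"]
            norm_snd_le[of "snd (D (v t + s0, t))" "fst (D (v t + s0, t))"] by (simp_all add: m_def)
        have "\<bar>p t * fst (D (v t + s0, t))\<bar> \<le> 1 * m s0 t"
          unfolding abs_mult by (intro mult_mono p 1) auto
        then show ?thesis using 1 by linarith
      qed
      show "continuous_on {0..\<epsilon>} (\<lambda>t. 2 * m s0 t)" by (intro continuous_intros cm2)
    qed (use y y0 in auto)
    then have "\<bar>\<phi> (v y + s0, y) - \<phi> (v y0 + s0, y0)\<bar>\<^sup>2 \<le> (LINT t:{0..\<epsilon>}|lborel. 2 * m s0 t)\<^sup>2"
      by (intro power_mono) auto
    also have "\<dots> \<le> (\<epsilon> - 0) * (LINT t:{0..\<epsilon>}|lborel. (2 * m s0 t)\<^sup>2)"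
      using eps_pos by (intro square_integral_le continuous_intros cm2) auto
    also have "(LINT t:{0..\<epsilon>}|lborel. (2 * m s0 t)\<^sup>2) = 4 * F s0"
      by (simp add: F_def power_mult_distrib)
    finally show ?thesis by simp
  qed
  \<comment> \<open>The three pieces of the path contribute at most \<open>\<epsilon> E y\<close>, \<open>4 T\<close> and \<open>T\<close>; the factor 4 stems from
    the slope, which at most doubles the derivative along the translated front.\<close>
  have pt: "(\<phi> (v y, y) - A)\<^sup>2 \<le> 3 * \<epsilon> * E y + 15 * T" if y: "y \<in> {0..\<epsilon>}" for y
  proof -
    define \<alpha> \<beta> \<gamma> where "\<alpha> = \<phi> (v y, y) - \<phi> (v y + s0, y)" and "\<beta> = \<phi> (v y + s0, y) - \<phi> (v y0 + s0, y0)"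
      and "\<gamma> = \<phi> (v y0 + s0, y0) - \<phi> (v y0, y0)"
    have "(\<alpha> + \<beta> + \<gamma>)\<^sup>2 \<le> 3 * (\<alpha>\<^sup>2 + \<beta>\<^sup>2 + \<gamma>\<^sup>2)"
    proof -
      have "0 \<le> (\<alpha> - \<beta>)\<^sup>2 + (\<beta> - \<gamma>)\<^sup>2 + (\<alpha> - \<gamma>)\<^sup>2" by simp
      then show ?thesis by (simp add: power2_eq_square algebra_simps)
    qed
    moreover have "\<alpha>\<^sup>2 \<le> \<epsilon> * E y" "\<beta>\<^sup>2 \<le> 4 * T" "\<gamma>\<^sup>2 \<le> T"
      using vert[of y] vert[of y0] horiz[OF y] s0 y0 by (auto simp: \<alpha>_def \<beta>_def \<gamma>_def power2_commute)
    moreover have "\<phi> (v y, y) - A = \<alpha> + \<beta> + \<gamma>" by (simp add: \<alpha>_def \<beta>_def \<gamma>_def A_def)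
    ultimately show ?thesis by (simp add: algebra_simps)
  qed
  have TJ: "T \<le> (\<integral>z. (norm (D z))\<^sup>2 \<partial>bulk)"
  proof -
    have mD: "(\<lambda>z. (norm (D z))\<^sup>2) \<in> borel_measurable borel"
      by (intro borel_measurable_continuous_onI continuous_intros cD)
    have "integrable bulk (\<lambda>z. (norm (D z))\<^sup>2)"
      using H1_square_integrable[OF H] by (auto simp: square_integrable_def norm_prod_square)
    then have I: "integrable lborel (\<lambda>z. indicator (Dom_per \<epsilon> v) z *\<^sub>R (norm (D z))\<^sup>2)"
      using bulk_integral_lborel(2)[OF mD] by blast
    have "T = (\<integral>y. indicator {0..\<epsilon>} y *\<^sub>R E y \<partial>lborel)" using TE by (simp add: set_lebesgue_integral_def)
    also have "\<dots> \<le> (\<integral>y. (\<integral>x. indicator (Dom_per \<epsilon> v) (x, y) *\<^sub>R (norm (D (x, y)))\<^sup>2 \<partial>lborel) \<partial>lborel)"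
    proof (rule integral_mono_AE)
      show "AE y in lborel. indicator {0..\<epsilon>} y *\<^sub>R E y \<le> (\<integral>x. indicator (Dom_per \<epsilon> v) (x, y) *\<^sub>R (norm (D (x, y)))\<^sup>2 \<partial>lborel)"
        using plane_Fubini(1)[OF I] AE_lborel_singleton[of 0] AE_lborel_singleton[of \<epsilon>]
      proof eventually_elim
        case (elim y)
        show ?case
        proof (cases "y \<in> {0<..<\<epsilon>}")
          case True
          then have E1: "indicator {0..\<epsilon>} y *\<^sub>R E y = E y" by auto
          have s: "integrable lborel (\<lambda>x. indicator {..<v y} x *\<^sub>R (norm (D (x, y)))\<^sup>2)"
            using elim(1) True by (simp add: indicator_Dom_per)
          have "E y = (\<integral>x. indicator {- \<epsilon>..0} (- v y + 1 * x) *\<^sub>R (m (- v y + 1 * x) y)\<^sup>2 \<partial>lborel)"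
            unfolding E_def set_lebesgue_integral_def by (subst lborel_integral_real_affine[of 1 _ "- v y"]) simp_all
          also have "\<dots> = (\<integral>x. indicator {v y - \<epsilon>..v y} x *\<^sub>R (norm (D (x, y)))\<^sup>2 \<partial>lborel)"
            by (intro Bochner_Integration.integral_cong refl) (auto simp: indicator_def m_def)
          also have "\<dots> \<le> (\<integral>x. indicator {..<v y} x *\<^sub>R (norm (D (x, y)))\<^sup>2 \<partial>lborel)"
          proof (rule integral_mono_AE[OF _ s])
            show "integrable lborel (\<lambda>x. indicat_real {v y - \<epsilon>..v y} x *\<^sub>R (norm (D (x, y)))\<^sup>2)"
              unfolding set_integrable_def[symmetric]
              by (intro borel_integrable_atLeastAtMost' continuous_intros continuous_on_compose2[OF cD]) auto
            show "AE x in lborel. indicat_real {v y - \<epsilon>..v y} x *\<^sub>R (norm (D (x, y)))\<^sup>2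
               \<le> indicat_real {..<v y} x *\<^sub>R (norm (D (x, y)))\<^sup>2"
              using AE_lborel_singleton[of "v y"] by eventually_elim (auto simp: indicator_def)
          qed
          finally show ?thesis using True by (simp add: E1 indicator_Dom_per)
        next
          case False
          then have "indicator {0..\<epsilon>} y *\<^sub>R E y = 0" using elim by (auto simp: indicator_def)
          moreover have "(\<integral>x. indicator (Dom_per \<epsilon> v) (x, y) *\<^sub>R (norm (D (x, y)))\<^sup>2 \<partial>lborel) = 0"
            using False by (simp add: indicator_Dom_per)
          ultimately show ?thesis by linarith
        qed
      qed
    qed (use iE plane_Fubini(4)[OF I] in \<open>auto simp: set_integrable_def\<close>)
    also have "\<dots> = (\<integral>z. indicator (Dom_per \<epsilon> v) z *\<^sub>R (norm (D z))\<^sup>2 \<partial>lborel)"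
      by (rule plane_Fubini(2)[OF I, symmetric])
    also have "\<dots> = (\<integral>z. (norm (D z))\<^sup>2 \<partial>bulk)"
      by (rule bulk_integral_lborel(1)[OF mD, symmetric])
    finally show ?thesis .
  qed
  have c: "continuous_on UNIV (\<lambda>y. (\<phi> (v y, y) - A)\<^sup>2)"
    by (intro continuous_intros continuous_on_boundary_values c\<phi>)
  have "(\<integral>y. (\<phi> (v y, y) - A)\<^sup>2 \<partial>edge) = (LINT y:{0<..<\<epsilon>}|lebesgue. (\<phi> (v y, y) - A)\<^sup>2)"
    by (rule set_integral_lebesgue_on(1)[symmetric]) auto
  also have "\<dots> = (LINT y:{0<..<\<epsilon>}|lborel. (\<phi> (v y, y) - A)\<^sup>2)"
    by (intro set_integral_completion(1) borel_measurable_continuous_onI c) auto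
  also have "\<dots> \<le> (LINT y:{0..\<epsilon>}|lborel. 3 * \<epsilon> * E y + 15 * T)"
    unfolding set_lebesgue_integral_def
  proof (rule integral_mono)
    have "set_integrable lborel {0..\<epsilon>} (\<lambda>y. (\<phi> (v y, y) - A)\<^sup>2)"
      by (rule borel_integrable_atLeastAtMost') (use c continuous_on_subset in blast)
    then have "set_integrable lborel {0<..<\<epsilon>} (\<lambda>y. (\<phi> (v y, y) - A)\<^sup>2)" by (rule set_integrable_subset) auto
    then show "integrable lborel (\<lambda>y. indicat_real {0<..<\<epsilon>} y *\<^sub>R (\<phi> (v y, y) - A)\<^sup>2)" by (simp add: set_integrable_def)
    have T0: "set_integrable lborel {0..\<epsilon>} (\<lambda>y. 15 * T)" by (rule borel_integrable_atLeastAtMost') auto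
    show "integrable lborel (\<lambda>y. indicat_real {0..\<epsilon>} y *\<^sub>R (3 * \<epsilon> * E y + 15 * T))"
      using set_integral_add(1)[OF set_integrable_mult_right[OF iE] T0] by (simp add: set_integrable_def)
    show "indicat_real {0<..<\<epsilon>} y *\<^sub>R (\<phi> (v y, y) - A)\<^sup>2 \<le> indicat_real {0..\<epsilon>} y *\<^sub>R (3 * \<epsilon> * E y + 15 * T)" for y
    proof (cases "y \<in> {0..\<epsilon>}")
      case True
      have "0 \<le> (\<phi> (v y, y) - A)\<^sup>2" by simp
      then have "0 \<le> 3 * \<epsilon> * E y + 15 * T" using pt[OF True] by linarith
      then show ?thesis using pt[OF True] True by (auto simp: indicator_def)
    qed (auto simp: indicator_def)
  qed
  also have "\<dots> = 3 * \<epsilon> * T + 15 * T * \<epsilon>"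
  proof -
    have T0: "set_integrable lborel {0..\<epsilon>} (\<lambda>y. 15 * T)" by (rule borel_integrable_atLeastAtMost') auto
    have "(LINT y:{0..\<epsilon>}|lborel. 15 * T) = 15 * T * \<epsilon>" using eps_pos by (simp add: set_lebesgue_integral_def)
    then show ?thesis
      using set_integral_add(2)[OF set_integrable_mult_right[OF iE] T0, of "3 * \<epsilon>"] TE by simp
  qed
  also have "\<dots> = 18 * \<epsilon> * T" by simp
  also have "\<dots> \<le> 18 * \<epsilon> * (\<integral>z. (norm (D z))\<^sup>2 \<partial>bulk)" using TJ eps_pos by (intro mult_left_mono) auto
  finally show ?thesis by blast
qed

end

section \<open>The temperature on the front\<close>

lemma AE_lebesgue_scale:
  fixes \<epsilon> :: real
  assumes "AE y in lebesgue. P y" "\<epsilon> \<noteq> 0"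
  shows "AE y in lebesgue. P (y / \<epsilon>)"
proof -
  have "AE y in lborel. P y" using assms(1) by (simp add: AE_completion_iff)
  then obtain N where N: "N \<in> null_sets lborel" "\<And>y. y \<notin> N \<Longrightarrow> P y"
    by (auto elim!: AE_E3)
  have "AE y in lborel. y \<notin> N" using N(1) by (rule AE_not_in)
  then have "AE y in lborel. 0 + (1 / \<epsilon>) * y \<notin> N"
    using N(1) assms(2) by (intro AE_borel_affine) auto
  then have "AE y in lborel. P (y / \<epsilon>)" by eventually_elim (use N(2) in auto)
  then show ?thesis by (rule AE_completion)
qed

lemma AE_plane_snd:
  fixes P :: "real \<Rightarrow> bool"
  assumes "AE y in lebesgue. P y"
  shows "AE z in lebesgue. P (snd (z :: real \<times> real))"
proof -
  have "AE y in lborel. P y" using assms by (simp add: AE_completion_iff)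
  then obtain N where N: "N \<in> null_sets lborel" "\<And>y. y \<notin> N \<Longrightarrow> P y"
    by (auto elim!: AE_E3)
  have "emeasure (lborel \<Otimes>\<^sub>M lborel) ((UNIV :: real set) \<times> N) = emeasure lborel (UNIV :: real set) * emeasure lborel N"
    using N(1) by (intro lborel.emeasure_pair_measure_Times) auto
  then have "(UNIV :: real set) \<times> N \<in> null_sets (lborel \<Otimes>\<^sub>M lborel)"
    using N(1) by (auto simp: null_sets_def)
  then have "AE z in (lborel :: (real \<times> real) measure). z \<notin> UNIV \<times> N"
    unfolding lborel_prod by (rule AE_not_in)
  then have "AE z in (lborel :: (real \<times> real) measure). P (snd z)"
    by eventually_elim (use N(2) in \<open>auto simp: mem_Times_iff\<close>)
  then show ?thesis by (rule AE_completion)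
qed

text \<open>
  Fubini is applied on the plane to Borel functions, so the scaled coefficients are replaced by Borel functions that
  satisfy their bounds everywhere.
\<close>

lemma coefficient_representative:
  assumes f: "f \<in> borel_measurable lebesgue" and b: "AE y in lebesgue. m \<le> f y \<and> f y \<le> M" and "m \<le> M"
    and \<epsilon>: "0 < (\<epsilon> :: real)"
  obtains F :: "real \<Rightarrow> real" where "F \<in> borel_measurable borel" "\<And>y. m \<le> F y \<and> F y \<le> M"
    "AE y in lebesgue. f (y / \<epsilon>) = F y" "AE z in lebesgue. f (snd (z :: real \<times> real) / \<epsilon>) = F (snd z)"
proof -
  obtain f0 where f0: "f0 \<in> borel_measurable lborel" "AE y in lborel. f y = f0 y"
    using completion_ex_borel_measurable_real[OF f] by blast
  define F where "F y = max m (min M (f0 (y / \<epsilon>)))" for y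
  have "AE y in lebesgue. f y = max m (min M (f0 y))"
    using AE_completion[OF f0(2)] b by eventually_elim auto
  then have 1: "AE y in lebesgue. f (y / \<epsilon>) = F y"
    unfolding F_def by (rule AE_lebesgue_scale) (use \<epsilon> in auto)
  show ?thesis
  proof (rule that[OF _ _ 1 AE_plane_snd[OF 1]])
    have [measurable]: "f0 \<in> borel_measurable borel" using f0(1) by simp
    show "F \<in> borel_measurable borel" unfolding F_def by measurable
    show "m \<le> F y \<and> F y \<le> M" for y using \<open>m \<le> M\<close> by (auto simp: F_def)
  qed
qed

lemma AE_lebesgue_onI: "AE x in lebesgue. P x \<Longrightarrow> S \<in> sets lebesgue \<Longrightarrow> AE x in lebesgue_on S. P x"
  by (subst AE_restrict_space_iff) auto

context periodic_cell
begin

lemma edge_measure: "measure edge {0<..<\<epsilon>} = \<epsilon>"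
  using eps_pos by (subst measure_restrict_space) auto

lemma edge_integral_const: "(\<integral>y. k \<partial>edge) = \<epsilon> * k"
  using edge_measure by (simp add: mult.commute)

lemma bounded_edge_square_integrable:
  assumes "f \<in> borel_measurable edge" "AE y in edge. \<bar>f y\<bar> \<le> K"
  shows "square_integrable edge f"
proof -
  have "square_integrable edge (\<lambda>y. f y * 1)"
    by (rule square_integrable_bounded_mult[OF _ assms]) (rule continuous_edge_square_integrable, auto)
  then show ?thesis by simp
qed

lemma square_integrable_edge_integrable:
  assumes "square_integrable edge f"
  shows "integrable edge f"
  using square_integrable_mult[OF assms continuous_edge_square_integrable[of "\<lambda>_. 1"]] by simp

text \<open>
  The weak equation of a periodic solution, with the arguments \<open>A\<close>, \<open>B\<close> and \<open>\<Gamma>\<close> standing for the coefficients \<open>a\<close>,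
  \<open>b\<close> and \<open>g\<close> at \<open>y / \<epsilon>\<close>.
\<close>

definition weak_solution :: "real \<Rightarrow> (real \<Rightarrow> real) \<Rightarrow> (real \<Rightarrow> real) \<Rightarrow> (real \<Rightarrow> real) \<Rightarrow> (real \<times> real \<Rightarrow> real \<times> real) \<Rightarrow> bool" where
  "weak_solution c A B \<Gamma> G \<longleftrightarrow> (\<forall>w H \<sigma>. H1_per \<epsilon> v w H \<and> is_trace \<epsilon> v w H \<sigma> \<longrightarrow>
     (LINT z:Dom_per \<epsilon> v|lebesgue. c * B (snd z) * fst (G z) * w z + A (snd z) * (G z \<bullet> H z))
     = (LINT y:{0<..<\<epsilon>}|lebesgue. c * \<Gamma> y * \<sigma> y))"

lemma weak_solution_split:
  assumes ws: "weak_solution c A B \<Gamma> G" and G: "H1_per \<epsilon> v u G"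
    and A: "A \<in> borel_measurable borel" "\<And>y. \<bar>A y\<bar> \<le> K" and B: "B \<in> borel_measurable borel" "\<And>y. \<bar>B y\<bar> \<le> L"
    and w: "is_trace \<epsilon> v w H \<sigma>"
  shows "c * (\<integral>z. B (snd z) * fst (G z) * w z \<partial>bulk)
      + ((\<integral>z. A (snd z) * fst (G z) * fst (H z) \<partial>bulk) + (\<integral>z. A (snd z) * snd (G z) * snd (H z) \<partial>bulk))
    = c * (\<integral>y. \<Gamma> y * \<sigma> y \<partial>edge)"
proof -
  have Hw: "H1_per \<epsilon> v w H" using w by (simp add: is_trace_def)
  have mA: "(\<lambda>z. A (snd z)) \<in> borel_measurable bulk" and mB: "(\<lambda>z. B (snd z)) \<in> borel_measurable bulk"
    by (rule coefficient_measurable[OF A(1)] coefficient_measurable[OF B(1)])+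
  have bA: "AE z in bulk. \<bar>A (snd z)\<bar> \<le> K" and bB: "AE z in bulk. \<bar>B (snd z)\<bar> \<le> L" using A B by auto
  note sG = H1_square_integrable[OF G] and sH = H1_square_integrable[OF Hw]
  have i: "integrable bulk (\<lambda>z. B (snd z) * fst (G z) * w z)" "integrable bulk (\<lambda>z. A (snd z) * fst (G z) * fst (H z))"
      "integrable bulk (\<lambda>z. A (snd z) * snd (G z) * snd (H z))"
    by (rule weighted_Cauchy_Schwarz(1)[OF sG(2) sH(1) mB bB] weighted_Cauchy_Schwarz(1)[OF sG(2) sH(2) mA bA]
        weighted_Cauchy_Schwarz(1)[OF sG(3) sH(3) mA bA])+
  have "(\<integral>z. c * B (snd z) * fst (G z) * w z + A (snd z) * (G z \<bullet> H z) \<partial>bulk) = (\<integral>y. c * \<Gamma> y * \<sigma> y \<partial>edge)"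
    using ws w Hw unfolding weak_solution_def by (simp add: set_integral_lebesgue_on(1))
  also have "(\<lambda>z. c * B (snd z) * fst (G z) * w z + A (snd z) * (G z \<bullet> H z))
    = (\<lambda>z. c * (B (snd z) * fst (G z) * w z) + (A (snd z) * fst (G z) * fst (H z) + A (snd z) * snd (G z) * snd (H z)))"
    by (auto simp: inner_prod_def algebra_simps)
  also have "(\<integral>z. c * (B (snd z) * fst (G z) * w z) + (A (snd z) * fst (G z) * fst (H z) + A (snd z) * snd (G z) * snd (H z)) \<partial>bulk)
    = c * (\<integral>z. B (snd z) * fst (G z) * w z \<partial>bulk)
      + ((\<integral>z. A (snd z) * fst (G z) * fst (H z) \<partial>bulk) + (\<integral>z. A (snd z) * snd (G z) * snd (H z) \<partial>bulk))"
    using i by (simp add: Bochner_Integration.integral_add)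
  also have "(\<integral>y. c * \<Gamma> y * \<sigma> y \<partial>edge) = c * (\<integral>y. \<Gamma> y * \<sigma> y \<partial>edge)" by (simp add: mult.assoc)
  finally show ?thesis .
qed

text \<open>
  Formally, the weak equation with the constant test function one. With \<open>exp (\<delta> x)\<close> instead, the error terms carry a
  factor \<open>\<delta>\<close> and are bounded by the norm of the test function, which is only of order \<open>1 / sqrt \<delta>\<close>.
\<close>

lemma heat_balance:
  assumes ws: "weak_solution c A B \<Gamma> G" and c: "0 < c" and tr: "is_trace \<epsilon> v u G \<tau>"
    and A: "A \<in> borel_measurable borel" "\<And>y. \<bar>A y\<bar> \<le> K" and B: "B \<in> borel_measurable borel" "\<And>y. \<bar>B y\<bar> \<le> L"
    and \<Gamma>: "\<Gamma> \<in> borel_measurable borel" "\<And>y. \<bar>\<Gamma> y\<bar> \<le> N" and V: "\<And>y. \<bar>v y\<bar> \<le> V"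
  shows "(\<integral>y. B y * \<tau> y \<partial>edge) = (\<integral>y. \<Gamma> y \<partial>edge)"
proof -
  have Hu: "H1_per \<epsilon> v u G" using tr by (simp add: is_trace_def)
  note sG = H1_square_integrable[OF Hu]
  have V': "v y \<le> V" for y using V[of y] by simp
  have V0: "0 \<le> V" using V[of 0] by simp
  have KL: "0 \<le> K" "0 \<le> L" using A(2)[of 0] B(2)[of 0] by simp_all
  have mA: "(\<lambda>z. A (snd z)) \<in> borel_measurable bulk" and mB: "(\<lambda>z. B (snd z)) \<in> borel_measurable bulk"
    by (rule coefficient_measurable[OF A(1)] coefficient_measurable[OF B(1)])+
  have bA: "AE z in bulk. \<bar>A (snd z)\<bar> \<le> K" and bB: "AE z in bulk. \<bar>B (snd z)\<bar> \<le> L" using A B by auto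
  have i\<tau>: "integrable edge (\<lambda>y. B y * \<tau> y)"
    by (intro square_integrable_edge_integrable square_integrable_bounded_mult[where K = L] trace_square_integrable[OF tr]
        borel_measurable_edge B) (use B in auto)
  have i\<Gamma>: "integrable edge \<Gamma>"
    by (intro square_integrable_edge_integrable bounded_edge_square_integrable[where K = N] borel_measurable_edge \<Gamma>) (use \<Gamma> in auto)
  define \<delta> where "\<delta> n = 1 / real (Suc n)" for n
  have \<delta>: "0 < \<delta> n" "\<delta> n \<le> 1" for n by (auto simp: \<delta>_def)
  have \<delta>0: "\<delta> \<longlonglongrightarrow> 0" unfolding \<delta>_def by (rule LIMSEQ_Suc[OF lim_1_over_n, unfolded o_def])
  let ?e = "\<lambda>n z :: real \<times> real. exp (\<delta> n * fst z)"
  define X where "X n = \<delta> n * (\<integral>z. B (snd z) * u z * ?e n z \<partial>bulk)" for n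
  define Y where "Y n = \<delta> n * (\<integral>z. A (snd z) * fst (G z) * ?e n z \<partial>bulk)" for n
  have eq: "c * (\<integral>y. B y * \<tau> y * exp (\<delta> n * v y) \<partial>edge) - c * (\<integral>y. \<Gamma> y * exp (\<delta> n * v y) \<partial>edge) = c * X n - Y n" for n
  proof -
    have 1: "c * (\<integral>z. B (snd z) * fst (G z) * ?e n z \<partial>bulk)
      + ((\<integral>z. A (snd z) * fst (G z) * (\<delta> n * ?e n z) \<partial>bulk) + (\<integral>z. A (snd z) * snd (G z) * 0 \<partial>bulk))
      = c * (\<integral>y. \<Gamma> y * exp (\<delta> n * v y) \<partial>edge)"
      using weak_solution_split[OF ws Hu A B is_trace_exp[OF \<delta>(1)[of n] V']] by simp
    have 2: "(\<integral>z. A (snd z) * fst (G z) * (\<delta> n * ?e n z) \<partial>bulk) = Y n"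
      by (simp add: Y_def mult.left_commute)
    have 3: "(\<integral>z. B (snd z) * fst (G z) * ?e n z \<partial>bulk) = (\<integral>y. B y * \<tau> y * exp (\<delta> n * v y) \<partial>edge) - X n"
      using trace_flux[OF tr B \<delta>(1)[of n] V'] by (simp add: X_def)
    have "c * ((\<integral>y. B y * \<tau> y * exp (\<delta> n * v y) \<partial>edge) - X n) + (Y n + 0) = c * (\<integral>y. \<Gamma> y * exp (\<delta> n * v y) \<partial>edge)"
      using 1 unfolding 2 3 by simp
    then show ?thesis unfolding right_diff_distrib by linarith
  qed
  \<comment> \<open>The test function has norm of order \<open>\<delta>\<close> to the power minus one half, so a factor \<open>\<delta>\<close> wins.\<close>
  have small: "(\<lambda>n. \<delta> n * L2_norm bulk (?e n)) \<longlonglongrightarrow> 0"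
  proof (rule Lim_null_comparison)
    show "(\<lambda>n. sqrt (\<delta> n * (\<epsilon> * exp (2 * V) / 2))) \<longlonglongrightarrow> 0"
      using tendsto_real_sqrt[OF tendsto_mult_left_zero[OF \<delta>0, of "\<epsilon> * exp (2 * V) / 2"]] by simp
    show "\<forall>\<^sub>F n in sequentially. norm (\<delta> n * L2_norm bulk (?e n)) \<le> sqrt (\<delta> n * (\<epsilon> * exp (2 * V) / 2))"
    proof (rule always_eventually, rule allI)
      fix n
      have "(\<delta> n * L2_norm bulk (?e n))\<^sup>2 \<le> (\<delta> n)\<^sup>2 * (\<epsilon> * (exp (2 * \<delta> n * V) / (2 * \<delta> n)))"
        unfolding power_mult_distrib by (intro mult_left_mono exp_weight_square_integrable(2)[OF \<delta>(1) V']) auto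
      also have "\<dots> = \<delta> n * (\<epsilon> * exp (2 * \<delta> n * V) / 2)" using \<delta>(1)[of n] by (simp add: power2_eq_square field_simps)
      also have "\<dots> \<le> \<delta> n * (\<epsilon> * exp (2 * V) / 2)"
      proof -
        have "\<delta> n * V \<le> 1 * V" using \<delta>[of n] V0 by (intro mult_right_mono) auto
        then show ?thesis using \<delta>(1)[of n] eps_pos by (intro mult_left_mono divide_right_mono) auto
      qed
      finally show "norm (\<delta> n * L2_norm bulk (?e n)) \<le> sqrt (\<delta> n * (\<epsilon> * exp (2 * V) / 2))"
        using \<delta>(1)[of n] by (simp add: real_le_rsqrt)
    qed
  qed
  have X: "X \<longlonglongrightarrow> 0"
  proof (rule Lim_null_comparison)
    show "(\<lambda>n. L * L2_norm bulk u * (\<delta> n * L2_norm bulk (?e n))) \<longlonglongrightarrow> 0"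
      by (rule tendsto_mult_right_zero[OF small])
    show "\<forall>\<^sub>F n in sequentially. norm (X n) \<le> L * L2_norm bulk u * (\<delta> n * L2_norm bulk (?e n))"
    proof (rule always_eventually, rule allI)
      fix n
      have "\<delta> n * \<bar>\<integral>z. B (snd z) * u z * ?e n z \<partial>bulk\<bar> \<le> \<delta> n * (L * (L2_norm bulk u * L2_norm bulk (?e n)))"
        using \<delta>(1)[of n] weighted_Cauchy_Schwarz(2)[OF sG(1) exp_weight_square_integrable(1)[OF \<delta>(1) V'] mB bB KL(2)]
        by (intro mult_left_mono) auto
      then show "norm (X n) \<le> L * L2_norm bulk u * (\<delta> n * L2_norm bulk (?e n))"
        using \<delta>(1)[of n] by (simp add: X_def abs_mult algebra_simps)
    qed
  qed
  have Y: "Y \<longlonglongrightarrow> 0"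
  proof (rule Lim_null_comparison)
    show "(\<lambda>n. K * L2_norm bulk (\<lambda>z. fst (G z)) * (\<delta> n * L2_norm bulk (?e n))) \<longlonglongrightarrow> 0"
      by (rule tendsto_mult_right_zero[OF small])
    show "\<forall>\<^sub>F n in sequentially. norm (Y n) \<le> K * L2_norm bulk (\<lambda>z. fst (G z)) * (\<delta> n * L2_norm bulk (?e n))"
    proof (rule always_eventually, rule allI)
      fix n
      have "\<delta> n * \<bar>\<integral>z. A (snd z) * fst (G z) * ?e n z \<partial>bulk\<bar> \<le> \<delta> n * (K * (L2_norm bulk (\<lambda>z. fst (G z)) * L2_norm bulk (?e n)))"
        using \<delta>(1)[of n] weighted_Cauchy_Schwarz(2)[OF sG(2) exp_weight_square_integrable(1)[OF \<delta>(1) V'] mA bA KL(1)]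
        by (intro mult_left_mono) auto
      then show "norm (Y n) \<le> K * L2_norm bulk (\<lambda>z. fst (G z)) * (\<delta> n * L2_norm bulk (?e n))"
        using \<delta>(1)[of n] by (simp add: Y_def abs_mult algebra_simps)
    qed
  qed
  have lim: "(\<lambda>n. \<integral>y. k y * exp (\<delta> n * v y) \<partial>edge) \<longlonglongrightarrow> (\<integral>y. k y \<partial>edge)" if k: "integrable edge k" for k
  proof (rule integral_dominated_convergence)
    show "integrable edge (\<lambda>y. \<bar>k y\<bar> * exp V)" using k by (intro integrable_mult_left integrable_abs)
    show "(\<lambda>y. k y * exp (\<delta> n * v y)) \<in> borel_measurable edge" for n
      by (rule borel_measurable_times[OF borel_measurable_integrable[OF k]])
        (intro borel_measurable_edge borel_measurable_continuous_onI continuous_intros v_cont)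
    show "AE y in edge. (\<lambda>n. k y * exp (\<delta> n * v y)) \<longlonglongrightarrow> k y"
    proof (rule AE_I2)
      fix y
      have "(\<lambda>n. k y * exp (\<delta> n * v y)) \<longlonglongrightarrow> k y * exp (0 * v y)" by (intro tendsto_intros \<delta>0)
      then show "(\<lambda>n. k y * exp (\<delta> n * v y)) \<longlonglongrightarrow> k y" by simp
    qed
    show "AE y in edge. norm (k y * exp (\<delta> n * v y)) \<le> \<bar>k y\<bar> * exp V" for n
    proof (rule AE_I2)
      fix y
      have "\<delta> n * v y \<le> \<delta> n * V" using \<delta>(1)[of n] V'[of y] by (intro mult_left_mono) auto
      also have "\<dots> \<le> 1 * V" using \<delta>[of n] V0 by (intro mult_right_mono) auto
      finally show "norm (k y * exp (\<delta> n * v y)) \<le> \<bar>k y\<bar> * exp V" by (simp add: abs_mult mult_left_mono)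
    qed
  qed (use k in auto)
  have "(\<lambda>n. c * (\<integral>y. B y * \<tau> y * exp (\<delta> n * v y) \<partial>edge) - c * (\<integral>y. \<Gamma> y * exp (\<delta> n * v y) \<partial>edge))
      \<longlonglongrightarrow> c * (\<integral>y. B y * \<tau> y \<partial>edge) - c * (\<integral>y. \<Gamma> y \<partial>edge)"
    by (intro tendsto_intros lim i\<tau> i\<Gamma>)
  moreover have "(\<lambda>n. c * X n - Y n) \<longlonglongrightarrow> c * 0 - 0" by (intro tendsto_intros X Y)
  ultimately have "c * (\<integral>y. B y * \<tau> y \<partial>edge) - c * (\<integral>y. \<Gamma> y \<partial>edge) = 0"
    unfolding eq using LIMSEQ_unique by fastforce
  then show ?thesis using c by simp
qed

text \<open>
  Testing with \<open>u\<close> and dropping the nonnegative convection term bounds the energy by the boundary term, in which \<open>\<Gamma> \<tau>\<close>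
  is at most a multiple of \<open>B \<tau>\<close> because \<open>\<tau>\<close> is positive; the integral of \<open>B \<tau>\<close> is known from the heat balance.
\<close>

lemma dirichlet_energy_bound:
  assumes ws: "weak_solution c A B \<Gamma> G" and c: "0 < c" and tr: "is_trace \<epsilon> v u G \<tau>"
    and A: "A \<in> borel_measurable borel" "\<And>y. am \<le> A y \<and> A y \<le> aM" "0 < am"
    and B: "B \<in> borel_measurable borel" "\<And>y. bm \<le> B y \<and> B y \<le> bM" "0 < bm"
    and \<Gamma>: "\<Gamma> \<in> borel_measurable borel" "\<And>y. gm \<le> \<Gamma> y \<and> \<Gamma> y \<le> gM" "0 < gm"
    and pos: "AE y in edge. 0 < \<tau> y" and V: "\<And>y. \<bar>v y\<bar> \<le> V"
  shows "am * (\<integral>z. (norm (G z))\<^sup>2 \<partial>bulk) \<le> c * (gM\<^sup>2 / bm) * \<epsilon>"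
proof -
  have Hu: "H1_per \<epsilon> v u G" using tr by (simp add: is_trace_def)
  note sG = H1_square_integrable[OF Hu]
  have bnd: "\<bar>A y\<bar> \<le> aM" "\<bar>B y\<bar> \<le> bM" "\<bar>\<Gamma> y\<bar> \<le> gM" for y
    using A(2)[of y] A(3) B(2)[of y] B(3) \<Gamma>(2)[of y] \<Gamma>(3) by auto
  have gM: "0 < gM" using \<Gamma>(2)[of 0] \<Gamma>(3) by linarith
  have mA: "(\<lambda>z. A (snd z)) \<in> borel_measurable bulk"
    by (rule coefficient_measurable[OF A(1)])
  have bA: "AE z in bulk. \<bar>A (snd z)\<bar> \<le> aM" using bnd by auto
  note s\<tau> = trace_square_integrable[OF tr]
  have i: "integrable edge (\<lambda>y. B y * \<tau> y)" "integrable edge (\<lambda>y. \<Gamma> y * \<tau> y)" "integrable edge \<Gamma>"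
    by (intro square_integrable_edge_integrable square_integrable_bounded_mult[OF s\<tau>, where K = bM]
        square_integrable_bounded_mult[OF s\<tau>, where K = gM] bounded_edge_square_integrable[where K = gM]
        borel_measurable_edge B \<Gamma> AE_I2 bnd)+
  have bal: "(\<integral>y. B y * \<tau> y \<partial>edge) = (\<integral>y. \<Gamma> y \<partial>edge)"
    by (rule heat_balance[OF ws c tr A(1) bnd(1) B(1) bnd(2) \<Gamma>(1) bnd(3) V])
  have iA: "integrable bulk (\<lambda>z. A (snd z) * fst (G z) * fst (G z))" "integrable bulk (\<lambda>z. A (snd z) * snd (G z) * snd (G z))"
    by (rule weighted_Cauchy_Schwarz(1)[OF sG(2) sG(2) mA bA] weighted_Cauchy_Schwarz(1)[OF sG(3) sG(3) mA bA])+
  have iG: "integrable bulk (\<lambda>z. (norm (G z))\<^sup>2)" using sG by (auto simp: square_integrable_def norm_prod_square)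
  have "am * (\<integral>z. (norm (G z))\<^sup>2 \<partial>bulk) = (\<integral>z. am * (norm (G z))\<^sup>2 \<partial>bulk)" by simp
  also have "\<dots> \<le> (\<integral>z. A (snd z) * fst (G z) * fst (G z) + A (snd z) * snd (G z) * snd (G z) \<partial>bulk)"
  proof (rule integral_mono)
    fix z
    have "am * ((fst (G z))\<^sup>2 + (snd (G z))\<^sup>2) \<le> A (snd z) * ((fst (G z))\<^sup>2 + (snd (G z))\<^sup>2)"
      using A(2)[of "snd z"] by (intro mult_right_mono) auto
    then show "am * (norm (G z))\<^sup>2 \<le> A (snd z) * fst (G z) * fst (G z) + A (snd z) * snd (G z) * snd (G z)"
      unfolding norm_prod_square by (simp add: power2_eq_square algebra_simps)
  qed (use iA iG in auto)
  also have "\<dots> = (\<integral>z. A (snd z) * fst (G z) * fst (G z) \<partial>bulk) + (\<integral>z. A (snd z) * snd (G z) * snd (G z) \<partial>bulk)"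
    using iA by simp
  also have "\<dots> \<le> c * (\<integral>y. \<Gamma> y * \<tau> y \<partial>edge)"
  proof -
    have "0 \<le> (\<integral>z. B (snd z) * fst (G z) * u z \<partial>bulk)"
      by (rule advection_energy_nonneg[OF tr B(1), where K = bM]) (use B(2,3) in \<open>auto intro: order_trans[of _ bm]\<close>)
    then have "0 \<le> c * (\<integral>z. B (snd z) * fst (G z) * u z \<partial>bulk)" using c by simp
    then show ?thesis using weak_solution_split[OF ws Hu A(1) bnd(1) B(1) bnd(2) tr] by linarith
  qed
  also have "\<dots> \<le> c * (gM / bm * (\<integral>y. B y * \<tau> y \<partial>edge))"
  proof (intro mult_left_mono)
    have "(\<integral>y. \<Gamma> y * \<tau> y \<partial>edge) \<le> (\<integral>y. gM / bm * (B y * \<tau> y) \<partial>edge)"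
    proof (rule integral_mono_AE)
      show "AE y in edge. \<Gamma> y * \<tau> y \<le> gM / bm * (B y * \<tau> y)"
        using pos
      proof eventually_elim
        case (elim y)
        have "\<Gamma> y * bm \<le> gM * B y" using \<Gamma>(2)[of y] \<Gamma>(3) B(2)[of y] B(3) by (intro mult_mono) auto
        then have "\<Gamma> y \<le> gM / bm * B y" using B(3) by (simp add: field_simps)
        then have "\<Gamma> y * \<tau> y \<le> (gM / bm * B y) * \<tau> y" using elim by (intro mult_right_mono) auto
        then show ?case by (simp only: mult.assoc)
      qed
    qed (use i in auto)
    then show "(\<integral>y. \<Gamma> y * \<tau> y \<partial>edge) \<le> gM / bm * (\<integral>y. B y * \<tau> y \<partial>edge)" by simp
  qed (use c in auto)
  also have "\<dots> \<le> c * (gM / bm * (\<epsilon> * gM))"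
  proof (intro mult_left_mono)
    have "(\<integral>y. \<Gamma> y \<partial>edge) \<le> (\<integral>y. gM \<partial>edge)"
      by (intro integral_mono i) (use \<Gamma>(2) finite_edge in \<open>auto intro: finite_measure.integrable_const\<close>)
    then show "(\<integral>y. B y * \<tau> y \<partial>edge) \<le> \<epsilon> * gM" using bal by (simp only: edge_integral_const)
  qed (use c gM B(3) in auto)
  finally show ?thesis by (simp add: power2_eq_square algebra_simps)
qed

text \<open>
  The oscillation estimate compares a smooth function with a constant that depends on it. Since errors of order \<open>\<epsilon>\<^sup>2\<close>
  are allowed, a single approximation of \<open>u\<close> suffices, with squared errors below \<open>\<epsilon>\<^sup>2\<close> on the boundary and below \<open>\<epsilon>\<close> for
  the gradient, and no limit of the constants has to be taken. Two applications of \<open>(x + y)\<^sup>2 \<le> 2 x\<^sup>2 + 2 y\<^sup>2\<close> turn the factor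
  18 of that estimate into 72.
\<close>

lemma trace_near_constant:
  assumes tr: "is_trace \<epsilon> v u G \<tau>"
    and v': "\<And>y. (v has_real_derivative p y) (at y)" and p: "continuous_on UNIV p" "\<And>y. \<bar>p y\<bar> \<le> 1"
    and J: "(\<integral>z. (norm (G z))\<^sup>2 \<partial>bulk) \<le> k * \<epsilon>"
  shows "\<exists>A. (\<integral>y. (A - \<tau> y)\<^sup>2 \<partial>edge) \<le> (74 + 72 * k) * \<epsilon>\<^sup>2"
proof -
  obtain \<phi> D where C: "\<And>n::nat. C1_gradient (\<phi> n) (D n)" and H: "\<And>n. H1_per \<epsilon> v (\<phi> n) (D n)"
    and l: "(\<lambda>n. L2_norm bulk (\<lambda>z. \<phi> n z - u z)) \<longlonglongrightarrow> 0"
    "(\<lambda>n. L2_norm bulk (\<lambda>z. fst (D n z) - fst (G z))) \<longlonglongrightarrow> 0"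
    "(\<lambda>n. L2_norm bulk (\<lambda>z. snd (D n z) - snd (G z))) \<longlonglongrightarrow> 0"
    "(\<lambda>n. L2_norm edge (\<lambda>y. \<phi> n (v y, y) - \<tau> y)) \<longlonglongrightarrow> 0"
  proof (rule trace_approximation[OF tr], goal_cases)
    case (1 \<phi> D)
    from 1(2-7) show ?case by (rule 1(1))
  qed
  have Hu: "H1_per \<epsilon> v u G" using tr by (simp add: is_trace_def)
  note sG = H1_square_integrable[OF Hu] and sD = H1_square_integrable[OF H]
  have "(\<lambda>n. (L2_norm bulk (\<lambda>z. fst (D n z) - fst (G z)))\<^sup>2 + (L2_norm bulk (\<lambda>z. snd (D n z) - snd (G z)))\<^sup>2) \<longlonglongrightarrow> 0\<^sup>2 + 0\<^sup>2"
    by (intro tendsto_intros l)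
  from order_tendstoD(2)[OF this] have e1: "\<forall>\<^sub>F n in sequentially. (L2_norm bulk (\<lambda>z. fst (D n z) - fst (G z)))\<^sup>2 + (L2_norm bulk (\<lambda>z. snd (D n z) - snd (G z)))\<^sup>2 < \<epsilon>"
    using eps_pos by auto
  have "(\<lambda>n. (L2_norm edge (\<lambda>y. \<phi> n (v y, y) - \<tau> y))\<^sup>2) \<longlonglongrightarrow> 0\<^sup>2"
    by (intro tendsto_intros l)
  from order_tendstoD(2)[OF this] have e2: "\<forall>\<^sub>F n in sequentially. (L2_norm edge (\<lambda>y. \<phi> n (v y, y) - \<tau> y))\<^sup>2 < \<epsilon>\<^sup>2"
    using eps_pos by auto
  obtain n where n: "(L2_norm bulk (\<lambda>z. fst (D n z) - fst (G z)))\<^sup>2 + (L2_norm bulk (\<lambda>z. snd (D n z) - snd (G z)))\<^sup>2 < \<epsilon>"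
    "(L2_norm edge (\<lambda>y. \<phi> n (v y, y) - \<tau> y))\<^sup>2 < \<epsilon>\<^sup>2"
    using eventually_happens'[OF _ eventually_conj[OF e1 e2]] by auto
  obtain A where A: "(\<integral>y. (\<phi> n (v y, y) - A)\<^sup>2 \<partial>edge) \<le> 18 * \<epsilon> * (\<integral>z. (norm (D n z))\<^sup>2 \<partial>bulk)"
    using C1_trace_oscillation[OF C H v' p] by blast
  have two: "(x + y)\<^sup>2 \<le> 2 * x\<^sup>2 + 2 * y\<^sup>2" for x y :: real
    using sum_squares_bound[of x y] by (simp add: power2_sum)
  note d1 = square_integrable_diff[OF sD(2)[of n] sG(2)] and d2 = square_integrable_diff[OF sD(3)[of n] sG(3)]
  have "(\<integral>z. (norm (D n z))\<^sup>2 \<partial>bulk) \<le> (\<integral>z. 2 * (norm (G z))\<^sup>2 + (2 * (fst (D n z) - fst (G z))\<^sup>2 + 2 * (snd (D n z) - snd (G z))\<^sup>2) \<partial>bulk)"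
  proof (rule integral_mono)
    fix z
    show "(norm (D n z))\<^sup>2 \<le> 2 * (norm (G z))\<^sup>2 + (2 * (fst (D n z) - fst (G z))\<^sup>2 + 2 * (snd (D n z) - snd (G z))\<^sup>2)"
      using two[of "fst (G z)" "fst (D n z) - fst (G z)"] two[of "snd (G z)" "snd (D n z) - snd (G z)"]
      by (simp add: norm_prod_square)
  qed (use sD[of n] sG d1 d2 in \<open>auto simp: square_integrable_def norm_prod_square\<close>)
  also have "\<dots> = 2 * (\<integral>z. (norm (G z))\<^sup>2 \<partial>bulk) + 2 * ((L2_norm bulk (\<lambda>z. fst (D n z) - fst (G z)))\<^sup>2 + (L2_norm bulk (\<lambda>z. snd (D n z) - snd (G z)))\<^sup>2)"
    using sG d1 d2 by (simp add: square_integrable_def norm_prod_square L2_norm_square)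
  also have "\<dots> \<le> 2 * (k * \<epsilon>) + 2 * \<epsilon>" by (intro add_mono mult_left_mono J less_imp_le[OF n(1)]) auto
  finally have "18 * \<epsilon> * (\<integral>z. (norm (D n z))\<^sup>2 \<partial>bulk) \<le> 18 * \<epsilon> * (2 * (k * \<epsilon>) + 2 * \<epsilon>)"
    using eps_pos by (intro mult_left_mono) auto
  then have A': "(\<integral>y. (\<phi> n (v y, y) - A)\<^sup>2 \<partial>edge) \<le> (36 * k + 36) * \<epsilon>\<^sup>2"
    using A by (simp add: power2_eq_square algebra_simps)
  have t1: "square_integrable edge (\<lambda>y. \<phi> n (v y, y))"
    by (intro continuous_edge_square_integrable continuous_on_boundary_values C1_gradient_continuous(1)[OF C])
  have t2: "square_integrable edge (\<lambda>_. A)" by (intro continuous_edge_square_integrable) auto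
  note s\<tau> = trace_square_integrable[OF tr]
  note q = square_integrable_diff[OF t1 t2] square_integrable_diff[OF t1 s\<tau>] square_integrable_diff[OF t2 s\<tau>]
  have "(\<integral>y. (A - \<tau> y)\<^sup>2 \<partial>edge) \<le> (\<integral>y. 2 * (\<phi> n (v y, y) - A)\<^sup>2 + 2 * (\<phi> n (v y, y) - \<tau> y)\<^sup>2 \<partial>edge)"
  proof (rule integral_mono)
    fix y
    show "(A - \<tau> y)\<^sup>2 \<le> 2 * (\<phi> n (v y, y) - A)\<^sup>2 + 2 * (\<phi> n (v y, y) - \<tau> y)\<^sup>2"
      using two[of "A - \<phi> n (v y, y)" "\<phi> n (v y, y) - \<tau> y"] by (simp add: power2_commute)
  qed (use q in \<open>auto simp: square_integrable_def\<close>)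
  also have "\<dots> = 2 * (\<integral>y. (\<phi> n (v y, y) - A)\<^sup>2 \<partial>edge) + 2 * (L2_norm edge (\<lambda>y. \<phi> n (v y, y) - \<tau> y))\<^sup>2"
    using q by (simp add: square_integrable_def L2_norm_square)
  also have "\<dots> \<le> 2 * ((36 * k + 36) * \<epsilon>\<^sup>2) + 2 * \<epsilon>\<^sup>2" using A' n(2) by linarith
  finally show ?thesis by (intro exI[of _ A]) (simp add: algebra_simps)
qed

text \<open>
  The balance says that \<open>\<tau> - T\<close> has mean zero with weight \<open>B\<close>. So the distance of \<open>T\<close> to the constant \<open>A\<close> is a weighted
  mean of \<open>A - \<tau>\<close>, which the Cauchy-Schwarz inequality bounds.
\<close>

lemma trace_near_limit_temperature:
  assumes tr: "is_trace \<epsilon> v u G \<tau>" and bal: "(\<integral>y. B y * \<tau> y \<partial>edge) = T * (\<integral>y. B y \<partial>edge)"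
    and B: "B \<in> borel_measurable borel" "\<And>y. bm \<le> B y \<and> B y \<le> bM" "0 < bm"
    and A: "(\<integral>y. (A - \<tau> y)\<^sup>2 \<partial>edge) \<le> K * \<epsilon>\<^sup>2"
  shows "(\<integral>y. (\<tau> y - T)\<^sup>2 \<partial>edge) \<le> 2 * (1 + (bM / bm)\<^sup>2) * K * \<epsilon>\<^sup>2"
proof -
  note s\<tau> = trace_square_integrable[OF tr]
  have bnd: "\<bar>B y\<bar> \<le> bM" for y using B(2)[of y] B(3) by auto
  have mB: "B \<in> borel_measurable edge" by (rule borel_measurable_edge[OF B(1)])
  have sB: "square_integrable edge B"
    by (rule bounded_edge_square_integrable[OF mB, of bM]) (use bnd in auto)
  have sc: "square_integrable edge (\<lambda>_. k)" for k by (intro continuous_edge_square_integrable) auto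
  note q = square_integrable_diff[OF sc[of A] s\<tau>]
  have i: "integrable edge B" "integrable edge (\<lambda>y. B y * \<tau> y)"
    by (rule square_integrable_edge_integrable[OF sB] square_integrable_mult[OF sB s\<tau>])+
  have eq: "(A - T) * (\<integral>y. B y \<partial>edge) = (\<integral>y. B y * (A - \<tau> y) \<partial>edge)"
    using i bal by (simp add: right_diff_distrib left_diff_distrib mult.commute)
  have Bge: "bm * \<epsilon> \<le> (\<integral>y. B y \<partial>edge)"
  proof -
    have "(\<integral>y. bm \<partial>edge) \<le> (\<integral>y. B y \<partial>edge)"
      by (intro integral_mono i square_integrable_edge_integrable sc) (use B(2) in auto)
    then show ?thesis by (simp only: edge_integral_const mult.commute)
  qed
  have NB: "(L2_norm edge B)\<^sup>2 \<le> bM\<^sup>2 * \<epsilon>"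
  proof -
    have "(\<integral>y. (B y)\<^sup>2 \<partial>edge) \<le> (\<integral>y. bM\<^sup>2 \<partial>edge)"
      using sB sc[of bM] bnd by (intro integral_mono) (auto simp: square_integrable_def abs_le_square_iff[symmetric] intro: order_trans[OF bnd] )
    then show ?thesis by (simp only: edge_integral_const L2_norm_square mult.commute)
  qed
  have "\<bar>A - T\<bar> * (bm * \<epsilon>) \<le> \<bar>A - T\<bar> * (\<integral>y. B y \<partial>edge)" by (intro mult_left_mono Bge) auto
  also have "\<dots> = \<bar>(A - T) * (\<integral>y. B y \<partial>edge)\<bar>"
    using Bge B(3) eps_pos by (simp add: abs_mult) (smt (verit) mult_pos_pos)
  also have "\<dots> \<le> L2_norm edge B * L2_norm edge (\<lambda>y. A - \<tau> y)"
    unfolding eq by (rule Cauchy_Schwarz_integral[OF sB q])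
  finally have "(\<bar>A - T\<bar> * (bm * \<epsilon>))\<^sup>2 \<le> (L2_norm edge B * L2_norm edge (\<lambda>y. A - \<tau> y))\<^sup>2"
    using B(3) eps_pos by (intro power_mono) auto
  also have "\<dots> = (L2_norm edge B)\<^sup>2 * (\<integral>y. (A - \<tau> y)\<^sup>2 \<partial>edge)" by (simp add: power_mult_distrib L2_norm_square)
  also have "\<dots> \<le> (bM\<^sup>2 * \<epsilon>) * (K * \<epsilon>\<^sup>2)" by (intro mult_mono NB A) (use eps_pos in auto)
  finally have "(A - T)\<^sup>2 * bm\<^sup>2 * \<epsilon>\<^sup>2 \<le> (bM\<^sup>2 * K * \<epsilon>) * \<epsilon>\<^sup>2" by (simp add: power_mult_distrib mult_ac)
  then have "(A - T)\<^sup>2 * bm\<^sup>2 \<le> bM\<^sup>2 * K * \<epsilon>" using eps_pos by (subst (asm) mult_le_cancel_right_pos) auto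
  then have "(A - T)\<^sup>2 \<le> (bM / bm)\<^sup>2 * K * \<epsilon>" using B(3) by (simp add: power_divide field_simps)
  then have "\<epsilon> * (A - T)\<^sup>2 \<le> \<epsilon> * ((bM / bm)\<^sup>2 * K * \<epsilon>)" using eps_pos by (intro mult_left_mono) auto
  then have AT: "\<epsilon> * (A - T)\<^sup>2 \<le> (bM / bm)\<^sup>2 * K * \<epsilon>\<^sup>2" by (simp add: power2_eq_square mult_ac)
  have sT: "square_integrable edge (\<lambda>y. \<tau> y - T)" by (rule square_integrable_diff[OF s\<tau> sc])
  have "(\<integral>y. (\<tau> y - T)\<^sup>2 \<partial>edge) \<le> (\<integral>y. 2 * (A - \<tau> y)\<^sup>2 + 2 * (A - T)\<^sup>2 \<partial>edge)"
  proof (rule integral_mono)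
    fix y
    have "(\<tau> y - T)\<^sup>2 = ((A - T) - (A - \<tau> y))\<^sup>2" by simp
    then show "(\<tau> y - T)\<^sup>2 \<le> 2 * (A - \<tau> y)\<^sup>2 + 2 * (A - T)\<^sup>2"
      using zero_le_power2[of "(A - T) + (A - \<tau> y)"] by (simp add: power2_eq_square algebra_simps)
  qed (use q sT square_integrable_edge_integrable[OF sc[of "2 * (A - T)\<^sup>2"]] in \<open>auto simp: square_integrable_def\<close>)
  also have "\<dots> = 2 * (\<integral>y. (A - \<tau> y)\<^sup>2 \<partial>edge) + (\<integral>y. 2 * (A - T)\<^sup>2 \<partial>edge)"
    using q square_integrable_edge_integrable[OF sc[of "2 * (A - T)\<^sup>2"]] by (simp add: square_integrable_def del: integral_const lebesgue_integral_const)
  also have "\<dots> = 2 * (\<integral>y. (A - \<tau> y)\<^sup>2 \<partial>edge) + 2 * (\<epsilon> * (A - T)\<^sup>2)"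
    by (simp only: edge_integral_const mult.left_commute)
  also have "\<dots> \<le> 2 * (K * \<epsilon>\<^sup>2) + 2 * ((bM / bm)\<^sup>2 * K * \<epsilon>\<^sup>2)" using A AT by linarith
  finally show ?thesis by (simp add: algebra_simps)
qed

end

section \<open>Periodic functions and the slope of the front\<close>

lemma periodic_reduce:
  fixes f :: "real \<Rightarrow> 'a"
  assumes per: "\<And>y. f (y + \<epsilon>) = f y" and \<epsilon>: "0 < \<epsilon>"
  obtains y' where "y' \<in> {0..\<epsilon>}" "f y' = f y"
proof -
  have n: "f (x + real n * \<epsilon>) = f x" for n x
  proof (induction n)
    case (Suc n)
    have "f (x + real (Suc n) * \<epsilon>) = f ((x + real n * \<epsilon>) + \<epsilon>)" by (simp add: algebra_simps)
    then show ?case using per Suc by simp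
  qed simp
  have i: "f (x + real_of_int k * \<epsilon>) = f x" for k x
  proof (cases "0 \<le> k")
    case True
    then show ?thesis using n[of x "nat k"] by simp
  next
    case False
    then show ?thesis using n[of "x + real_of_int k * \<epsilon>" "nat (- k)"] by (simp add: algebra_simps)
  qed
  let ?k = "\<lfloor>y / \<epsilon>\<rfloor>"
  have "real_of_int ?k * \<epsilon> \<le> y" "y \<le> (real_of_int ?k + 1) * \<epsilon>"
    using floor_divide_lower[OF \<epsilon>, of y] floor_divide_upper[OF \<epsilon>, of y] by auto
  then have "y + real_of_int (- ?k) * \<epsilon> \<in> {0..\<epsilon>}" by (simp add: algebra_simps)
  then show ?thesis using that i[of y "- ?k"] by blast
qed

lemma periodic_derivative:
  fixes f f' :: "real \<Rightarrow> real"
  assumes per: "\<And>y. f (y + \<epsilon>) = f y" and d: "\<And>y. (f has_real_derivative f' y) (at y)"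
  shows "f' (y + \<epsilon>) = f' y"
proof -
  have "((\<lambda>y. f (y + \<epsilon>)) has_real_derivative f' (y + \<epsilon>)) (at y)"
    using DERIV_shift[of f "f' (y + \<epsilon>)" y \<epsilon>] d by (simp add: add.commute)
  then have "(f has_real_derivative f' (y + \<epsilon>)) (at y)" by (simp add: per)
  then show ?thesis using d DERIV_unique by blast
qed

lemma periodic_derivative_zero:
  fixes f f' :: "real \<Rightarrow> real"
  assumes per: "\<And>y. f (y + \<epsilon>) = f y" and d: "\<And>y. (f has_real_derivative f' y) (at y)" and \<epsilon>: "0 < \<epsilon>"
  obtains z where "z \<in> {0..\<epsilon>}" "f' z = 0"
proof -
  obtain z where "0 < z" "z < \<epsilon>" "f \<epsilon> - f 0 = (\<epsilon> - 0) * f' z"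
    using MVT2[OF \<epsilon>, of f f'] d by blast
  then show ?thesis using per[of 0] \<epsilon> that[of z] by auto
qed

lemma set_integral_lebesgue_abs_le:
  fixes k m :: "real \<Rightarrow> real"
  assumes "set_integrable lebesgue {a..b} k" "set_integrable lebesgue {a..b} m"
    and "AE t in lebesgue. t \<in> {a..b} \<longrightarrow> \<bar>k t\<bar> \<le> m t" and "a \<le> x" "y \<le> b"
  shows "\<bar>LINT t:{x..y}|lebesgue. k t\<bar> \<le> (LINT t:{a..b}|lebesgue. m t)"
proof -
  have k: "set_integrable lebesgue {x..y} k" using assms by (auto intro: set_integrable_subset)
  have "\<bar>LINT t:{x..y}|lebesgue. k t\<bar> \<le> (\<integral>t. \<bar>indicator {x..y} t *\<^sub>R k t\<bar> \<partial>lebesgue)"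
    unfolding set_lebesgue_integral_def by (rule integral_abs_bound)
  also have "\<dots> \<le> (LINT t:{a..b}|lebesgue. m t)"
    unfolding set_lebesgue_integral_def
  proof (rule integral_mono_AE)
    show "AE t in lebesgue. \<bar>indicator {x..y} t *\<^sub>R k t\<bar> \<le> indicat_real {a..b} t *\<^sub>R m t"
      using assms(3) by eventually_elim (use assms(4,5) in \<open>auto simp: indicator_def\<close>)
  qed (use k assms(2) in \<open>auto simp: set_integrable_def\<close>)
  finally show ?thesis .
qed

text \<open>
  The derivative has a zero by Rolle's theorem and \<open>W\<close> has one because its mean vanishes. Integrating twice from these
  zeros over at most one period gives the bound.
\<close>

lemma periodic_mean_zero_sup_bound:
  fixes W W' k :: "real \<Rightarrow> real"
  assumes per: "\<And>z. W (z + 1) = W z" and mean: "(LINT t:{0..1}|lebesgue. W t) = 0"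
    and d: "\<And>z. (W has_real_derivative W' z) (at z)" and P: "bounded_primitive W' k"
  shows "\<bar>W z\<bar> \<le> (LINT t:{0..1}|lebesgue. \<bar>k t\<bar>)"
proof -
  let ?D = "LINT t:{0..1}|lebesgue. \<bar>k t\<bar>"
  have ik: "set_integrable lebesgue {0..1} k" by (rule bounded_primitiveD(2)[OF P]) auto
  have D0: "0 \<le> ?D" unfolding set_lebesgue_integral_def by (intro Bochner_Integration.integral_nonneg) auto
  have inc: "\<bar>W' y - W' x\<bar> \<le> ?D" if "x \<in> {0..1}" "y \<in> {0..1}" for x y
  proof (cases "x \<le> y")
    case True
    then show ?thesis unfolding bounded_primitiveD(3)[OF P True]
      by (intro set_integral_lebesgue_abs_le ik set_integrable_abs[OF ik]) (use that in auto)
  next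
    case False
    then have "y \<le> x" by simp
    then have "\<bar>W' x - W' y\<bar> \<le> ?D" unfolding bounded_primitiveD(3)[OF P \<open>y \<le> x\<close>]
      by (intro set_integral_lebesgue_abs_le ik set_integrable_abs[OF ik]) (use that in auto)
    then show ?thesis by (simp add: abs_minus_commute)
  qed
  obtain z0 where z0: "z0 \<in> {0..1}" "W' z0 = 0" by (rule periodic_derivative_zero[OF per d]) auto
  have W': "\<bar>W' x\<bar> \<le> ?D" if "x \<in> {0..1}" for x using inc[OF z0(1) that] z0(2) by simp
  have cW: "continuous_on S W" for S
    using d by (intro continuous_at_imp_continuous_on ballI) (rule DERIV_isCont)
  have iW: "set_integrable lborel {0..1} W" by (rule borel_integrable_atLeastAtMost'[OF cW])
  have mW: "(LINT t:{0..1}|lborel. W t) = 0"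
    using mean by (subst (asm) set_integral_completion(1)) (auto intro: borel_measurable_continuous_onI cW)
  obtain t1 where t1: "t1 \<in> {0..1}" "W t1 \<le> 0" using exists_le_average[OF _ iW] mW by auto
  have "set_integrable lborel {0..1} (\<lambda>t. - W t)"
    by (intro borel_integrable_atLeastAtMost' continuous_intros cW)
  then obtain t2 where t2: "t2 \<in> {0..1}" "- W t2 \<le> 0"
    using exists_le_average[of 0 1 "\<lambda>t. - W t"] mW set_integral_uminus[OF iW] by auto
  have "connected (W ` {0..1})" by (intro connected_continuous_image cW) auto
  then have "0 \<in> W ` {0..1}"
    using t1 t2 connectedD_interval[of "W ` {0..1}" "W t1" "W t2" 0] by auto
  then obtain y0 where y0: "y0 \<in> {0..1}" "W y0 = 0" by auto
  obtain z' where z': "z' \<in> {0..1}" "W z' = W z" by (rule periodic_reduce[of W 1, OF per]) auto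
  have "norm (W z' - W y0) \<le> ?D * norm (z' - y0)"
    by (rule field_differentiable_bound[of "{0..1}" W W']) (use d W' z' y0 in \<open>auto intro: DERIV_subset\<close>)
  also have "\<dots> \<le> ?D * 1" using D0 z'(1) y0(1) by (intro mult_left_mono) auto
  finally show ?thesis using y0(2) z'(2) by simp
qed

lemma lebesgue_scale_measurable:
  fixes \<epsilon> :: real
  assumes "f \<in> borel_measurable lebesgue" "\<epsilon> \<noteq> 0"
  shows "(\<lambda>z. f (\<epsilon> * z)) \<in> borel_measurable lebesgue"
proof -
  have "(\<lambda>z. \<epsilon> * z) \<in> lebesgue \<rightarrow>\<^sub>M lebesgue"
    using lebesgue_affine_measurable[where c = "\<lambda>x::real. \<epsilon>" and t = 0] assms(2) by simp
  then show ?thesis using assms(1) by (rule measurable_compose)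
qed

lemma set_integral_scale:
  fixes f :: "real \<Rightarrow> real"
  assumes "0 < \<epsilon>"
  shows "(LINT t:{\<epsilon> * x..\<epsilon> * y}|lebesgue. f t) = \<epsilon> * (LINT z:{x..y}|lebesgue. f (\<epsilon> * z))"
proof -
  have "indicat_real {\<epsilon> * x..\<epsilon> * y} (\<epsilon> * z) = indicator {x..y} z" for z
    using assms by (auto simp: indicator_def)
  then show ?thesis
    using lebesgue_integral_real_affine[of \<epsilon> "\<lambda>t. indicator {\<epsilon> * x..\<epsilon> * y} t *\<^sub>R f t" 0] assms
    by (simp add: set_lebesgue_integral_def)
qed

lemma AE_lebesgue_scale':
  fixes \<epsilon> :: real
  assumes "AE y in lebesgue. P y" "\<epsilon> \<noteq> 0"
  shows "AE z in lebesgue. P (\<epsilon> * z)"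
  using AE_lebesgue_scale[OF assms(1), of "1 / \<epsilon>"] assms(2) by (simp add: mult.commute)

lemma bounded_primitive_rescale:
  assumes P: "bounded_primitive P q" and \<epsilon>: "0 < \<epsilon>"
  shows "bounded_primitive (\<lambda>z. P (\<epsilon> * z) / \<epsilon>) (\<lambda>z. q (\<epsilon> * z))"
proof -
  obtain M where "AE x in lebesgue. \<bar>q x\<bar> \<le> M" using P by (auto simp: bounded_primitive_def)
  then have "AE z in lebesgue. \<bar>q (\<epsilon> * z)\<bar> \<le> M" using \<epsilon> by (intro AE_lebesgue_scale') auto
  moreover have "P (\<epsilon> * y) / \<epsilon> - P (\<epsilon> * x) / \<epsilon> = (LINT t:{x..y}|lebesgue. q (\<epsilon> * t))" if "x \<le> y" for x y
    using bounded_primitiveD(3)[OF P, of "\<epsilon> * x" "\<epsilon> * y"] set_integral_scale[OF \<epsilon>, of x y q] that \<epsilon>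
    by (simp add: field_simps)
  ultimately show ?thesis
    using lebesgue_scale_measurable[OF bounded_primitiveD(1)[OF P], of \<epsilon>] \<epsilon> unfolding bounded_primitive_def by auto
qed

text \<open>
  The function is the sine of the angle whose tangent is \<open>r\<close>.
\<close>

lemma slope_sine_derivative:
  "((\<lambda>r::real. r / sqrt (1 + r\<^sup>2)) has_real_derivative 1 / ((1 + r\<^sup>2) * sqrt (1 + r\<^sup>2))) (at r)"
proof -
  have pos: "0 < 1 + r\<^sup>2" by (simp add: add_pos_nonneg)
  define w where "w = sqrt (1 + r\<^sup>2)"
  have w: "w > 0" "w\<^sup>2 = 1 + r\<^sup>2" using pos by (auto simp: w_def)
  have "((\<lambda>r::real. r / sqrt (1 + r\<^sup>2)) has_real_derivative (1 * w - r * (r / w)) / (w * w)) (at r)"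
    unfolding w_def using pos
    by (auto intro!: derivative_eq_intros simp: field_simps)
  also have "(1 * w - r * (r / w)) / (w * w) = 1 / ((1 + r\<^sup>2) * w)"
  proof -
    have "w - r * (r / w) = (w\<^sup>2 - r\<^sup>2) / w" using w(1) by (simp add: field_simps power2_eq_square)
    also have "\<dots> = 1 / w" by (simp add: w(2))
    finally show ?thesis using w by (simp add: field_simps power2_eq_square)
  qed
  finally show ?thesis by (simp add: w_def)
qed

text \<open>
  Here \<open>\<rho> y\<close> is the value of the reaction term on the front. With \<open>F\<close> the sine of the slope angle, \<open>F (p y)\<close> is a primitive
  of \<open>(\<rho> - c \<sigma>) / \<mu>\<close> with \<open>\<sigma> = 1 / sqrt (1 + p\<^sup>2)\<close>. Periodicity makes the integrals of \<open>\<rho>\<close> and \<open>c \<sigma>\<close> over a period equal,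
  so \<open>c\<close> has the sign of \<open>\<rho>\<close> and \<open>F\<close> varies by at most twice the integral of \<open>\<rho>\<close>, divided by \<open>\<mu>\<close>.
\<close>

lemma front_bounds:
  assumes \<mu>: "0 < \<mu>" and \<epsilon>: "0 < \<epsilon>" and RM: "0 < RM"
    and per: "\<And>y. v (y + \<epsilon>) = v y" and v': "\<And>y. (v has_real_derivative p y) (at y)"
    and P: "bounded_primitive p q"
    and \<rho>: "\<rho> \<in> borel_measurable lebesgue" "AE y in lebesgue. 0 < \<rho> y \<and> \<rho> y \<le> RM"
    and eq: "AE y in lebesgue. - c + \<rho> y * sqrt (1 + (p y)\<^sup>2) = \<mu> * (q y / (1 + (p y)\<^sup>2))"
  shows "0 < c" "4 * RM * \<epsilon> \<le> \<mu> \<Longrightarrow> (p y)\<^sup>2 \<le> (4 * RM * \<epsilon> / \<mu>)\<^sup>2" "4 * RM * \<epsilon> \<le> \<mu> \<Longrightarrow> c \<le> 2 * RM"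
proof -
  have cp: "continuous_on S p" for S by (rule bounded_primitive_continuous[OF P])
  have pper: "p (y + \<epsilon>) = p y" for y by (rule periodic_derivative[OF per v'])
  have pos: "0 < 1 + (p y)\<^sup>2" for y by (simp add: add_pos_nonneg)
  define \<sigma> where "\<sigma> y = 1 / sqrt (1 + (p y)\<^sup>2)" for y
  have \<sigma>: "0 < \<sigma> y" "\<sigma> y \<le> 1" for y using pos[of y] by (auto simp: \<sigma>_def)
  have c\<sigma>: "continuous_on S \<sigma>" for S
    unfolding \<sigma>_def using pos by (intro continuous_intros cp) (auto simp: less_imp_neq[symmetric])
  have i\<rho>: "set_integrable lebesgue {x..y} \<rho>" for x y
  proof (rule set_integrable_ess_bounded[OF \<rho>(1)])
    show "AE y in lebesgue. \<bar>\<rho> y\<bar> \<le> RM" using \<rho>(2) by eventually_elim auto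
  qed auto
  have i\<sigma>: "set_integrable lebesgue {x..y} \<sigma>" for x y
    using borel_integrable_atLeastAtMost'[OF c\<sigma>] by (subst set_integral_completion(2)) (auto intro: borel_measurable_continuous_onI c\<sigma>)
  define F where "F r = r / sqrt (1 + r\<^sup>2)" for r :: real
  have chain: "F (p y) - F (p x) = (LINT t:{x..y}|lebesgue. (1 / \<mu>) * (\<rho> t - c * \<sigma> t))" if "x \<le> y" for x y
  proof -
    have "F (p y) - F (p x) = (LINT t:{x..y}|lebesgue. 1 / ((1 + (p t)\<^sup>2) * sqrt (1 + (p t)\<^sup>2)) * q t)"
      unfolding F_def
    proof (rule bounded_primitive_chain_rule[OF P slope_sine_derivative _ that])
      have "0 < 1 + r\<^sup>2" for r :: real by (simp add: add_pos_nonneg)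
      then show "continuous_on UNIV (\<lambda>r::real. 1 / ((1 + r\<^sup>2) * sqrt (1 + r\<^sup>2)))"
        by (intro continuous_intros) (auto simp: less_imp_neq[symmetric])
    qed
    also have "\<dots> = (LINT t:{x..y}|lebesgue. (1 / \<mu>) * (\<rho> t - c * \<sigma> t))"
      unfolding set_lebesgue_integral_def
    proof (rule integral_cong_AE)
      have cw: "continuous_on UNIV (\<lambda>t. 1 / ((1 + (p t)\<^sup>2) * sqrt (1 + (p t)\<^sup>2)))"
        using pos by (intro continuous_intros cp) (auto simp: less_imp_neq[symmetric])
      show "(\<lambda>t. indicat_real {x..y} t *\<^sub>R (1 / ((1 + (p t)\<^sup>2) * sqrt (1 + (p t)\<^sup>2)) * q t)) \<in> borel_measurable lebesgue"
        by (intro borel_measurable_scaleR borel_measurable_indicator borel_measurable_times[OF _ bounded_primitiveD(1)[OF P]]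
          borel_measurable_lebesgueI borel_measurable_continuous_onI[OF cw]) auto
      show "(\<lambda>t. indicat_real {x..y} t *\<^sub>R (1 / \<mu> * (\<rho> t - c * \<sigma> t))) \<in> borel_measurable lebesgue"
        by (intro borel_measurable_scaleR borel_measurable_indicator borel_measurable_times borel_measurable_diff \<rho>(1)
          borel_measurable_lebesgueI[OF borel_measurable_continuous_onI[OF c\<sigma>]]) auto
      show "AE t in lebesgue. indicat_real {x..y} t *\<^sub>R (1 / ((1 + (p t)\<^sup>2) * sqrt (1 + (p t)\<^sup>2)) * q t)
         = indicat_real {x..y} t *\<^sub>R (1 / \<mu> * (\<rho> t - c * \<sigma> t))"
        using eq
      proof eventually_elim
        case (elim t)
        let ?w = "sqrt (1 + (p t)\<^sup>2)"
        have w: "?w > 0" using pos by simp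
        have "1 / ((1 + (p t)\<^sup>2) * ?w) * q t = (\<mu> * (q t / (1 + (p t)\<^sup>2))) / (\<mu> * ?w)"
        proof -
          have "1 / (A * w) * Q = (\<mu> * (Q / A)) / (\<mu> * w)" if "A > 0" "w > 0" for A w Q :: real
            using \<mu> that by (simp add: field_simps)
          then show ?thesis using w pos[of t] by blast
        qed
        also have "\<dots> = (- c + \<rho> t * ?w) / (\<mu> * ?w)" using elim by simp
        also have "\<dots> = 1 / \<mu> * (\<rho> t - c * \<sigma> t)" using \<mu> w by (simp add: \<sigma>_def field_simps)
        finally show ?case by simp
      qed
    qed
    finally show ?thesis .
  qed
  define I where "I = (LINT t:{0..\<epsilon>}|lebesgue. \<rho> t)"
  define J where "J = (LINT t:{0..\<epsilon>}|lebesgue. \<sigma> t)"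
  have IJ: "I = c * J"
  proof -
    have "0 = F (p \<epsilon>) - F (p 0)" using pper[of 0] by simp
    also have "\<dots> = (1 / \<mu>) * (LINT t:{0..\<epsilon>}|lebesgue. \<rho> t - c * \<sigma> t)" using chain[of 0 \<epsilon>] \<epsilon> by simp
    also have "(LINT t:{0..\<epsilon>}|lebesgue. \<rho> t - c * \<sigma> t) = I - c * J"
      using i\<rho> i\<sigma> by (subst set_integral_diff(2)) (auto simp: I_def J_def)
    finally show ?thesis using \<mu> by simp
  qed
  have AEpos: "0 < (LINT t:{0..\<epsilon>}|lebesgue. k t)"
    if k: "set_integrable lebesgue {0..\<epsilon>} k" "AE t in lebesgue. 0 < k t" for k :: "real \<Rightarrow> real"
  proof -
    have nn: "AE t in lebesgue. 0 \<le> indicator {0..\<epsilon>} t *\<^sub>R k t"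
      using k(2) by eventually_elim (auto simp: indicator_def)
    have "0 \<le> (LINT t:{0..\<epsilon>}|lebesgue. k t)" unfolding set_lebesgue_integral_def by (rule integral_nonneg_AE[OF nn])
    moreover have "(LINT t:{0..\<epsilon>}|lebesgue. k t) \<noteq> 0"
    proof
      assume "(LINT t:{0..\<epsilon>}|lebesgue. k t) = 0"
      then have "AE t in lebesgue. indicator {0..\<epsilon>} t *\<^sub>R k t = 0"
        using k(1) integral_nonneg_eq_0_iff_AE[OF _ nn] unfolding set_lebesgue_integral_def set_integrable_def by blast
      then have "AE t in lebesgue. t \<notin> {0..\<epsilon>}" using k(2) by eventually_elim (auto simp: indicator_def)
      then have "{0..\<epsilon>} \<in> null_sets lebesgue" by (subst AE_iff_null_sets) auto
      then show False using \<epsilon> by (auto simp: null_sets_def)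
    qed
    ultimately show ?thesis by simp
  qed
  have I: "0 < I" unfolding I_def by (rule AEpos[OF i\<rho>]) (use \<rho>(2) in \<open>auto elim: eventually_mono\<close>)
  have J: "0 < J" unfolding J_def by (rule AEpos[OF i\<sigma>]) (use \<sigma> in auto)
  show c: "0 < c" using I J IJ by (simp add: zero_less_mult_iff)
  have IRM: "I \<le> RM * \<epsilon>"
  proof -
    have "AE t in lebesgue. t \<in> {0..\<epsilon>} \<longrightarrow> \<bar>\<rho> t\<bar> \<le> RM"
      using \<rho>(2) by eventually_elim auto
    from set_integral_abs_le_const[OF \<rho>(1) this] show ?thesis using \<epsilon> by (simp add: I_def)
  qed
  obtain z where z: "z \<in> {0..\<epsilon>}" "p z = 0" by (rule periodic_derivative_zero[OF per v' \<epsilon>])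
  have osc: "\<bar>F (p y) - F (p x)\<bar> \<le> 2 * RM * \<epsilon> / \<mu>" if "x \<le> y" "0 \<le> x" "y \<le> \<epsilon>" for x y
  proof -
    have "\<bar>F (p y) - F (p x)\<bar> \<le> (LINT t:{0..\<epsilon>}|lebesgue. (1 / \<mu>) * (\<rho> t + c * \<sigma> t))"
      unfolding chain[OF that(1)]
    proof (rule set_integral_lebesgue_abs_le[OF _ _ _ that(2,3)])
      show "AE t in lebesgue. t \<in> {0..\<epsilon>} \<longrightarrow> \<bar>1 / \<mu> * (\<rho> t - c * \<sigma> t)\<bar> \<le> 1 / \<mu> * (\<rho> t + c * \<sigma> t)"
        using \<rho>(2)
      proof eventually_elim
        case (elim t)
        have "0 < c * \<sigma> t" using c \<sigma>(1)[of t] by simp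
        then have "\<bar>\<rho> t - c * \<sigma> t\<bar> \<le> \<rho> t + c * \<sigma> t" using elim by linarith
        then show ?case using \<mu> by (simp add: abs_mult divide_right_mono)
      qed
    qed (intro set_integrable_mult_right set_integral_diff(1) set_integral_add(1) i\<rho> i\<sigma>)+
    also have "\<dots> = (1 / \<mu>) * (I + c * J)"
      using i\<rho> i\<sigma> set_integral_add(2)[OF i\<rho> set_integrable_mult_right[OF i\<sigma>], of 0 \<epsilon> c] by (simp add: I_def J_def)
    also have "\<dots> = 2 * I / \<mu>" using IJ by simp
    also have "\<dots> \<le> 2 * RM * \<epsilon> / \<mu>" using IRM \<mu> by (intro divide_right_mono) auto
    finally show ?thesis .
  qed
  have Fz: "F (p z) = 0" using z by (simp add: F_def)
  have Fy: "\<bar>F (p y)\<bar> \<le> 2 * RM * \<epsilon> / \<mu>" for y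
  proof -
    obtain y' where y': "y' \<in> {0..\<epsilon>}" "p y' = p y" by (rule periodic_reduce[of p \<epsilon>, OF pper \<epsilon>])
    show ?thesis
      using osc[of y' z] osc[of z y'] y' z(1) Fz by (cases "y' \<le> z") auto
  qed
  have p2: "(p y)\<^sup>2 \<le> (4 * RM * \<epsilon> / \<mu>)\<^sup>2" if small: "4 * RM * \<epsilon> \<le> \<mu>" for y
  proof -
    define s where "s = 2 * RM * \<epsilon> / \<mu>"
    have s: "0 \<le> s" "s \<le> 1 / 2" using small \<mu> \<epsilon> RM by (auto simp: s_def field_simps)
    have "(F (p y))\<^sup>2 \<le> s\<^sup>2" using Fy[of y] power_mono[of "\<bar>F (p y)\<bar>" s 2] by (simp add: s_def)
    moreover have "(F (p y))\<^sup>2 = (p y)\<^sup>2 / (1 + (p y)\<^sup>2)"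
      using pos[of y] by (simp add: F_def power_divide)
    ultimately have 1: "(p y)\<^sup>2 \<le> s\<^sup>2 * (1 + (p y)\<^sup>2)" using pos[of y] by (simp add: field_simps)
    have "s\<^sup>2 \<le> (1/2)\<^sup>2" using s by (intro power_mono) auto
    then have "s\<^sup>2 * (p y)\<^sup>2 \<le> 1 / 4 * (p y)\<^sup>2" by (intro mult_right_mono) (auto simp: power_divide)
    then have "(p y)\<^sup>2 \<le> 4 * s\<^sup>2" using 1 zero_le_power2[of s] unfolding distrib_left by linarith
    also have "\<dots> = (4 * RM * \<epsilon> / \<mu>)\<^sup>2" by (simp add: s_def power_divide power_mult_distrib)
    finally show ?thesis .
  qed
  then show "4 * RM * \<epsilon> \<le> \<mu> \<Longrightarrow> (p y)\<^sup>2 \<le> (4 * RM * \<epsilon> / \<mu>)\<^sup>2" .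
  show "c \<le> 2 * RM" if small: "4 * RM * \<epsilon> \<le> \<mu>"
  proof -
    have "1 / 2 \<le> \<sigma> y" for y
    proof -
      have "4 * RM * \<epsilon> / \<mu> \<le> 1" using small \<mu> by simp
      then have "(4 * RM * \<epsilon> / \<mu>)\<^sup>2 \<le> 1" using \<mu> \<epsilon> RM by (intro power_le_one) auto
      then have "1 + (p y)\<^sup>2 \<le> 2\<^sup>2" using p2[OF small, of y] by simp
      then have "sqrt (1 + (p y)\<^sup>2) \<le> 2" by (intro real_le_lsqrt) auto
      then show ?thesis using pos[of y] by (simp add: \<sigma>_def field_simps)
    qed
    moreover have i2: "set_integrable lebesgue {0..\<epsilon>} (\<lambda>_. 1 / 2 :: real)"
      by (rule set_integrable_ess_bounded[of _ "1/2"]) auto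
    ultimately have "(LINT t:{0..\<epsilon>}|lebesgue. 1 / 2) \<le> J"
      unfolding J_def by (intro set_integral_mono i\<sigma>) auto
    moreover have "(LINT t:{0..\<epsilon>}|lebesgue. 1 / 2 :: real) = \<epsilon> / 2" using \<epsilon> by (simp add: set_lebesgue_integral_def)
    ultimately have "c * (\<epsilon> / 2) \<le> RM * \<epsilon>" using IJ IRM c mult_left_mono[of "\<epsilon> / 2" J c] by linarith
    then show ?thesis using \<epsilon> by simp
  qed
qed

section \<open>The limit profile\<close>

lemma bounded_primitive_has_weak_gradient:
  assumes P: "bounded_primitive P q"
  shows "has_weak_gradient_on P q UNIV"
  unfolding has_weak_gradient_on_def
proof (intro conjI allI impI)
  obtain M where M: "AE x in lebesgue. \<bar>q x\<bar> \<le> M" using P by (auto simp: bounded_primitive_def)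
  show "loc_integrable_on P UNIV" by (intro loc_integrable_on_continuous bounded_primitive_continuous[OF P])
  show "loc_integrable_on q UNIV"
    unfolding loc_integrable_on_def
    using set_integrable_ess_bounded[OF bounded_primitiveD(1)[OF P] M] lmeasurable_compact by blast
next
  fix \<phi> D :: "real \<Rightarrow> real"
  assume "C1_gradient \<phi> D \<and> (\<exists>K. compact K \<and> K \<subseteq> UNIV \<and> (\<forall>z. z \<notin> K \<longrightarrow> \<phi> z = 0))"
  then obtain K where "C1_gradient \<phi> D" "compact K" "\<And>z. z \<notin> K \<Longrightarrow> \<phi> z = 0" by blast
  then show "(LINT z:UNIV|lebesgue. P z *\<^sub>R D z) = - (LINT z:UNIV|lebesgue. \<phi> z *\<^sub>R q z)"
    by (rule bounded_primitive_weak_gradient_test[OF P])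
qed

lemma set_integral_shift:
  fixes f :: "real \<Rightarrow> real"
  shows "(LINT t:{x + a..y + a}|lebesgue. f t) = (LINT t:{x..y}|lebesgue. f (t + a))"
proof -
  have "indicat_real {x + a..y + a} (a + 1 * t) = indicator {x..y} t" for t by (auto simp: indicator_def)
  then show ?thesis
    using lebesgue_integral_real_affine[of 1 "\<lambda>t. indicator {x + a..y + a} t *\<^sub>R f t" a]
    by (simp add: set_lebesgue_integral_def add.commute)
qed

text \<open>
  Shifting by a period does not change the increments of \<open>P\<close>.
\<close>

lemma periodic_bounded_primitive:
  assumes P: "bounded_primitive P q" and per: "\<And>z. q (z + 1) = q z" and mean: "(LINT t:{0..1}|lebesgue. q t) = 0"
  shows "P (z + 1) = P z"
proof -
  have *: "P (y + 1) - P (x + 1) = P y - P x" if "x \<le> y" for x y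
    using bounded_primitiveD(3)[OF P, of "x + 1" "y + 1"] bounded_primitiveD(3)[OF P that] that
    by (simp add: set_integral_shift per)
  have "P (0 + 1) - P 0 = 0" using bounded_primitiveD(3)[OF P, of 0 1] mean by simp
  then show ?thesis using *[of 0 z] *[of z 0] by (cases "0 \<le> z") auto
qed

lemma continuous_periodic_bounded:
  fixes f :: "real \<Rightarrow> real"
  assumes c: "continuous_on UNIV f" and per: "\<And>z. f (z + \<epsilon>) = f z" and \<epsilon>: "0 < \<epsilon>"
  obtains M where "\<And>z. \<bar>f z\<bar> \<le> M"
proof -
  have "bounded (f ` {0..\<epsilon>})"
    using compact_continuous_image[OF continuous_on_subset[OF c] compact_Icc] compact_imp_bounded by auto
  then obtain M where M: "\<And>x. x \<in> {0..\<epsilon>} \<Longrightarrow> \<bar>f x\<bar> \<le> M" unfolding bounded_iff by force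
  have "\<bar>f z\<bar> \<le> M" for z
  proof -
    obtain z' where "z' \<in> {0..\<epsilon>}" "f z' = f z" by (rule periodic_reduce[of f \<epsilon>, OF per \<epsilon>])
    then show ?thesis using M[of z'] by simp
  qed
  then show ?thesis by (rule that)
qed

lemma continuous_set_integrable_lebesgue:
  fixes f :: "real \<Rightarrow> real"
  assumes "continuous_on UNIV f"
  shows "set_integrable lebesgue {a..b} f"
  using set_integrable_continuous_times_ess_bounded[of "\<lambda>_. 1" 1 a b f] continuous_on_subset[OF assms] by auto

lemma periodic_primitive_mean_zero:
  assumes q: "q \<in> borel_measurable lebesgue" "AE x in lebesgue. \<bar>q x\<bar> \<le> M"
    and per: "\<And>z. q (z + 1) = q z" and mean: "(LINT t:{0..1}|lebesgue. q t) = 0"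
  obtains P where "bounded_primitive P q" "\<And>z. P (z + 1) = P z" "(LINT t:{0..1}|lebesgue. P t) = 0"
proof -
  obtain P0 where P0: "bounded_primitive P0 q" using bounded_primitive_exists[OF q] by blast
  define k where "k = (LINT t:{0..1}|lebesgue. P0 t)"
  have "bounded_primitive (\<lambda>z. P0 z - k) q" using P0 by (auto simp: bounded_primitive_def)
  moreover have "P0 (z + 1) - k = P0 z - k" for z using periodic_bounded_primitive[OF P0 per mean] by simp
  moreover have "(LINT t:{0..1}|lebesgue. P0 t - k) = 0"
  proof -
    have "(LINT t:{0..1}|lebesgue. P0 t - k) = (LINT t:{0..1}|lebesgue. P0 t) - (LINT t:{0..1::real}|lebesgue. k)"
      by (intro set_integral_diff(2) continuous_set_integrable_lebesgue bounded_primitive_continuous[OF P0]) auto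
    also have "(LINT t:{0..1::real}|lebesgue. k) = k" by (simp add: set_lebesgue_integral_def)
    finally show ?thesis by (simp add: k_def)
  qed
  ultimately show ?thesis by (rule that)
qed

text \<open>
  The mean zero primitive is taken twice.
\<close>

lemma periodic_profile_exists:
  assumes r: "r \<in> borel_measurable lebesgue" "AE x in lebesgue. \<bar>r x\<bar> \<le> M"
    and per: "\<And>z. r (z + 1) = r z" and mean: "(LINT t:{0..1}|lebesgue. r t) = 0"
  shows "\<exists>Q Qz. W2inf Q Qz r \<and> (\<forall>z. Q (z + 1) = Q z) \<and> (LINT t:{0..1}|lebesgue. Q t) = 0"
proof -
  obtain P where P: "bounded_primitive P r" "\<And>z. P (z + 1) = P z" "(LINT t:{0..1}|lebesgue. P t) = 0"
    using periodic_primitive_mean_zero[OF r per mean] by blast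
  have cP: "continuous_on UNIV P" by (rule bounded_primitive_continuous[OF P(1)])
  obtain MP where MP: "\<And>z. \<bar>P z\<bar> \<le> MP" using continuous_periodic_bounded[OF cP P(2) zero_less_one] by blast
  have mP: "P \<in> borel_measurable lebesgue" by (intro borel_measurable_lebesgueI borel_measurable_continuous_onI cP)
  obtain Q where Q: "bounded_primitive Q P" "\<And>z. Q (z + 1) = Q z" "(LINT t:{0..1}|lebesgue. Q t) = 0"
    using periodic_primitive_mean_zero[OF mP _ P(2,3), of MP] MP by auto
  have cQ: "continuous_on UNIV Q" by (rule bounded_primitive_continuous[OF Q(1)])
  obtain MQ where MQ: "\<And>z. \<bar>Q z\<bar> \<le> MQ" using continuous_periodic_bounded[OF cQ Q(2) zero_less_one] by blast
  have mQ: "Q \<in> borel_measurable lebesgue" by (intro borel_measurable_lebesgueI borel_measurable_continuous_onI cQ)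
  have "W2inf Q P r"
    unfolding W2inf_def
    using LinfI[OF mQ, of MQ] LinfI[OF mP, of MP] LinfI[OF r] MP MQ cQ
      bounded_primitive_has_weak_gradient[OF Q(1)] bounded_primitive_has_weak_gradient[OF P(1)] by auto
  then show ?thesis using Q by blast
qed

text \<open>
  The difference of two profiles has second derivative zero, so the sup bound above gives zero.
\<close>

lemma periodic_profile_unique:
  assumes Q1: "W2inf Q1 P1 r" "\<And>z. Q1 (z + 1) = Q1 z" "(LINT t:{0..1}|lebesgue. Q1 t) = 0"
    and Q2: "W2inf Q2 P2 r" "\<And>z. Q2 (z + 1) = Q2 z" "(LINT t:{0..1}|lebesgue. Q2 t) = 0"
  shows "Q1 = Q2"
proof
  fix z
  obtain D1 where D1: "bounded_primitive D1 r" "\<And>x. (Q1 has_real_derivative D1 x) (at x)"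
    using W2inf_regularity[OF Q1(1)] by blast
  obtain D2 where D2: "bounded_primitive D2 r" "\<And>x. (Q2 has_real_derivative D2 x) (at x)"
    using W2inf_regularity[OF Q2(1)] by blast
  have c: "continuous_on UNIV Q1" "continuous_on UNIV Q2" using Q1(1) Q2(1) by (auto simp: W2inf_def)
  have "\<bar>Q1 z - Q2 z\<bar> \<le> (LINT t:{0..1}|lebesgue. \<bar>r t + (-1) * r t\<bar>)"
  proof (rule periodic_mean_zero_sup_bound[where W = "\<lambda>z. Q1 z - Q2 z"])
    show "bounded_primitive (\<lambda>x. D1 x + (-1) * D2 x) (\<lambda>t. r t + (-1) * r t)"
      by (intro bounded_primitive_add bounded_primitive_scale D1 D2)
    show "((\<lambda>z. Q1 z - Q2 z) has_real_derivative D1 z + (-1) * D2 z) (at z)" for z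
      using DERIV_diff[OF D1(2) D2(2)] by simp
    show "(LINT t:{0..1}|lebesgue. Q1 t - Q2 t) = 0"
      using Q1(3) Q2(3) continuous_set_integrable_lebesgue[OF c(1)] continuous_set_integrable_lebesgue[OF c(2)]
      by (subst set_integral_diff(2)) auto
  qed (use Q1 Q2 in auto)
  then show "Q1 z = Q2 z" by (simp add: set_lebesgue_integral_def)
qed

text \<open>
  Here \<open>x\<close> stands for the square of the slope.
\<close>

lemma curvature_linearization:
  fixes x :: real
  assumes x: "0 \<le> x" "x \<le> X" "x \<le> 1" and \<rho>: "0 < \<rho>" "\<rho> \<le> RM" and c: "0 < c" "c \<le> 2 * RM"
    and eq: "- c + \<rho> * sqrt (1 + x) = \<mu> * (q / (1 + x))"
  shows "\<bar>\<mu> * q - (\<rho> - c)\<bar> \<le> 3 * RM * X"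
proof -
  define w where "w = sqrt (1 + x)"
  have w1: "1 \<le> w" using x by (simp add: w_def)
  have w2: "w \<le> 1 + x"
  proof -
    have "1 + x \<le> (1 + x)\<^sup>2" using x by (simp add: power2_eq_square algebra_simps)
    then show ?thesis unfolding w_def using x by (intro real_le_lsqrt) auto
  qed
  have "\<mu> * q = (1 + x) * (- c + \<rho> * w)"
    using eq x by (simp add: w_def field_simps)
  then have d: "\<mu> * q - (\<rho> - c) = \<rho> * ((1 + x) * w - 1) - c * x" by (simp add: algebra_simps)
  have a0: "0 \<le> (1 + x) * w - 1" using mult_mono[of 1 "1 + x" 1 w] w1 x by simp
  have "(1 + x) * w \<le> (1 + x) * (1 + x)" using w2 x by (intro mult_left_mono) auto
  also have "\<dots> \<le> 1 + 3 * x" using x mult_left_mono[of x 1 x] by (simp add: algebra_simps)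
  finally have a1: "(1 + x) * w - 1 \<le> 3 * x" by simp
  have "\<rho> * ((1 + x) * w - 1) \<le> RM * (3 * x)" using a0 a1 \<rho> by (intro mult_mono) auto
  moreover have "0 \<le> \<rho> * ((1 + x) * w - 1)" using a0 \<rho> by simp
  moreover have "c * x \<le> 2 * RM * x" "0 \<le> c * x" using c x by (auto intro: mult_right_mono)
  moreover have "RM * x \<le> RM * X" "0 \<le> RM * x" using x \<rho> by (auto intro: mult_left_mono)
  ultimately show ?thesis unfolding d by linarith
qed

lemma set_integral_const_unit: "(LINT t:{0..1::real}|lebesgue. (k :: real)) = k"
  by (simp add: set_lebesgue_integral_def)

text \<open>
  The second derivative of \<open>v(\<epsilon> z) / \<epsilon>\<^sup>2\<close> is, up to the linearization error, \<open>(\<rho> - c) / \<mu>\<close>, and that of \<open>Q\<close> is \<open>R0\<close> minus its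
  mean, divided by \<open>\<mu>\<close>. The speed \<open>c\<close> is close to the mean of \<open>R0\<close> because the second derivative has mean zero, so the
  distance is governed by the distance of \<open>\<rho>\<close> to \<open>R0\<close> alone.
\<close>

lemma front_profile_distance:
  assumes \<mu>: "0 < \<mu>" and \<epsilon>: "0 < \<epsilon>" and RM: "0 < RM" and small: "4 * RM * \<epsilon> \<le> \<mu>"
    and per: "\<And>y. v (y + \<epsilon>) = v y" and v': "\<And>y. (v has_real_derivative p y) (at y)"
    and P: "bounded_primitive p q" and v0: "(LINT y:{0..\<epsilon>}|lebesgue. v y) = 0"
    and \<rho>: "\<rho> \<in> borel_measurable lebesgue" "AE y in lebesgue. 0 < \<rho> y \<and> \<rho> y \<le> RM"
    and eq: "AE y in lebesgue. - c + \<rho> y * sqrt (1 + (p y)\<^sup>2) = \<mu> * (q y / (1 + (p y)\<^sup>2))"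
    and R0: "R0 \<in> borel_measurable lebesgue" "AE t in lebesgue. \<bar>R0 t\<bar> \<le> RM"
    and Q: "\<And>z. Q (z + 1) = Q z" "(LINT t:{0..1}|lebesgue. Q t) = 0" "\<And>z. (Q has_real_derivative D z) (at z)"
    and DQ: "bounded_primitive D (\<lambda>z. 1 / \<mu> * (R0 z - (LINT t:{0..1}|lebesgue. R0 t)))"
  shows "\<bar>v y - \<epsilon>\<^sup>2 * Q (y / \<epsilon>)\<bar>
    \<le> \<epsilon>\<^sup>2 * (1 / \<mu> * (6 * RM * (4 * RM * \<epsilon> / \<mu>)\<^sup>2 + 2 * (LINT t:{0..1}|lebesgue. \<bar>\<rho> (\<epsilon> * t) - R0 t\<bar>)))"
proof -
  note fb = front_bounds[OF \<mu> \<epsilon> RM per v' P \<rho> eq]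
  define X where "X = (4 * RM * \<epsilon> / \<mu>)\<^sup>2"
  have X1: "X \<le> 1" unfolding X_def using small \<mu> \<epsilon> RM by (intro power_le_one) auto
  define e where "e = 3 * RM * X"
  define \<eta> where "\<eta> = (LINT t:{0..1}|lebesgue. \<bar>\<rho> (\<epsilon> * t) - R0 t\<bar>)"
  define Rb where "Rb = (LINT t:{0..1}|lebesgue. R0 t)"
  have v_cont: "continuous_on UNIV v"
    using v' by (intro continuous_at_imp_continuous_on ballI) (rule DERIV_isCont)
  have Q_cont: "continuous_on UNIV Q"
    using Q(3) by (intro continuous_at_imp_continuous_on ballI) (rule DERIV_isCont)
  have P': "bounded_primitive (\<lambda>z. p (\<epsilon> * z) / \<epsilon>) (\<lambda>z. q (\<epsilon> * z))" by (rule bounded_primitive_rescale[OF P \<epsilon>])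
  define k where "k t = q (\<epsilon> * t) + (-1) * (1 / \<mu> * (R0 t - Rb))" for t
  have bk: "bounded_primitive (\<lambda>z. p (\<epsilon> * z) / \<epsilon> + (-1) * D z) k"
    unfolding k_def Rb_def by (intro bounded_primitive_add bounded_primitive_scale P' DQ)
  have sup: "\<bar>v (\<epsilon> * z) / \<epsilon>\<^sup>2 - Q z\<bar> \<le> (LINT t:{0..1}|lebesgue. \<bar>k t\<bar>)" for z
  proof (rule periodic_mean_zero_sup_bound[where W = "\<lambda>z. v (\<epsilon> * z) / \<epsilon>\<^sup>2 - Q z", OF _ _ _ bk])
    show "v (\<epsilon> * (z + 1)) / \<epsilon>\<^sup>2 - Q (z + 1) = v (\<epsilon> * z) / \<epsilon>\<^sup>2 - Q z" for z
      using per[of "\<epsilon> * z"] Q(1)[of z] by (simp add: algebra_simps)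
    show "((\<lambda>z. v (\<epsilon> * z) / \<epsilon>\<^sup>2 - Q z) has_real_derivative p (\<epsilon> * z) / \<epsilon> + (-1) * D z) (at z)" for z
    proof -
      have "((\<lambda>z. v (\<epsilon> * z)) has_real_derivative p (\<epsilon> * z) * \<epsilon>) (at z)"
        by (rule DERIV_chain2[OF v']) (auto intro!: derivative_eq_intros)
      from DERIV_diff[OF DERIV_cdivide[OF this, of "\<epsilon>\<^sup>2"] Q(3)[of z]]
      show ?thesis using \<epsilon> by (simp add: power2_eq_square)
    qed
    have "(LINT t:{0..1}|lebesgue. v (\<epsilon> * t)) = 0"
      using set_integral_scale[OF \<epsilon>, of 0 1 v] v0 \<epsilon> by simp
    moreover have "set_integrable lebesgue {0..1} (\<lambda>t. v (\<epsilon> * t) / \<epsilon>\<^sup>2)"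
      using \<epsilon> by (intro continuous_set_integrable_lebesgue continuous_intros continuous_on_compose2[OF v_cont]) auto
    ultimately show "(LINT t:{0..1}|lebesgue. v (\<epsilon> * t) / \<epsilon>\<^sup>2 - Q t) = 0"
      using Q(2) continuous_set_integrable_lebesgue[OF Q_cont] by (subst set_integral_diff(2)) auto
  qed
  have \<rho>'m: "(\<lambda>t. \<rho> (\<epsilon> * t)) \<in> borel_measurable lebesgue" using \<epsilon> by (intro lebesgue_scale_measurable \<rho>) auto
  have \<rho>'b: "AE t in lebesgue. 0 < \<rho> (\<epsilon> * t) \<and> \<rho> (\<epsilon> * t) \<le> RM" using \<epsilon> by (intro AE_lebesgue_scale'[OF \<rho>(2)]) auto
  have i\<rho>: "set_integrable lebesgue {0..1} (\<lambda>t. \<rho> (\<epsilon> * t))"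
  proof (rule set_integrable_ess_bounded[OF \<rho>'m])
    show "AE t in lebesgue. \<bar>\<rho> (\<epsilon> * t)\<bar> \<le> RM" using \<rho>'b by eventually_elim auto
  qed auto
  have iR: "set_integrable lebesgue {0..1} R0" by (rule set_integrable_ess_bounded[OF R0]) auto
  have iq: "set_integrable lebesgue {0..1} (\<lambda>t. q (\<epsilon> * t))" by (rule bounded_primitiveD(2)[OF P']) auto
  have ik: "set_integrable lebesgue {0..1} k" by (rule bounded_primitiveD(2)[OF bk]) auto
  have ic: "set_integrable lebesgue {0..1::real} (\<lambda>_. s :: real)" for s
    by (rule continuous_set_integrable_lebesgue) auto
  define d where "d t = \<mu> * q (\<epsilon> * t) - (\<rho> (\<epsilon> * t) - c)" for t
  have id: "set_integrable lebesgue {0..1} d"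
    unfolding d_def by (intro set_integral_diff(1) set_integrable_mult_right iq i\<rho> ic)
  have d: "AE t in lebesgue. \<bar>d t\<bar> \<le> e"
    using AE_lebesgue_scale'[OF eq less_imp_neq[OF \<epsilon>, symmetric]] \<rho>'b
  proof eventually_elim
    case (elim t)
    have x: "(p (\<epsilon> * t))\<^sup>2 \<le> X" using fb(2)[OF small] by (simp add: X_def)
    show ?case unfolding d_def e_def
      by (rule curvature_linearization[OF _ x _ _ _ fb(1) fb(3)[OF small]]) (use elim x X1 in auto)
  qed
  have e0: "0 \<le> e" using RM by (simp add: e_def X_def)
  \<comment> \<open>The slope is periodic, so the mean of the second derivative vanishes, which determines the speed.\<close>
  have q0: "(LINT t:{0..1}|lebesgue. q (\<epsilon> * t)) = 0"
    using bounded_primitiveD(3)[OF P', of 0 1] periodic_derivative[OF per v', of 0] by simp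
  have speed: "\<bar>c - Rb\<bar> \<le> e + \<eta>"
  proof -
    have "(LINT t:{0..1}|lebesgue. d t) = \<mu> * (LINT t:{0..1}|lebesgue. q (\<epsilon> * t)) - ((LINT t:{0..1}|lebesgue. \<rho> (\<epsilon> * t)) - c)"
      unfolding d_def using iq i\<rho> ic[of c] set_integral_const_unit[of c]
      by (subst set_integral_diff(2) | auto intro!: set_integral_diff(1))+
    then have "c = (LINT t:{0..1}|lebesgue. \<rho> (\<epsilon> * t)) + (LINT t:{0..1}|lebesgue. d t)" using q0 by simp
    moreover have "(LINT t:{0..1}|lebesgue. \<rho> (\<epsilon> * t)) - Rb = (LINT t:{0..1}|lebesgue. \<rho> (\<epsilon> * t) - R0 t)"
      unfolding Rb_def by (rule set_integral_diff(2)[symmetric, OF i\<rho> iR])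
    moreover have "\<bar>LINT t:{0..1}|lebesgue. \<rho> (\<epsilon> * t) - R0 t\<bar> \<le> \<eta>"
      unfolding \<eta>_def by (intro set_integral_lebesgue_abs_le set_integrable_abs set_integral_diff(1) i\<rho> iR) auto
    moreover have "\<bar>LINT t:{0..1}|lebesgue. d t\<bar> \<le> (LINT t:{0..1::real}|lebesgue. e)"
      by (intro set_integral_lebesgue_abs_le id ic) (use d in \<open>auto elim!: eventually_mono\<close>)
    ultimately show ?thesis unfolding set_integral_const_unit by linarith
  qed
  have "(LINT t:{0..1}|lebesgue. \<bar>k t\<bar>) \<le> (LINT t:{0..1}|lebesgue. 1 / \<mu> * (\<bar>\<rho> (\<epsilon> * t) - R0 t\<bar> + (2 * e + \<eta>)))"
    unfolding set_lebesgue_integral_def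
  proof (rule integral_mono_AE)
    show "integrable lebesgue (\<lambda>t. indicat_real {0..1} t *\<^sub>R \<bar>k t\<bar>)"
      using set_integrable_abs[OF ik] by (simp add: set_integrable_def)
    show "integrable lebesgue (\<lambda>t. indicat_real {0..1} t *\<^sub>R (1 / \<mu> * (\<bar>\<rho> (\<epsilon> * t) - R0 t\<bar> + (2 * e + \<eta>))))"
      unfolding set_integrable_def[symmetric]
      by (intro set_integrable_mult_right set_integral_add(1) set_integrable_abs set_integral_diff(1) i\<rho> iR ic)
    show "AE t in lebesgue. indicat_real {0..1} t *\<^sub>R \<bar>k t\<bar> \<le> indicat_real {0..1} t *\<^sub>R (1 / \<mu> * (\<bar>\<rho> (\<epsilon> * t) - R0 t\<bar> + (2 * e + \<eta>)))"
      using d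
    proof eventually_elim
      case (elim t)
      have "\<mu> * k t = d t + (\<rho> (\<epsilon> * t) - R0 t) - (c - Rb)"
        using \<mu> by (simp add: k_def d_def field_simps)
      then have "\<bar>\<mu> * k t\<bar> \<le> \<bar>\<rho> (\<epsilon> * t) - R0 t\<bar> + (2 * e + \<eta>)" using elim speed by linarith
      then have "\<bar>k t\<bar> \<le> 1 / \<mu> * (\<bar>\<rho> (\<epsilon> * t) - R0 t\<bar> + (2 * e + \<eta>))"
        using \<mu> by (simp add: abs_mult field_simps)
      then show ?case by (intro scaleR_left_mono) auto
    qed
  qed
  also have "\<dots> = 1 / \<mu> * (\<eta> + (2 * e + \<eta>))"
    using set_integral_add(2)[OF set_integrable_abs[OF set_integral_diff(1)[OF i\<rho> iR]] ic[of "2 * e + \<eta>"]]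
      set_integral_const_unit[of "2 * e + \<eta>"] by (simp add: \<eta>_def)
  also have "\<dots> = 1 / \<mu> * (6 * RM * X + 2 * \<eta>)" by (simp add: e_def)
  finally have D: "(LINT t:{0..1}|lebesgue. \<bar>k t\<bar>) \<le> 1 / \<mu> * (6 * RM * X + 2 * \<eta>)" .
  have "v y - \<epsilon>\<^sup>2 * Q (y / \<epsilon>) = \<epsilon>\<^sup>2 * (v (\<epsilon> * (y / \<epsilon>)) / \<epsilon>\<^sup>2 - Q (y / \<epsilon>))"
    using \<epsilon> by (simp add: field_simps)
  then have "\<bar>v y - \<epsilon>\<^sup>2 * Q (y / \<epsilon>)\<bar> = \<epsilon>\<^sup>2 * \<bar>v (\<epsilon> * (y / \<epsilon>)) / \<epsilon>\<^sup>2 - Q (y / \<epsilon>)\<bar>" by (simp add: abs_mult)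
  also have "\<dots> \<le> \<epsilon>\<^sup>2 * (1 / \<mu> * (6 * RM * X + 2 * \<eta>))"
    by (intro mult_left_mono order_trans[OF sup D]) auto
  finally show ?thesis by (simp only: X_def \<eta>_def)
qed

section \<open>Convergence of the nonlinearity\<close>

text \<open>
  Lebesgue measure is complete, so both functions are measurable or neither is.
\<close>

lemma integral_lebesgue_cong_AE:
  fixes f g :: "'a::euclidean_space \<Rightarrow> real"
  assumes ae: "AE x in lebesgue. f x = g x"
  shows "integral\<^sup>L lebesgue f = integral\<^sup>L lebesgue g"
proof (cases "f \<in> borel_measurable lebesgue")
  case True
  then show ?thesis using borel_measurable_AE[OF True ae] ae by (intro integral_cong_AE) auto
next
  case False
  have "g \<notin> borel_measurable lebesgue"
  proof
    assume "g \<in> borel_measurable lebesgue"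
    then have "f \<in> borel_measurable lebesgue"
      by (rule borel_measurable_AE) (use ae in \<open>auto elim!: eventually_mono\<close>)
    then show False using False by simp
  qed
  then have "\<not> integrable lebesgue f" "\<not> integrable lebesgue g" using False by auto
  then show ?thesis by (simp add: not_integrable_integral_eq)
qed

lemma set_integral_lebesgue_cong_AE:
  fixes f g :: "'a::euclidean_space \<Rightarrow> real"
  assumes "AE x in lebesgue. x \<in> S \<longrightarrow> f x = g x"
  shows "(LINT x:S|lebesgue. f x) = (LINT x:S|lebesgue. g x)"
  unfolding set_lebesgue_integral_def
  by (rule integral_lebesgue_cong_AE) (use assms in \<open>auto elim!: eventually_mono simp: indicator_def\<close>)

lemma set_integral_open_interval:
  fixes f :: "real \<Rightarrow> real"
  shows "(LINT t:{a<..<b}|lebesgue. f t) = (LINT t:{a..b}|lebesgue. f t)"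
  unfolding set_lebesgue_integral_def
proof (rule integral_lebesgue_cong_AE)
  show "AE t in lebesgue. indicat_real {a<..<b} t *\<^sub>R f t = indicat_real {a..b} t *\<^sub>R f t"
    using AE_completion[OF AE_lborel_singleton[of a]] AE_completion[OF AE_lborel_singleton[of b]]
    by eventually_elim (auto simp: indicator_def)
qed

text \<open>
  Where \<open>\<tau>\<close> is within \<open>d\<close> of \<open>T\<close>, monotonicity traps both values of \<open>R\<close> between those at \<open>T - d\<close> and \<open>T + d\<close>; elsewhere their
  difference is at most \<open>RM\<close>, and there \<open>(\<tau> - T)\<^sup>2 / d\<^sup>2\<close> is at least one. The sum of the two bounds holds everywhere.
\<close>

lemma nonlinearity_distance:
  fixes R :: "real \<Rightarrow> real \<Rightarrow> real" and T d \<epsilon> RM :: real and \<tau> \<rho> :: "real \<Rightarrow> real"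
  assumes mono: "AE t in lebesgue. mono_on {0<..} (R t)"
    and RM: "AE t in lebesgue. \<forall>T>0. R t T \<le> RM \<and> R t T > 0"
    and m: "\<And>T. T > 0 \<Longrightarrow> (\<lambda>t. R t T) \<in> borel_measurable lebesgue"
    and T: "0 < d" "d < T" and \<epsilon>: "0 < \<epsilon>" and \<tau>: "\<tau> \<in> borel_measurable lebesgue"
    and \<rho>: "\<rho> \<in> borel_measurable lebesgue" "AE y in lebesgue. 0 < \<tau> y \<and> \<rho> y = R (y / \<epsilon>) (\<tau> y)"
    and i\<tau>: "set_integrable lebesgue {0<..<\<epsilon>} (\<lambda>y. (\<tau> y - T)\<^sup>2)"
  shows "(LINT t:{0..1}|lebesgue. \<bar>\<rho> (\<epsilon> * t) - R t T\<bar>)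
    \<le> (LINT t:{0..1}|lebesgue. R t (T + d) - R t (T - d)) + RM / d\<^sup>2 * ((LINT y:{0<..<\<epsilon>}|lebesgue. (\<tau> y - T)\<^sup>2) / \<epsilon>)"
proof -
  define h where "h y = indicat_real {0<..<\<epsilon>} y *\<^sub>R (\<tau> y - T)\<^sup>2" for y
  have ih: "integrable lebesgue (\<lambda>t. h (\<epsilon> * t))"
  proof -
    have "integrable lebesgue h" unfolding h_def using i\<tau> by (simp only: set_integrable_def)
    then show ?thesis using lebesgue_integrable_real_affine[of h \<epsilon> 0] \<epsilon> by simp
  qed
  have Ih: "(\<integral>t. h (\<epsilon> * t) \<partial>lebesgue) = (LINT y:{0<..<\<epsilon>}|lebesgue. (\<tau> y - T)\<^sup>2) / \<epsilon>"
    using lebesgue_integral_real_affine[of \<epsilon> h 0] \<epsilon> by (simp add: h_def set_lebesgue_integral_def)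
  have RM0: "0 < RM"
  proof -
    have "AE t::real in lebesgue. 0 < RM"
      using RM
    proof eventually_elim
      case (elim t)
      from elim[rule_format, of 1] show ?case by simp
    qed
    then have "\<exists>t::real. 0 < RM" by (rule eventually_happens'[rotated]) (simp add: ae_filter_eq_bot_iff)
    then show ?thesis by simp
  qed
  have iR: "set_integrable lebesgue {0..1} (\<lambda>t. R t S)" if "0 < S" for S
  proof (rule set_integrable_ess_bounded[OF m[OF that]])
    show "AE t in lebesgue. \<bar>R t S\<bar> \<le> RM"
      using RM
    proof eventually_elim
      case (elim t)
      from elim[rule_format, OF that] show ?case by simp
    qed
  qed auto
  have \<rho>': "AE t in lebesgue. 0 < \<tau> (\<epsilon> * t) \<and> \<rho> (\<epsilon> * t) = R t (\<tau> (\<epsilon> * t))"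
    using AE_lebesgue_scale'[OF \<rho>(2) less_imp_neq[OF \<epsilon>, symmetric]] \<epsilon> by simp
  have i\<rho>: "set_integrable lebesgue {0..1} (\<lambda>t. \<rho> (\<epsilon> * t))"
  proof (rule set_integrable_ess_bounded)
    show "(\<lambda>t. \<rho> (\<epsilon> * t)) \<in> borel_measurable lebesgue" using \<epsilon> by (intro lebesgue_scale_measurable \<rho>) auto
    show "AE t in lebesgue. \<bar>\<rho> (\<epsilon> * t)\<bar> \<le> RM"
      using \<rho>' RM
    proof eventually_elim
      case (elim t)
      from elim(1) elim(2)[rule_format, OF conjunct1[OF elim(1)]] show ?case by simp
    qed
  qed auto
  have i2: "set_integrable lebesgue {0..1} (\<lambda>t. R t (T + d) - R t (T - d))"
    using T by (intro set_integral_diff(1) iR) auto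
  have "(LINT t:{0..1}|lebesgue. \<bar>\<rho> (\<epsilon> * t) - R t T\<bar>)
     \<le> (\<integral>t. indicator {0..1} t *\<^sub>R (R t (T + d) - R t (T - d)) + RM / d\<^sup>2 * h (\<epsilon> * t) \<partial>lebesgue)"
    unfolding set_lebesgue_integral_def
  proof (rule integral_mono_AE)
    show "integrable lebesgue (\<lambda>t. indicat_real {0..1} t *\<^sub>R \<bar>\<rho> (\<epsilon> * t) - R t T\<bar>)"
      unfolding set_integrable_def[symmetric] using T by (intro set_integrable_abs set_integral_diff(1) i\<rho> iR) auto
    show "integrable lebesgue (\<lambda>t. indicat_real {0..1} t *\<^sub>R (R t (T + d) - R t (T - d)) + RM / d\<^sup>2 * h (\<epsilon> * t))"
      using i2 ih by (simp add: set_integrable_def)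
    show "AE t in lebesgue. indicat_real {0..1} t *\<^sub>R \<bar>\<rho> (\<epsilon> * t) - R t T\<bar>
      \<le> indicat_real {0..1} t *\<^sub>R (R t (T + d) - R t (T - d)) + RM / d\<^sup>2 * h (\<epsilon> * t)"
      using \<rho>' RM mono AE_completion[OF AE_lborel_singleton[of "0::real"]] AE_completion[OF AE_lborel_singleton[of "1::real"]]
    proof eventually_elim
      case (elim t)
      show ?case
      proof (cases "t \<in> {0<..<1}")
        case True
        let ?\<tau> = "\<tau> (\<epsilon> * t)"
        have h: "h (\<epsilon> * t) = (?\<tau> - T)\<^sup>2" using True \<epsilon> by (simp add: h_def)
        have mon: "R t x \<le> R t y" if "0 < x" "x \<le> y" for x y
          using mono_onD[OF elim(3), of x y] that by auto
        have g0: "0 \<le> R t (T + d) - R t (T - d)" using mon[of "T - d" "T + d"] T by simp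
        have s0: "0 \<le> RM / d\<^sup>2 * (?\<tau> - T)\<^sup>2" using RM0 by simp
        have "\<bar>R t ?\<tau> - R t T\<bar> \<le> (R t (T + d) - R t (T - d)) + RM / d\<^sup>2 * (?\<tau> - T)\<^sup>2"
        proof (cases "\<bar>?\<tau> - T\<bar> \<le> d")
          case True
          then have "R t (T - d) \<le> R t ?\<tau>" "R t ?\<tau> \<le> R t (T + d)" "R t (T - d) \<le> R t T" "R t T \<le> R t (T + d)"
            using T elim(1) by (auto intro!: mon)
          then show ?thesis using s0 by linarith
        next
          case False
          have "d\<^sup>2 \<le> (?\<tau> - T)\<^sup>2" using False T by (simp add: abs_le_square_iff[symmetric])
          then have "RM * 1 \<le> RM * ((?\<tau> - T)\<^sup>2 / d\<^sup>2)" using T RM0 by (intro mult_left_mono) auto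
          moreover have "\<bar>R t ?\<tau> - R t T\<bar> \<le> RM"
            using elim(2)[rule_format, OF conjunct1[OF elim(1)]] elim(2)[rule_format, of T] T by linarith
          ultimately show ?thesis using g0 by simp
        qed
        then show ?thesis using True elim(1) h by simp
      next
        case False
        have "0 \<le> RM / d\<^sup>2 * h (\<epsilon> * t)" using RM0 by (simp add: h_def)
        moreover have "t \<notin> {0..1}" using False elim(4,5) by auto
        ultimately show ?thesis by simp
      qed
    qed
  qed
  also have "\<dots> = (LINT t:{0..1}|lebesgue. R t (T + d) - R t (T - d)) + RM / d\<^sup>2 * ((LINT y:{0<..<\<epsilon>}|lebesgue. (\<tau> y - T)\<^sup>2) / \<epsilon>)"
    using i2 ih Ih by (simp add: set_integrable_def set_lebesgue_integral_def)
  finally show ?thesis .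
qed

text \<open>
  Dominated convergence. The sequence of gaps starts at \<open>T / 2\<close> so that \<open>T - d\<close> stays positive.
\<close>

lemma nonlinearity_oscillation_tendsto_zero:
  fixes R :: "real \<Rightarrow> real \<Rightarrow> real" and T RM :: real
  assumes cont: "AE t in lebesgue. continuous_on {0<..} (R t)"
    and RM: "AE t in lebesgue. \<forall>T>0. R t T \<le> RM \<and> R t T > 0"
    and m: "\<And>T. T > 0 \<Longrightarrow> (\<lambda>t. R t T) \<in> borel_measurable lebesgue" and T: "0 < T"
  shows "(\<lambda>n. LINT t:{0..1}|lebesgue. R t (T + T / real (n + 2)) - R t (T - T / real (n + 2))) \<longlonglongrightarrow> 0"
proof -
  define d where "d n = T / real (n + 2)" for n
  have d: "0 < d n" "d n < T" for n
  proof -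
    show "0 < d n" using T by (simp add: d_def)
    have "T * 1 < T * real (n + 2)" using T by (intro mult_strict_left_mono) auto
    then show "d n < T" by (simp add: d_def pos_divide_less_eq)
  qed
  have d0: "d \<longlonglongrightarrow> 0"
    unfolding d_def by (rule LIMSEQ_ignore_initial_segment[OF lim_const_over_n])
  have "(\<lambda>n. LINT t:{0..1}|lebesgue. R t (T + d n) - R t (T - d n)) \<longlonglongrightarrow> (\<integral>t. (0::real) \<partial>(lebesgue :: real measure))"
    unfolding set_lebesgue_integral_def
  proof (rule integral_dominated_convergence)
    show "integrable lebesgue (\<lambda>t::real. indicat_real {0..1} t * RM)"
      by (intro integrable_mult_left) (auto simp: integrable_indicator_iff)
    show "(\<lambda>t. indicat_real {0..1} t *\<^sub>R (R t (T + d n) - R t (T - d n))) \<in> borel_measurable lebesgue" for n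
      using d[of n] T by (intro borel_measurable_scaleR borel_measurable_indicator borel_measurable_diff m) auto
    show "AE t in lebesgue. norm (indicat_real {0..1} t *\<^sub>R (R t (T + d n) - R t (T - d n))) \<le> indicat_real {0..1} t * RM" for n
      using RM
    proof eventually_elim
      case (elim t)
      have "0 < T + d n" "0 < T - d n" using d[of n] T by auto
      from elim[rule_format, OF this(1)] elim[rule_format, OF this(2)]
      have "\<bar>R t (T + d n) - R t (T - d n)\<bar> \<le> RM" by linarith
      then show ?case by (auto simp: indicator_def)
    qed
    show "AE t in lebesgue. (\<lambda>n. indicat_real {0..1} t *\<^sub>R (R t (T + d n) - R t (T - d n))) \<longlonglongrightarrow> 0"
      using cont
    proof eventually_elim
      case (elim t)
      have l: "(\<lambda>n. R t (T + s * d n)) \<longlonglongrightarrow> R t T" if s: "\<bar>s\<bar> \<le> 1" for s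
      proof (rule continuous_on_tendsto_compose[OF elim])
        have "(\<lambda>n. T + s * d n) \<longlonglongrightarrow> T + s * 0" by (intro tendsto_intros d0)
        then show "(\<lambda>n. T + s * d n) \<longlonglongrightarrow> T" by simp
        have "T + s * d n \<in> {0<..}" for n
        proof -
          have "\<bar>s\<bar> * d n \<le> 1 * d n" using d[of n] s by (intro mult_right_mono) auto
          then have "\<bar>s * d n\<bar> \<le> d n" using d[of n] by (simp add: abs_mult)
          then show ?thesis using d[of n] T by (simp add: abs_le_iff)
        qed
        then show "\<forall>\<^sub>F n in sequentially. T + s * d n \<in> {0<..}" by simp
      qed (use T in auto)
      have "(\<lambda>n. indicat_real {0..1} t *\<^sub>R (R t (T + 1 * d n) - R t (T + (-1) * d n))) \<longlonglongrightarrow> indicat_real {0..1} t *\<^sub>R (R t T - R t T)"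
        by (intro tendsto_intros l) auto
      then show ?case by simp
    qed
  qed auto
  then show ?thesis by (simp add: d_def)
qed

lemma mean_bounds:
  assumes f: "f \<in> borel_measurable lebesgue" "AE y in lebesgue. m \<le> f y \<and> f y \<le> M"
  shows "m \<le> mean f"
proof -
  have i: "set_integrable lebesgue {0..1} f"
  proof (rule set_integrable_ess_bounded[OF f(1)])
    show "AE x in lebesgue. \<bar>f x\<bar> \<le> \<bar>m\<bar> + \<bar>M\<bar>" using f(2) by eventually_elim auto
  qed auto
  have "(LINT t:{0..1::real}|lebesgue. m) \<le> (LINT t:{0..1}|lebesgue. f t)"
  proof (rule set_integral_mono_AE[OF _ i])
    show "set_integrable lebesgue {0..1::real} (\<lambda>_. m)" by (rule continuous_set_integrable_lebesgue) auto
    show "AE x in lebesgue. x \<in> {0..1} \<longrightarrow> m \<le> f x" using f(2) by eventually_elim auto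
  qed
  then show ?thesis by (simp add: set_integral_const_unit mean_def)
qed

text \<open>
  This extracts from the definition of a periodic solution what the rest of the argument uses: a front with classical slope
  \<open>p\<close>, the reaction term \<open>\<rho>\<close> and the estimate for the trace \<open>\<tau>\<close>. Defining \<open>\<rho>\<close> by solving the curvature equation for it
  makes its measurability evident, which is not so for \<open>R (y / \<epsilon>) (\<tau> y)\<close>.
\<close>

lemma solution_trace_estimate:
  assumes \<mu>: "0 < \<mu>" and \<epsilon>: "0 < \<epsilon>" and RM: "0 < RM" and small: "4 * RM * \<epsilon> \<le> \<mu>"
    and a: "a \<in> borel_measurable lebesgue" "AE y in lebesgue. am \<le> a y \<and> a y \<le> aM" "0 < am" "am \<le> aM"
    and b: "b \<in> borel_measurable lebesgue" "AE y in lebesgue. bm \<le> b y \<and> b y \<le> bM" "0 < bm" "bm \<le> bM"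
    and g: "g \<in> borel_measurable lebesgue" "AE y in lebesgue. gm \<le> g y \<and> g y \<le> gM" "0 < gm" "gm \<le> gM"
    and RMae: "AE t in lebesgue. \<forall>T>0. R t T \<le> RM \<and> R t T > 0"
    and sol: "periodic_solution \<mu> a b g R \<epsilon> c v u"
  obtains p q \<rho> \<tau> where
    "\<And>y. (v has_real_derivative p y) (at y)" "bounded_primitive p q" "\<And>y. v (y + \<epsilon>) = v y"
    "\<rho> \<in> borel_measurable lebesgue" "AE y in lebesgue. 0 < \<rho> y \<and> \<rho> y \<le> RM"
    "AE y in lebesgue. 0 < \<tau> y \<and> \<rho> y = R (y / \<epsilon>) (\<tau> y)"
    "AE y in lebesgue. - c + \<rho> y * sqrt (1 + (p y)\<^sup>2) = \<mu> * (q y / (1 + (p y)\<^sup>2))"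
    "\<tau> \<in> borel_measurable lebesgue" "set_integrable lebesgue {0<..<\<epsilon>} (\<lambda>y. (\<tau> y - mean g / mean b)\<^sup>2)"
    "(LINT y:{0<..<\<epsilon>}|lebesgue. (\<tau> y - mean g / mean b)\<^sup>2)
      \<le> 2 * (1 + (bM / bm)\<^sup>2) * (74 + 72 * (2 * RM * gM\<^sup>2 / (am * bm))) * \<epsilon>\<^sup>2"
proof -
  obtain vy q G \<tau> where per: "\<And>y. v (y + \<epsilon>) = v y" and W: "W2inf v vy q" and Hu: "H1_per \<epsilon> v u G"
    and tr: "is_trace \<epsilon> v u G \<tau>"
    and weak: "\<And>w H \<sigma>. H1_per \<epsilon> v w H \<and> is_trace \<epsilon> v w H \<sigma> \<Longrightarrow>
           (LINT z:Dom_per \<epsilon> v|lebesgue. c * b (snd z / \<epsilon>) * fst (G z) * w z + a (snd z / \<epsilon>) * (G z \<bullet> H z)) =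
           (LINT y:{0<..<\<epsilon>}|lebesgue. c * g (y / \<epsilon>) * \<sigma> y)"
    and curv: "AE y in lebesgue. \<tau> y > 0 \<and>
           - c + R (y / \<epsilon>) (\<tau> y) * sqrt (1 + (vy y)\<^sup>2) = \<mu> * (q y / (1 + (vy y)\<^sup>2))"
    using sol unfolding periodic_solution_def by blast
  obtain p where P: "bounded_primitive p q" and vyp: "AE x in lebesgue. vy x = p x"
    and v': "\<And>x. (v has_real_derivative p x) (at x)"
    using W2inf_regularity[OF W] by blast
  have cp: "continuous_on UNIV p" by (rule bounded_primitive_continuous[OF P])
  have pos: "0 < 1 + (p y)\<^sup>2" for y by (simp add: add_pos_nonneg)
  define \<rho> where "\<rho> y = (c + \<mu> * (q y / (1 + (p y)\<^sup>2))) / sqrt (1 + (p y)\<^sup>2)" for y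
  have eq: "- c + \<rho> y * sqrt (1 + (p y)\<^sup>2) = \<mu> * (q y / (1 + (p y)\<^sup>2))" for y
    using pos[of y] by (simp add: \<rho>_def)
  have \<rho>m: "\<rho> \<in> borel_measurable lebesgue"
  proof -
    have 1: "(\<lambda>y. 1 / (1 + (p y)\<^sup>2)) \<in> borel_measurable lebesgue" "(\<lambda>y. 1 / sqrt (1 + (p y)\<^sup>2)) \<in> borel_measurable lebesgue"
      using pos by (intro borel_measurable_lebesgueI borel_measurable_continuous_onI continuous_intros cp; auto simp: less_imp_neq[symmetric])+
    have "(\<lambda>y. (c + \<mu> * (q y * (1 / (1 + (p y)\<^sup>2)))) * (1 / sqrt (1 + (p y)\<^sup>2))) \<in> borel_measurable lebesgue"
      by (intro borel_measurable_times[OF _ 1(2)] borel_measurable_add borel_measurable_const borel_measurable_times[OF borel_measurable_const]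
        borel_measurable_times[OF bounded_primitiveD(1)[OF P] 1(1)])
    then show ?thesis unfolding \<rho>_def by simp
  qed
  have \<rho>R: "AE y in lebesgue. 0 < \<tau> y \<and> \<rho> y = R (y / \<epsilon>) (\<tau> y)"
    using curv vyp
  proof eventually_elim
    case (elim y)
    have "R (y / \<epsilon>) (\<tau> y) * sqrt (1 + (p y)\<^sup>2) = \<rho> y * sqrt (1 + (p y)\<^sup>2)"
      using elim(1) eq[of y] unfolding elim(2) by linarith
    moreover have "sqrt (1 + (p y)\<^sup>2) \<noteq> 0" using pos[of y] by simp
    ultimately have "R (y / \<epsilon>) (\<tau> y) = \<rho> y" by simp
    then show ?case using elim by simp
  qed
  have \<rho>b: "AE y in lebesgue. 0 < \<rho> y \<and> \<rho> y \<le> RM"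
    using \<rho>R AE_lebesgue_scale[OF RMae less_imp_neq[OF \<epsilon>, symmetric]]
  proof eventually_elim
    case (elim y)
    from elim(1) elim(2)[rule_format, OF conjunct1[OF elim(1)]] show ?case by simp
  qed
  note fb = front_bounds[OF \<mu> \<epsilon> RM per v' P \<rho>m \<rho>b AE_I2[OF eq]]
  have p1: "\<bar>p y\<bar> \<le> 1" for y
  proof -
    have "4 * RM * \<epsilon> / \<mu> \<le> 1" using small \<mu> by simp
    then have "(4 * RM * \<epsilon> / \<mu>)\<^sup>2 \<le> 1" using \<mu> \<epsilon> RM by (intro power_le_one) auto
    then have "(p y)\<^sup>2 \<le> 1" using fb(2)[OF small, of y] by simp
    then show ?thesis by (simp add: abs_square_le_1)
  qed
  have v_cont: "continuous_on UNIV v"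
    using v' by (intro continuous_at_imp_continuous_on ballI) (rule DERIV_isCont)
  interpret periodic_cell \<epsilon> v by unfold_locales (use \<epsilon> v_cont per in auto)
  obtain V where V: "\<And>y. \<bar>v y\<bar> \<le> V"
    using continuous_periodic_bounded[OF v_cont per \<epsilon>] by blast
  obtain A where A: "A \<in> borel_measurable borel" "\<And>y. am \<le> A y \<and> A y \<le> aM"
    and Aae: "AE y in lebesgue. a (y / \<epsilon>) = A y" "AE z in lebesgue. a (snd (z :: real \<times> real) / \<epsilon>) = A (snd z)"
    using coefficient_representative[OF a(1,2,4) \<epsilon>] by blast
  obtain B where B: "B \<in> borel_measurable borel" "\<And>y. bm \<le> B y \<and> B y \<le> bM"
    and Bae: "AE y in lebesgue. b (y / \<epsilon>) = B y" "AE z in lebesgue. b (snd (z :: real \<times> real) / \<epsilon>) = B (snd z)"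
    using coefficient_representative[OF b(1,2,4) \<epsilon>] by blast
  obtain \<Gamma> where \<Gamma>: "\<Gamma> \<in> borel_measurable borel" "\<And>y. gm \<le> \<Gamma> y \<and> \<Gamma> y \<le> gM"
    and \<Gamma>ae: "AE y in lebesgue. g (y / \<epsilon>) = \<Gamma> y" "AE z in lebesgue. g (snd (z :: real \<times> real) / \<epsilon>) = \<Gamma> (snd z)"
    using coefficient_representative[OF g(1,2,4) \<epsilon>] by blast
  have ws: "weak_solution c A B \<Gamma> G"
    unfolding weak_solution_def
  proof (intro allI impI)
    fix w H \<sigma> assume w: "H1_per \<epsilon> v w H \<and> is_trace \<epsilon> v w H \<sigma>"
    have "(LINT z:Dom_per \<epsilon> v|lebesgue. c * B (snd z) * fst (G z) * w z + A (snd z) * (G z \<bullet> H z))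
        = (LINT z:Dom_per \<epsilon> v|lebesgue. c * b (snd z / \<epsilon>) * fst (G z) * w z + a (snd z / \<epsilon>) * (G z \<bullet> H z))"
      by (rule set_integral_lebesgue_cong_AE) (use Aae(2) Bae(2) in \<open>eventually_elim, auto\<close>)
    also have "\<dots> = (LINT y:{0<..<\<epsilon>}|lebesgue. c * g (y / \<epsilon>) * \<sigma> y)" by (rule weak[OF w])
    also have "\<dots> = (LINT y:{0<..<\<epsilon>}|lebesgue. c * \<Gamma> y * \<sigma> y)"
      by (rule set_integral_lebesgue_cong_AE) (use \<Gamma>ae(1) in \<open>eventually_elim, auto\<close>)
    finally show "(LINT z:Dom_per \<epsilon> v|lebesgue. c * B (snd z) * fst (G z) * w z + A (snd z) * (G z \<bullet> H z))
      = (LINT y:{0<..<\<epsilon>}|lebesgue. c * \<Gamma> y * \<sigma> y)" .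
  qed
  have edge_mean: "(\<integral>y. F y \<partial>edge) = \<epsilon> * mean f" if "AE y in lebesgue. f (y / \<epsilon>) = F y" for f F
  proof -
    have "(\<integral>y. F y \<partial>edge) = (LINT y:{0..\<epsilon>}|lebesgue. F y)"
      by (simp add: set_integral_lebesgue_on(1)[symmetric] set_integral_open_interval)
    also have "\<dots> = (LINT y:{0..\<epsilon>}|lebesgue. f (y / \<epsilon>))"
      by (rule set_integral_lebesgue_cong_AE) (use that in \<open>eventually_elim, auto\<close>)
    also have "\<dots> = \<epsilon> * mean f"
      using set_integral_scale[OF \<epsilon>, of 0 1 "\<lambda>y. f (y / \<epsilon>)"] \<epsilon> by (simp add: mean_def)
    finally show ?thesis .
  qed
  have bnd: "\<bar>A y\<bar> \<le> aM" "\<bar>B y\<bar> \<le> bM" "\<bar>\<Gamma> y\<bar> \<le> gM" for y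
    using A(2)[of y] B(2)[of y] \<Gamma>(2)[of y] a(3) b(3) g(3) by auto
  have mb: "0 < mean b" using mean_bounds[OF b(1,2)] b(3) by linarith
  let ?T = "mean g / mean b"
  have "(\<integral>y. B y * \<tau> y \<partial>edge) = (\<integral>y. \<Gamma> y \<partial>edge)"
    by (rule heat_balance[OF ws fb(1) tr A(1) bnd(1) B(1) bnd(2) \<Gamma>(1) bnd(3) V])
  also have "\<dots> = ?T * (\<integral>y. B y \<partial>edge)"
    using mb by (simp add: edge_mean[OF \<Gamma>ae(1)] edge_mean[OF Bae(1)])
  finally have bal: "(\<integral>y. B y * \<tau> y \<partial>edge) = ?T * (\<integral>y. B y \<partial>edge)" .
  have \<tau>pos: "AE y in edge. 0 < \<tau> y"
    by (rule AE_lebesgue_onI) (use \<rho>R in \<open>auto elim!: eventually_mono\<close>)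
  define k where "k = 2 * RM * gM\<^sup>2 / (am * bm)"
  have J: "(\<integral>z. (norm (G z))\<^sup>2 \<partial>bulk) \<le> k * \<epsilon>"
  proof -
    have "am * (\<integral>z. (norm (G z))\<^sup>2 \<partial>bulk) \<le> c * (gM\<^sup>2 / bm) * \<epsilon>"
      by (rule dirichlet_energy_bound[OF ws fb(1) tr A a(3) B b(3) \<Gamma> g(3) \<tau>pos V])
    also have "\<dots> \<le> (2 * RM) * (gM\<^sup>2 / bm) * \<epsilon>"
      using fb(3)[OF small] b(3) \<epsilon> by (intro mult_right_mono) auto
    finally show ?thesis using a(3) b(3) by (simp add: k_def field_simps)
  qed
  obtain A0 where A0: "(\<integral>y. (A0 - \<tau> y)\<^sup>2 \<partial>edge) \<le> (74 + 72 * k) * \<epsilon>\<^sup>2"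
    using trace_near_constant[OF tr v' cp p1 J] by blast
  have est: "(\<integral>y. (\<tau> y - ?T)\<^sup>2 \<partial>edge) \<le> 2 * (1 + (bM / bm)\<^sup>2) * (74 + 72 * k) * \<epsilon>\<^sup>2"
    by (rule trace_near_limit_temperature[OF tr bal B b(3) A0])
  have sq: "square_integrable edge (\<lambda>y. \<tau> y - ?T)"
    by (rule square_integrable_diff[OF trace_square_integrable[OF tr]]) (rule continuous_edge_square_integrable, auto)
  show ?thesis
  proof (rule that[OF v' P per \<rho>m \<rho>b \<rho>R AE_I2[OF eq]])
    show "\<tau> \<in> borel_measurable lebesgue" using tr by (simp add: is_trace_def)
    show "set_integrable lebesgue {0<..<\<epsilon>} (\<lambda>y. (\<tau> y - ?T)\<^sup>2)"
      using sq by (simp add: square_integrable_def set_integral_lebesgue_on(2))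
    show "(LINT y:{0<..<\<epsilon>}|lebesgue. (\<tau> y - ?T)\<^sup>2) \<le> 2 * (1 + (bM / bm)\<^sup>2) * (74 + 72 * (2 * RM * gM\<^sup>2 / (am * bm))) * \<epsilon>\<^sup>2"
      using est by (simp add: set_integral_lebesgue_on(1) k_def)
  qed
qed

section \<open>Convergence of the fronts\<close>

lemma admissible_coeffE:
  assumes "admissible_coeff f"
  obtains m M where "f \<in> borel_measurable lebesgue" "AE y in lebesgue. m \<le> f y \<and> f y \<le> M" "0 < m" "m \<le> M"
proof -
  obtain M m where "m \<le> M" "0 < m" "AE y in lebesgue. M \<ge> f y \<and> f y \<ge> m" "f \<in> borel_measurable lebesgue"
    using assms unfolding admissible_coeff_def by blast
  then show ?thesis using that[of m M] by (auto elim!: eventually_mono)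
qed

lemma Linf_norm_nonneg: "0 \<le> Linf_norm f"
proof -
  have "AE y in lebesgue. ereal \<bar>f y\<bar> \<le> Linf_norm f" unfolding Linf_norm_def by (rule esssup_AE)
  then have "\<exists>y. ereal \<bar>f y\<bar> \<le> Linf_norm f" by (rule eventually_happens'[rotated]) (simp add: ae_filter_eq_bot_iff)
  then show ?thesis by (meson abs_ge_zero ereal_less_eq(5) order_trans)
qed

text \<open>
  First \<open>d\<close> is chosen so small that the oscillation of \<open>R\<close> between \<open>T - d\<close> and \<open>T + d\<close> is small in the mean; for that fixed
  \<open>d\<close> all remaining terms tend to zero with \<open>\<epsilon>\<close>.
\<close>

lemma uniform_convergence:
  assumes \<mu>: "0 < \<mu>" and co: "admissible_coeff a" "admissible_coeff b" "admissible_coeff g" and R: "admissible_R R"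
    and sol: "\<And>\<epsilon>. \<epsilon> \<in> {0<..\<epsilon>\<^sub>0} \<Longrightarrow> periodic_solution \<mu> a b g R \<epsilon> (c \<epsilon>) (v \<epsilon>) (u \<epsilon>)"
    and v0: "\<And>\<epsilon>. \<epsilon> \<in> {0<..\<epsilon>\<^sub>0} \<Longrightarrow> 1 / \<epsilon> * (LINT y:{0..\<epsilon>}|lebesgue. v \<epsilon> y) = 0"
    and \<epsilon>0: "0 < \<epsilon>\<^sub>0" and Q: "is_profile \<mu> R (mean g / mean b) Q" and e: "0 < e"
  shows "\<forall>\<^sub>F \<epsilon> in at_right 0. \<epsilon> \<in> {0<..\<epsilon>\<^sub>0} \<and> (\<forall>y. \<bar>v \<epsilon> y - \<epsilon>\<^sup>2 * Q (y / \<epsilon>)\<bar> \<le> e * \<epsilon>\<^sup>2)"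
proof -
  obtain am aM where a: "a \<in> borel_measurable lebesgue" "AE y in lebesgue. am \<le> a y \<and> a y \<le> aM" "0 < am" "am \<le> aM"
    by (rule admissible_coeffE[OF co(1)])
  obtain bm bM where b: "b \<in> borel_measurable lebesgue" "AE y in lebesgue. bm \<le> b y \<and> b y \<le> bM" "0 < bm" "bm \<le> bM"
    by (rule admissible_coeffE[OF co(2)])
  obtain gm gM where g: "g \<in> borel_measurable lebesgue" "AE y in lebesgue. gm \<le> g y \<and> g y \<le> gM" "0 < gm" "gm \<le> gM"
    by (rule admissible_coeffE[OF co(3)])
  obtain RM where RM: "0 < RM" and RMae: "AE t in lebesgue. \<forall>T>0. R t T \<le> RM \<and> R t T > 0"
    using R unfolding admissible_R_def by blast
  have cont: "AE t in lebesgue. continuous_on {0<..} (R t)" and mono: "AE t in lebesgue. mono_on {0<..} (R t)"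
    using R unfolding admissible_R_def by (auto elim!: eventually_mono)
  have m: "(\<lambda>t. R t T) \<in> borel_measurable lebesgue" if "0 < T" for T using R that unfolding admissible_R_def by blast
  define T where "T = mean g / mean b"
  have T: "0 < T" unfolding T_def using mean_bounds[OF b(1,2)] mean_bounds[OF g(1,2)] b(3) g(3) by (intro divide_pos_pos) auto
  obtain Qz where W: "W2inf Q Qz (\<lambda>z. 1 / \<mu> * (R z T - mean (\<lambda>t. R t T)))" and Qper: "\<And>z. Q (z + 1) = Q z" and Qm: "mean Q = 0"
    using Q unfolding is_profile_def T_def by blast
  obtain D where D: "bounded_primitive D (\<lambda>z. 1 / \<mu> * (R z T - mean (\<lambda>t. R t T)))" "\<And>z. (Q has_real_derivative D z) (at z)"
    using W2inf_regularity[OF W] by blast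
  have RT: "AE t in lebesgue. \<bar>R t T\<bar> \<le> RM"
    using RMae
  proof eventually_elim
    case (elim t)
    from elim[rule_format, OF T] show ?case by simp
  qed
  define K where "K = 2 * (1 + (bM / bm)\<^sup>2) * (74 + 72 * (2 * RM * gM\<^sup>2 / (am * bm)))"
  define \<omega> where "\<omega> d = (LINT t:{0..1}|lebesgue. R t (T + d) - R t (T - d))" for d
  have est: "\<bar>v \<epsilon> y - \<epsilon>\<^sup>2 * Q (y / \<epsilon>)\<bar>
      \<le> \<epsilon>\<^sup>2 * (1 / \<mu> * (6 * RM * (4 * RM * \<epsilon> / \<mu>)\<^sup>2 + 2 * (\<omega> d + RM / d\<^sup>2 * (K * \<epsilon>))))"
    if \<epsilon>: "\<epsilon> \<in> {0<..\<epsilon>\<^sub>0}" and small: "4 * RM * \<epsilon> \<le> \<mu>" and d: "0 < d" "d < T" for \<epsilon> y d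
  proof -
    have \<epsilon>pos: "0 < \<epsilon>" using \<epsilon> by simp
    have vm: "(LINT y:{0..\<epsilon>}|lebesgue. v \<epsilon> y) = 0" using v0[OF \<epsilon>] \<epsilon>pos by simp
    obtain p q \<rho> \<tau> where v': "\<And>y. (v \<epsilon> has_real_derivative p y) (at y)" and P: "bounded_primitive p q"
      and per: "\<And>y. v \<epsilon> (y + \<epsilon>) = v \<epsilon> y"
      and \<rho>: "\<rho> \<in> borel_measurable lebesgue" "AE y in lebesgue. 0 < \<rho> y \<and> \<rho> y \<le> RM"
      and \<rho>R: "AE y in lebesgue. 0 < \<tau> y \<and> \<rho> y = R (y / \<epsilon>) (\<tau> y)"
      and eq: "AE y in lebesgue. - c \<epsilon> + \<rho> y * sqrt (1 + (p y)\<^sup>2) = \<mu> * (q y / (1 + (p y)\<^sup>2))"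
      and \<tau>: "\<tau> \<in> borel_measurable lebesgue" and i\<tau>: "set_integrable lebesgue {0<..<\<epsilon>} (\<lambda>y. (\<tau> y - mean g / mean b)\<^sup>2)"
      and L: "(LINT y:{0<..<\<epsilon>}|lebesgue. (\<tau> y - mean g / mean b)\<^sup>2)
      \<le> 2 * (1 + (bM / bm)\<^sup>2) * (74 + 72 * (2 * RM * gM\<^sup>2 / (am * bm))) * \<epsilon>\<^sup>2"
    proof (rule solution_trace_estimate[OF \<mu> \<epsilon>pos RM small a b g RMae sol[OF \<epsilon>]], goal_cases)
      case (1 p q \<rho> \<tau>)
      from 1(2-11) show ?case by (rule 1(1))
    qed
    have "(LINT t:{0..1}|lebesgue. \<bar>\<rho> (\<epsilon> * t) - R t T\<bar>)
        \<le> \<omega> d + RM / d\<^sup>2 * ((LINT y:{0<..<\<epsilon>}|lebesgue. (\<tau> y - T)\<^sup>2) / \<epsilon>)"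
      unfolding \<omega>_def by (rule nonlinearity_distance[OF mono RMae m d \<epsilon>pos \<tau> \<rho>(1) \<rho>R i\<tau>[folded T_def]])
    also have "\<dots> \<le> \<omega> d + RM / d\<^sup>2 * (K * \<epsilon>\<^sup>2 / \<epsilon>)"
      using L RM \<epsilon>pos by (intro add_left_mono mult_left_mono divide_right_mono) (auto simp: K_def T_def)
    also have "K * \<epsilon>\<^sup>2 / \<epsilon> = K * \<epsilon>" using \<epsilon>pos by (simp add: power2_eq_square)
    finally have \<eta>: "(LINT t:{0..1}|lebesgue. \<bar>\<rho> (\<epsilon> * t) - R t T\<bar>) \<le> \<omega> d + RM / d\<^sup>2 * (K * \<epsilon>)" .
    have "\<bar>v \<epsilon> y - \<epsilon>\<^sup>2 * Q (y / \<epsilon>)\<bar>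
      \<le> \<epsilon>\<^sup>2 * (1 / \<mu> * (6 * RM * (4 * RM * \<epsilon> / \<mu>)\<^sup>2 + 2 * (LINT t:{0..1}|lebesgue. \<bar>\<rho> (\<epsilon> * t) - R t T\<bar>)))"
      using front_profile_distance[OF \<mu> \<epsilon>pos RM small per v' P vm \<rho> eq m[OF T] RT Qper _ D(2)] Qm D(1)
      by (simp add: mean_def)
    also have "\<dots> \<le> \<epsilon>\<^sup>2 * (1 / \<mu> * (6 * RM * (4 * RM * \<epsilon> / \<mu>)\<^sup>2 + 2 * (\<omega> d + RM / d\<^sup>2 * (K * \<epsilon>))))"
      using \<eta> \<mu> by (intro mult_left_mono add_left_mono) auto
    finally show ?thesis .
  qed
  have "(\<lambda>n. 1 / \<mu> * (2 * \<omega> (T / real (n + 2)))) \<longlonglongrightarrow> 1 / \<mu> * (2 * 0)"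
    unfolding \<omega>_def by (intro tendsto_intros nonlinearity_oscillation_tendsto_zero[OF cont RMae m T])
  then have "\<forall>\<^sub>F n in sequentially. 1 / \<mu> * (2 * \<omega> (T / real (n + 2))) < e / 2"
    by (rule order_tendstoD(2)) (use e in simp)
  then obtain n where n: "1 / \<mu> * (2 * \<omega> (T / real (n + 2))) < e / 2"
    by (auto simp: eventually_sequentially)
  define d where "d = T / real (n + 2)"
  have d: "0 < d" "d < T"
  proof -
    show "0 < d" using T by (simp add: d_def)
    have "T * 1 < T * real (n + 2)" using T by (intro mult_strict_left_mono) auto
    then show "d < T" by (simp add: d_def pos_divide_less_eq)
  qed
  define f where "f \<epsilon> = 1 / \<mu> * (6 * RM * (4 * RM * \<epsilon> / \<mu>)\<^sup>2 + 2 * (RM / d\<^sup>2 * (K * \<epsilon>)))" for \<epsilon> :: real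
  have "(f \<longlongrightarrow> f 0) (at_right 0)"
    unfolding f_def using \<mu> d by (intro tendsto_intros) auto
  then have "\<forall>\<^sub>F \<epsilon> in at_right 0. f \<epsilon> < e / 2"
    by (rule order_tendstoD(2)) (use e in \<open>simp add: f_def\<close>)
  moreover have "\<forall>\<^sub>F \<epsilon> in at_right 0. \<epsilon> \<in> {0<..<min \<epsilon>\<^sub>0 (\<mu> / (4 * RM))}"
    using \<epsilon>0 \<mu> RM by (intro eventually_at_right_real) auto
  ultimately show ?thesis
  proof eventually_elim
    case (elim \<epsilon>)
    have \<epsilon>: "\<epsilon> \<in> {0<..\<epsilon>\<^sub>0}" using elim by auto
    have small: "4 * RM * \<epsilon> \<le> \<mu>" using elim RM by (simp add: field_simps)
    have "\<bar>v \<epsilon> y - \<epsilon>\<^sup>2 * Q (y / \<epsilon>)\<bar> \<le> e * \<epsilon>\<^sup>2" for y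
    proof -
      have "1 / \<mu> * (6 * RM * (4 * RM * \<epsilon> / \<mu>)\<^sup>2 + 2 * (\<omega> d + RM / d\<^sup>2 * (K * \<epsilon>))) = 1 / \<mu> * (2 * \<omega> d) + f \<epsilon>"
        by (simp add: f_def algebra_simps)
      also have "\<dots> \<le> e" using n elim by (simp add: d_def)
      finally have "\<epsilon>\<^sup>2 * (1 / \<mu> * (6 * RM * (4 * RM * \<epsilon> / \<mu>)\<^sup>2 + 2 * (\<omega> d + RM / d\<^sup>2 * (K * \<epsilon>)))) \<le> \<epsilon>\<^sup>2 * e"
        by (intro mult_left_mono) auto
      then show ?thesis using est[OF \<epsilon> small d, of y] by (simp add: mult.commute)
    qed
    then show ?case using \<epsilon> by blast
  qed
qed

lemma profile_exists_unique:
  assumes \<mu>: "0 < \<mu>" and R: "admissible_R R" and T: "0 < T"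
  shows "\<exists>!Q. is_profile \<mu> R T Q"
proof -
  obtain RM where RM: "0 < RM" and RMae: "AE t in lebesgue. \<forall>T>0. R t T \<le> RM \<and> R t T > 0"
    using R unfolding admissible_R_def by blast
  have m: "(\<lambda>t. R t T) \<in> borel_measurable lebesgue" and per: "R (t + 1) T = R t T" for t
    using R T unfolding admissible_R_def by blast+
  have b: "AE t in lebesgue. \<bar>R t T\<bar> \<le> RM"
    using RMae
  proof eventually_elim
    case (elim t)
    from elim[rule_format, OF T] show ?case by simp
  qed
  let ?r = "\<lambda>z. 1 / \<mu> * (R z T - mean (\<lambda>t. R t T))"
  have i: "set_integrable lebesgue {0..1} (\<lambda>t. R t T)" by (rule set_integrable_ess_bounded[OF m b]) auto
  have ic: "set_integrable lebesgue {0..1::real} (\<lambda>_. k :: real)" for k by (rule continuous_set_integrable_lebesgue) auto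
  have mean0: "(LINT t:{0..1}|lebesgue. ?r t) = 0"
  proof -
    have "(LINT t:{0..1}|lebesgue. R t T - mean (\<lambda>t. R t T)) = mean (\<lambda>t. R t T) - (LINT t:{0..1::real}|lebesgue. mean (\<lambda>t. R t T))"
      by (subst set_integral_diff(2)[OF i ic]) (simp add: mean_def)
    then show ?thesis by (simp add: set_integral_const_unit)
  qed
  have rb: "AE t in lebesgue. \<bar>?r t\<bar> \<le> 1 / \<mu> * (RM + \<bar>mean (\<lambda>t. R t T)\<bar>)"
    using b
  proof eventually_elim
    case (elim t)
    have "\<bar>?r t\<bar> = 1 / \<mu> * \<bar>R t T - mean (\<lambda>t. R t T)\<bar>" using \<mu> by (simp add: abs_mult)
    also have "\<dots> \<le> 1 / \<mu> * (RM + \<bar>mean (\<lambda>t. R t T)\<bar>)" using elim \<mu> by (intro mult_left_mono) auto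
    finally show ?case .
  qed
  have rm: "?r \<in> borel_measurable lebesgue" using m by (intro borel_measurable_times borel_measurable_diff) auto
  obtain Q Qz where "W2inf Q Qz ?r" "\<forall>z. Q (z + 1) = Q z" "(LINT t:{0..1}|lebesgue. Q t) = 0"
    using periodic_profile_exists[OF rm rb _ mean0] per by auto
  then have "is_profile \<mu> R T Q" by (auto simp: is_profile_def mean_def)
  moreover have "Q1 = Q2" if Q: "is_profile \<mu> R T Q1" "is_profile \<mu> R T Q2" for Q1 Q2
  proof -
    obtain P1 P2 where "W2inf Q1 P1 ?r" "W2inf Q2 P2 ?r" using Q unfolding is_profile_def by blast
    then show ?thesis using Q unfolding is_profile_def mean_def
      by (intro periodic_profile_unique[of Q1 P1 ?r Q2 P2]) (auto simp: mean_def)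
  qed
  ultimately show ?thesis by blast
qed

theorem theorem13:
  fixes a b g :: "real \<Rightarrow> real" and R :: "real \<Rightarrow> real \<Rightarrow> real"
    and \<mu> \<epsilon>\<^sub>0 :: real
    and c :: "real \<Rightarrow> real" and v :: "real \<Rightarrow> real \<Rightarrow> real" and u :: "real \<Rightarrow> real \<times> real \<Rightarrow> real"
  assumes "\<mu> > 0"
    and "admissible_coeff a" "admissible_coeff b" "admissible_coeff g" "admissible_R R"
    and "\<epsilon>\<^sub>0 > 0"
    and "\<And>\<epsilon>. \<epsilon> \<in> {0<..\<epsilon>\<^sub>0} \<Longrightarrow> periodic_solution \<mu> a b g R \<epsilon> (c \<epsilon>) (v \<epsilon>) (u \<epsilon>)"
    and "\<And>\<epsilon>. \<epsilon> \<in> {0<..\<epsilon>\<^sub>0} \<Longrightarrow> 1 / \<epsilon> * (LINT y:{0..\<epsilon>}|lebesgue. v \<epsilon> y) = 0"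
  shows "(\<exists>!Q. is_profile \<mu> R (mean g / mean b) Q) \<and>
    (\<forall>Q. is_profile \<mu> R (mean g / mean b) Q \<longrightarrow>
      (\<exists>rem :: real \<Rightarrow> real \<Rightarrow> real.
        (\<forall>\<epsilon>\<in>{0<..\<epsilon>\<^sub>0}. \<forall>y. v \<epsilon> y = \<epsilon>\<^sup>2 * Q (y / \<epsilon>) + rem \<epsilon> y) \<and>
        (\<forall>p\<ge>1. \<forall>r>0.
          ((\<lambda>\<epsilon>. 1 / \<epsilon>\<^sup>2 * (LINT y:{-r..r}|lebesgue. \<bar>rem \<epsilon> y\<bar> powr p) powr (1 / p)) \<longlongrightarrow> 0)
            (at_right 0)) \<and>
        (((\<lambda>T. Linf_norm (\<lambda>y. R y T - R y (mean g / mean b))) \<longlongrightarrow> 0)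
            (at (mean g / mean b) within {0<..}) \<longrightarrow>
          ((\<lambda>\<epsilon>. Linf_norm (\<lambda>y. rem \<epsilon> y / \<epsilon>\<^sup>2)) \<longlongrightarrow> 0) (at_right 0))))"
proof (intro conjI allI impI)
  obtain bm bM where b: "b \<in> borel_measurable lebesgue" "AE y in lebesgue. bm \<le> b y \<and> b y \<le> bM" "0 < bm" "bm \<le> bM"
    by (rule admissible_coeffE[OF assms(3)])
  obtain gm gM where g: "g \<in> borel_measurable lebesgue" "AE y in lebesgue. gm \<le> g y \<and> g y \<le> gM" "0 < gm" "gm \<le> gM"
    by (rule admissible_coeffE[OF assms(4)])
  have "0 < mean g / mean b" using mean_bounds[OF b(1,2)] mean_bounds[OF g(1,2)] b(3) g(3) by (intro divide_pos_pos) auto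
  then show "\<exists>!Q. is_profile \<mu> R (mean g / mean b) Q" by (rule profile_exists_unique[OF assms(1,5)])
next
  fix Q assume Q: "is_profile \<mu> R (mean g / mean b) Q"
  define rem where "rem \<epsilon> y = v \<epsilon> y - \<epsilon>\<^sup>2 * Q (y / \<epsilon>)" for \<epsilon> y
  have unif: "\<forall>\<^sub>F \<epsilon> in at_right 0. \<epsilon> \<in> {0<..\<epsilon>\<^sub>0} \<and> (\<forall>y. \<bar>rem \<epsilon> y\<bar> \<le> e * \<epsilon>\<^sup>2)" if "0 < e" for e
    unfolding rem_def by (rule uniform_convergence[OF assms(1-5,7,8,6) Q that])
  have cQ: "continuous_on UNIV Q" using Q by (auto simp: is_profile_def W2inf_def)
  have mrem: "rem \<epsilon> \<in> borel_measurable borel" if "\<epsilon> \<in> {0<..\<epsilon>\<^sub>0}" for \<epsilon>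
  proof -
    have "continuous_on UNIV (v \<epsilon>)" using assms(7)[OF that] by (auto simp: periodic_solution_def W2inf_def)
    then have "continuous_on UNIV (rem \<epsilon>)"
      unfolding rem_def using that by (intro continuous_intros continuous_on_compose2[OF cQ]) auto
    then show ?thesis by (rule borel_measurable_continuous_onI)
  qed
  show "\<exists>rem :: real \<Rightarrow> real \<Rightarrow> real.
        (\<forall>\<epsilon>\<in>{0<..\<epsilon>\<^sub>0}. \<forall>y. v \<epsilon> y = \<epsilon>\<^sup>2 * Q (y / \<epsilon>) + rem \<epsilon> y) \<and>
        (\<forall>p\<ge>1. \<forall>r>0.
          ((\<lambda>\<epsilon>. 1 / \<epsilon>\<^sup>2 * (LINT y:{-r..r}|lebesgue. \<bar>rem \<epsilon> y\<bar> powr p) powr (1 / p)) \<longlongrightarrow> 0)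
            (at_right 0)) \<and>
        (((\<lambda>T. Linf_norm (\<lambda>y. R y T - R y (mean g / mean b))) \<longlongrightarrow> 0)
            (at (mean g / mean b) within {0<..}) \<longrightarrow>
          ((\<lambda>\<epsilon>. Linf_norm (\<lambda>y. rem \<epsilon> y / \<epsilon>\<^sup>2)) \<longlongrightarrow> 0) (at_right 0))"
  proof (intro exI[of _ rem] conjI ballI allI impI)
    show "v \<epsilon> y = \<epsilon>\<^sup>2 * Q (y / \<epsilon>) + rem \<epsilon> y" for \<epsilon> y by (simp add: rem_def)
  next
    fix p r :: real assume p: "1 \<le> p" and r: "0 < r"
    show "((\<lambda>\<epsilon>. 1 / \<epsilon>\<^sup>2 * (LINT y:{-r..r}|lebesgue. \<bar>rem \<epsilon> y\<bar> powr p) powr (1 / p)) \<longlongrightarrow> 0) (at_right 0)"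
    proof (rule tendstoI)
      fix e :: real assume e: "0 < e"
      define k where "k = (2 * r) powr (1 / p)"
      have k: "0 < k" using r by (simp add: k_def)
      have "0 < e / (2 * k)" using e k by simp
      from unif[OF this]
      show "\<forall>\<^sub>F \<epsilon> in at_right 0. dist (1 / \<epsilon>\<^sup>2 * (LINT y:{-r..r}|lebesgue. \<bar>rem \<epsilon> y\<bar> powr p) powr (1 / p)) 0 < e"
      proof eventually_elim
        case (elim \<epsilon>)
        have \<epsilon>: "0 < \<epsilon>" using elim by simp
        define s where "s = e / (2 * k) * \<epsilon>\<^sup>2"
        have s: "0 \<le> s" using e k by (simp add: s_def)
        have [measurable]: "rem \<epsilon> \<in> borel_measurable borel" using elim by (intro mrem) auto
        have "\<bar>LINT y:{-r..r}|lebesgue. \<bar>rem \<epsilon> y\<bar> powr p\<bar> \<le> s powr p * (r - (-r))"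
        proof (rule set_integral_abs_le_const)
          show "(\<lambda>y. \<bar>rem \<epsilon> y\<bar> powr p) \<in> borel_measurable lebesgue"
            by (rule borel_measurable_lebesgueI) measurable
          show "AE y in lebesgue. y \<in> {-r..r} \<longrightarrow> \<bar>\<bar>rem \<epsilon> y\<bar> powr p\<bar> \<le> s powr p"
            using elim p by (auto simp: s_def intro!: powr_mono2)
        qed (use r in auto)
        then have le: "(LINT y:{-r..r}|lebesgue. \<bar>rem \<epsilon> y\<bar> powr p) \<le> s powr p * (2 * r)" by simp
        have nn: "0 \<le> (LINT y:{-r..r}|lebesgue. \<bar>rem \<epsilon> y\<bar> powr p)"
          unfolding set_lebesgue_integral_def by (intro Bochner_Integration.integral_nonneg) auto
        have "(LINT y:{-r..r}|lebesgue. \<bar>rem \<epsilon> y\<bar> powr p) powr (1 / p) \<le> (s powr p * (2 * r)) powr (1 / p)"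
          using p by (intro powr_mono2 le nn) auto
        also have "\<dots> = (s powr p) powr (1 / p) * k" using r by (simp add: powr_mult k_def)
        also have "(s powr p) powr (1 / p) = s" using p s by (simp add: powr_powr)
        also have "s * k = e / 2 * \<epsilon>\<^sup>2" using k by (simp add: s_def)
        finally have "1 / \<epsilon>\<^sup>2 * (LINT y:{-r..r}|lebesgue. \<bar>rem \<epsilon> y\<bar> powr p) powr (1 / p) \<le> e / 2"
          using \<epsilon> by (simp add: field_simps)
        moreover have "0 \<le> 1 / \<epsilon>\<^sup>2 * (LINT y:{-r..r}|lebesgue. \<bar>rem \<epsilon> y\<bar> powr p) powr (1 / p)" by simp
        ultimately show ?case using e unfolding dist_real_def by linarith
      qed
    qed
  next
    show "((\<lambda>\<epsilon>. Linf_norm (\<lambda>y. rem \<epsilon> y / \<epsilon>\<^sup>2)) \<longlongrightarrow> 0) (at_right 0)"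
    proof (rule order_tendstoI)
      fix x :: ereal assume "x < 0"
      then show "\<forall>\<^sub>F \<epsilon> in at_right 0. x < Linf_norm (\<lambda>y. rem \<epsilon> y / \<epsilon>\<^sup>2)"
        using Linf_norm_nonneg less_le_trans by (intro always_eventually) blast
    next
      fix x :: ereal assume "0 < x"
      then obtain e where e: "0 < ereal e" "ereal e < x" using ereal_dense2 by blast
      then have "0 < e" by simp
      from unif[OF this] show "\<forall>\<^sub>F \<epsilon> in at_right 0. Linf_norm (\<lambda>y. rem \<epsilon> y / \<epsilon>\<^sup>2) < x"
      proof eventually_elim
        case (elim \<epsilon>)
        have [measurable]: "rem \<epsilon> \<in> borel_measurable borel" using elim by (intro mrem) auto
        have "Linf_norm (\<lambda>y. rem \<epsilon> y / \<epsilon>\<^sup>2) \<le> ereal e"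
        proof (rule Linf_norm_le)
          show "(\<lambda>y. rem \<epsilon> y / \<epsilon>\<^sup>2) \<in> borel_measurable lebesgue"
            by (rule borel_measurable_lebesgueI) measurable
          show "AE y in lebesgue. \<bar>rem \<epsilon> y / \<epsilon>\<^sup>2\<bar> \<le> e"
            using elim by (auto simp: field_simps)
        qed
        then show ?case using e(2) by (rule le_less_trans)
      qed
    qed
  qed
qed

end
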